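(* Let $(\mathcal{V},\mathcal{E})$ be a finite directed graph whose adjacency matrix $M$ is irreducible and is not a permutation matrix, let $(X,\sigma)$ be the associated one-sided shift of finite type, let $G$ be the étale groupoid of $(X,\sigma)$, and let $Y\subset X$ be a non-empty clopen subset. Let $\mathcal{T}\subset[[G|Y]]$ be the set of all transpositions. Then the group $[[G|Y]]_0$ is generated by finitely many elements of $\mathcal{T}$.
   Context: Étale groupoids: an étale groupoid is a second countable locally compact Hausdorff topological groupoid $G$ whose range map is a local homeomorphism. $G^{(0)}$ is the unit space, $s,r$ are the source and range maps, and $gh$ is defined when $s(g)=r(h)$. For an open set $Y\subset G^{(0)}$, $G|Y=r^{-1}(Y)\cap s^{-1}(Y)$ is the reduction, an étale groupoid with unit space $Y$. A $G$-set is a subset $U\subset G$ such that $r|U$ and $s|U$ are injective; for an open $G$-set $U$, $\pi_U=r\circ(s|U)^{-1}:s(U)\to r(U)$. When $G^{(0)}$ is compact, the topological full group $[[G]]$ is the group of all $\alpha\in\mathrm{Homeo}(G^{(0)})$ for which there is a compact open $G$-set $U$ with $\alpha=\pi_U$ (so $s(U)=r(U)=G^{(0)}$); for the groupoids considered here (which are essentially principal, i.e. the interior of $\{g\in G\mid r(g)=s(g)\}$ is $G^{(0)}$) this $U$ is unique. $\mathrm{supp}(\alpha)$ is the closure of $\{x\mid\alpha(x)\neq x\}$. Homology: $C_c(Y,\mathbb{Z})$ is the group of compactly supported continuous functions $Y\to\mathbb{Z}$. For a local homeomorphism $\pi:Y\to Z$, $\pi_*(f)(z)=\sum_{\pi(y)=z}f(y)$.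 Let $G^{(2)}$ be the space of pairs $(g_1,g_2)$ with $s(g_1)=r(g_2)$, and $d_0(g_1,g_2)=g_2$, $d_1(g_1,g_2)=g_1g_2$, $d_2(g_1,g_2)=g_1$. Put $\delta_1=s_*-r_*:C_c(G,\mathbb{Z})\to C_c(G^{(0)},\mathbb{Z})$ and $\delta_2=d_{0*}-d_{1*}+d_{2*}:C_c(G^{(2)},\mathbb{Z})\to C_c(G,\mathbb{Z})$. Then $H_1(G)=\ker\delta_1/\mathrm{Im}\,\delta_2$. The index map is the homomorphism $I:[[G]]\to H_1(G)$, $I(\pi_U)=[1_U]$ ($1_U$ the characteristic function of the compact open $G$-set $U$), and $[[G]]_0=\ker I$. These definitions are applied to $G|Y$. Transpositions: $\alpha\in[[G|Y]]$ is a transposition if there is a clopen set $A\subset Y$ such that $A\cap\alpha(A)=\emptyset$, $\mathrm{supp}(\alpha)=A\cup\alpha(A)$ and $\alpha^2=1$. Shifts of finite type: $\mathbb{N}=\{1,2,\dots\}$. For $e\in\mathcal{E}$, $i(e)$ and $t(e)$ are the initial and terminal vertices. $M(\xi,\eta)=\#\{e\in\mathcal{E}\mid i(e)=\xi,\ t(e)=\eta\}$; $M$ is irreducible if for all $\xi,\eta\in\mathcal{V}$ there is $n\in\mathbb{N}$ with $M^n(\xi,\eta)>0$. $X=\{(x_k)_{k\in\mathbb{N}}\in\mathcal{E}^{\mathbb{N}}\mid t(x_k)=i(x_{k+1})\ \forall k\}$ with the product topology (a Cantor set), and $\sigma:X\to X$, $\sigma(x)_k=x_{k+1}$. The étale groupoid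 of $(X,\sigma)$ is $G=\{(x,n,y)\in X\times\mathbb{Z}\times X\mid\exists k,l\in\mathbb{N},\ n=k-l,\ \sigma^k(x)=\sigma^l(y)\}$, with product $(x,n,y)(y,n',y')=(x,n+n',y')$, inverse $(x,n,y)^{-1}=(y,-n,x)$, and topology generated by the sets $\{(x,k-l,y)\in G\mid x\in A,\ y\in B,\ \sigma^k(x)=\sigma^l(y)\}$ for $A,B\subset X$ open and $k,l\in\mathbb{N}$. $X$ is identified with $G^{(0)}$ via $x\mapsto(x,0,x)$. *)

theory Defs
  imports
    "Graph_Theory.Digraph"
    "HOL-Algebra.Bij"
    "HOL-Algebra.Generated_Groups"
    "HOL-Analysis.Analysis"
begin

section \<open>Topological groupoids\<close>

text \<open>
  A groupoid is given by its space of arrows, the composition and the inversion. The composition is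
  a total HOL function, of which only the values on composable pairs matter. The unit space
  consists of arrows and carries the subspace topology.
\<close>

record 'g top_groupoid =
  arrow_top :: "'g topology"
  gcomp :: "'g \<Rightarrow> 'g \<Rightarrow> 'g"
  ginv :: "'g \<Rightarrow> 'g"

definition rng :: "'g top_groupoid \<Rightarrow> 'g \<Rightarrow> 'g" where
  "rng G g = gcomp G g (ginv G g)"

definition src :: "'g top_groupoid \<Rightarrow> 'g \<Rightarrow> 'g" where
  "src G g = gcomp G (ginv G g) g"

definition unit_space :: "'g top_groupoid \<Rightarrow> 'g set" where
  "unit_space G = rng G ` topspace (arrow_top G)"

definition unit_top :: "'g top_groupoid \<Rightarrow> 'g topology" where
  "unit_top G = subtopology (arrow_top G) (unit_space G)"

definition composable_top :: "'g top_groupoid \<Rightarrow> ('g \<times> 'g) topology" where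
  "composable_top G =
     subtopology (prod_topology (arrow_top G) (arrow_top G)) {(g, h). src G g = rng G h}"

definition reduction :: "'g top_groupoid \<Rightarrow> 'g set \<Rightarrow> 'g top_groupoid" where
  "reduction G Y =
     G\<lparr>arrow_top := subtopology (arrow_top G) {g. rng G g \<in> Y \<and> src G g \<in> Y}\<rparr>"

section \<open>Topological full groups\<close>

definition compact_open_G_set :: "'g top_groupoid \<Rightarrow> 'g set \<Rightarrow> bool" where
  "compact_open_G_set G U \<longleftrightarrow>
     compactin (arrow_top G) U \<and> openin (arrow_top G) U \<and> inj_on (rng G) U \<and> inj_on (src G) U"

definition G_set_map :: "'g top_groupoid \<Rightarrow> 'g set \<Rightarrow> 'g \<Rightarrow> 'g" where
  "G_set_map G U = (\<lambda>x \<in> src G ` U. rng G (the_inv_into U (src G) x))"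

definition represents :: "'g top_groupoid \<Rightarrow> 'g set \<Rightarrow> ('g \<Rightarrow> 'g) \<Rightarrow> bool" where
  "represents G U \<alpha> \<longleftrightarrow>
     compact_open_G_set G U \<and> src G ` U = unit_space G \<and> rng G ` U = unit_space G \<and>
     \<alpha> = G_set_map G U"

definition full_group :: "'g top_groupoid \<Rightarrow> ('g \<Rightarrow> 'g) monoid" where
  "full_group G = (BijGroup (unit_space G))
     \<lparr>carrier := {\<alpha> \<in> Bij (unit_space G).
        homeomorphic_map (unit_top G) (unit_top G) \<alpha> \<and> (\<exists>U. represents G U \<alpha>)}\<rparr>"

definition supp :: "'g top_groupoid \<Rightarrow> ('g \<Rightarrow> 'g) \<Rightarrow> 'g set" where
  "supp G \<alpha> = unit_top G closure_of {x \<in> unit_space G. \<alpha> x \<noteq> x}"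

definition transpositions :: "'g top_groupoid \<Rightarrow> ('g \<Rightarrow> 'g) set" where
  "transpositions G = {\<alpha> \<in> carrier (full_group G).
     (\<exists>A. openin (unit_top G) A \<and> closedin (unit_top G) A \<and>
          A \<inter> \<alpha> ` A = {} \<and> supp G \<alpha> = A \<union> \<alpha> ` A) \<and>
     \<alpha> \<otimes>\<^bsub>full_group G\<^esub> \<alpha> = \<one>\<^bsub>full_group G\<^esub>}"

section \<open>First homology and the index map\<close>

text \<open>
  Functions on a space are represented by total functions that vanish outside of it, so that
  equality of functions on the space is equality in HOL. The group is written multiplicatively,
  as everywhere in HOL-Algebra's group theory.
\<close>

definition Cc :: "'a topology \<Rightarrow> ('a \<Rightarrow> int) monoid" where
  "Cc X =
     \<lparr>carrier = {f. (\<forall>x. x \<notin> topspace X \<longrightarrow> f x = 0) \<and>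
        continuous_map X (discrete_topology UNIV) f \<and>
        compactin X (X closure_of {x \<in> topspace X. f x \<noteq> 0})},
      monoid.mult = (\<lambda>f g x. f x + g x),
      one = (\<lambda>x. 0)\<rparr>"

text \<open>
  The fibre of \<open>\<pi>\<close> over \<open>z\<close> may be infinite, but it meets the support of a compactly supported
  function in a finite set when \<open>\<pi>\<close> is a local homeomorphism. The zeros of \<open>f\<close> have to be left
  out because a sum over an infinite set is \<open>0\<close> in HOL.
\<close>

definition push_forward :: "'a topology \<Rightarrow> ('a \<Rightarrow> 'b) \<Rightarrow> ('a \<Rightarrow> int) \<Rightarrow> 'b \<Rightarrow> int" where
  "push_forward X \<pi> f z = (\<Sum>y \<in> {y \<in> topspace X. \<pi> y = z \<and> f y \<noteq> 0}. f y)"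

definition delta1 :: "'g top_groupoid \<Rightarrow> ('g \<Rightarrow> int) \<Rightarrow> 'g \<Rightarrow> int" where
  "delta1 G f x =
     push_forward (arrow_top G) (src G) f x - push_forward (arrow_top G) (rng G) f x"

definition delta2 :: "'g top_groupoid \<Rightarrow> ('g \<times> 'g \<Rightarrow> int) \<Rightarrow> 'g \<Rightarrow> int" where
  "delta2 G f g =
     push_forward (composable_top G) snd f g
     - push_forward (composable_top G) (\<lambda>(g1, g2). gcomp G g1 g2) f g
     + push_forward (composable_top G) fst f g"

definition cycles1 :: "'g top_groupoid \<Rightarrow> ('g \<Rightarrow> int) monoid" where
  "cycles1 G = (Cc (arrow_top G))
     \<lparr>carrier := kernel (Cc (arrow_top G)) (Cc (unit_top G)) (delta1 G)\<rparr>"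

definition boundaries1 :: "'g top_groupoid \<Rightarrow> ('g \<Rightarrow> int) set" where
  "boundaries1 G = delta2 G ` carrier (Cc (composable_top G))"

definition H1 :: "'g top_groupoid \<Rightarrow> ('g \<Rightarrow> int) set monoid" where
  "H1 G = cycles1 G Mod boundaries1 G"

text \<open>
  The representing compact open \<open>G\<close>-set is unique when \<open>G\<close> is essentially principal; the index
  map is meant for such groupoids.
\<close>

definition index_map :: "'g top_groupoid \<Rightarrow> ('g \<Rightarrow> 'g) \<Rightarrow> ('g \<Rightarrow> int) set" where
  "index_map G \<alpha> = boundaries1 G #>\<^bsub>cycles1 G\<^esub> indicator (THE U. represents G U \<alpha>)"

definition full_group0 :: "'g top_groupoid \<Rightarrow> ('g \<Rightarrow> 'g) set" where
  "full_group0 G = kernel (full_group G) (H1 G) (index_map G)"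

section \<open>Shifts of finite type\<close>

definition adjacency :: "('v, 'e) pre_digraph \<Rightarrow> 'v \<Rightarrow> 'v \<Rightarrow> nat" where
  "adjacency D \<xi> \<eta> = card {e \<in> arcs D. tail D e = \<xi> \<and> head D e = \<eta>}"

text \<open>Square matrices over \<open>nat\<close> with rows and columns indexed by a finite set \<open>V\<close>.\<close>

fun matrix_power :: "'v set \<Rightarrow> ('v \<Rightarrow> 'v \<Rightarrow> nat) \<Rightarrow> nat \<Rightarrow> 'v \<Rightarrow> 'v \<Rightarrow> nat" where
  "matrix_power V M 0 = (\<lambda>\<xi> \<eta>. if \<xi> = \<eta> then 1 else 0)"
| "matrix_power V M (Suc n) = (\<lambda>\<xi> \<eta>. \<Sum>\<zeta>\<in>V. matrix_power V M n \<xi> \<zeta> * M \<zeta> \<eta>)"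

definition irreducible_matrix :: "'v set \<Rightarrow> ('v \<Rightarrow> 'v \<Rightarrow> nat) \<Rightarrow> bool" where
  "irreducible_matrix V M \<longleftrightarrow> (\<forall>\<xi>\<in>V. \<forall>\<eta>\<in>V. \<exists>n\<ge>1. matrix_power V M n \<xi> \<eta> > 0)"

definition permutation_matrix :: "'v set \<Rightarrow> ('v \<Rightarrow> 'v \<Rightarrow> nat) \<Rightarrow> bool" where
  "permutation_matrix V M \<longleftrightarrow>
     (\<exists>p. p permutes V \<and> (\<forall>\<xi>\<in>V. \<forall>\<eta>\<in>V. M \<xi> \<eta> = (if \<eta> = p \<xi> then 1 else 0)))"

text \<open>Paths are indexed from \<open>0\<close>: the first edge of \<open>x\<close> is \<open>x 0\<close>.\<close>

definition sft :: "('v, 'e) pre_digraph \<Rightarrow> (nat \<Rightarrow> 'e) topology" where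
  "sft D = subtopology (product_topology (\<lambda>_. discrete_topology (arcs D)) UNIV)
     {x. \<forall>k. head D (x k) = tail D (x (Suc k))}"

definition shift :: "(nat \<Rightarrow> 'e) \<Rightarrow> nat \<Rightarrow> 'e" where
  "shift x = (\<lambda>k. x (Suc k))"

text \<open>
  The arrows are the elements of the topological space, that is of the union of the generating
  sets.
\<close>

definition sft_groupoid ::
  "('v, 'e) pre_digraph \<Rightarrow> ((nat \<Rightarrow> 'e) \<times> int \<times> (nat \<Rightarrow> 'e)) top_groupoid" where
  "sft_groupoid D =
     \<lparr>arrow_top = topology_generated_by
        {{(x, int k - int l, y) | x y. x \<in> A \<and> y \<in> B \<and> (shift ^^ k) x = (shift ^^ l) y}
         | A B k l. openin (sft D) A \<and> openin (sft D) B \<and> k \<ge> 1 \<and> l \<ge> 1},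
      gcomp = (\<lambda>(x, n, y) (y', n', z). (x, n + n', z)),
      ginv = (\<lambda>(x, n, y). (y, - n, x))\<rparr>"

definition unit_arrow :: "(nat \<Rightarrow> 'e) \<Rightarrow> (nat \<Rightarrow> 'e) \<times> int \<times> (nat \<Rightarrow> 'e)" where
  "unit_arrow x = (x, 0, x)"

definition sft_reduction ::
  "('v, 'e) pre_digraph \<Rightarrow> (nat \<Rightarrow> 'e) set
    \<Rightarrow> ((nat \<Rightarrow> 'e) \<times> int \<times> (nat \<Rightarrow> 'e)) top_groupoid" where
  "sft_reduction D Y = reduction (sft_groupoid D) (unit_arrow ` Y)"

end

theory Submission
  imports Defs "HOL-Library.Sublist"
begin

text \<open>
  Elements of the full group act by replacing prefixes: \<open>\<alpha>\<close> is given by two finite trees of words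
  inside \<open>Y\<close> and a bijection between their leaves that preserves terminal vertices. Swaps of two
  disjoint cylinders whose words end at the same vertex are transpositions with trivial index.

  If the two trees have equally many interior nodes ending at each vertex, they can be made equal by
  composing with swaps, which exchange an interior node of the first tree with a leaf, and what
  remains is a permutation of leaves. The index map detects these numbers: for a point \<open>z\<close>, the
  number of visits to \<open>z\<close> defines an integer valued groupoid cocycle, and pairing it with the class of
  \<open>\<alpha>\<close> yields the difference between the numbers of interior nodes ending at the initial vertex of
  \<open>z\<close>. Hence the kernel of the index map is the group generated by all swaps.

  Finally, a swap involving a long word is conjugate to one of shorter words by a swap that moves a
  prefix of the long word to a short word disjoint from everything in sight, so that finitely many
  swaps suffice.
\<close>

section \<open>Words and sequences\<close>

text \<open>Exchanging an interior node with a leaf of the same terminal vertex keeps the number of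
  interior nodes ending at each vertex, and splitting a leaf together with its image adds one node
  with the same terminal vertex to both trees. So the difference of the two counts is what swaps
  cannot repair, and it has to be read off from the class of the graph of \<open>\<alpha>\<close>.
  The visit cocycle does this one vertex at a time. It need not be continuous, but on a compact set
  of arrows it is non-zero at finitely many of them only, so its pairing with a compactly supported
  function is a finite sum; the cocycle identity makes this pairing vanish on boundaries. That the
  matrix is not a permutation matrix enters through branching: two incomparable paths lead from any
  vertex to any vertex. This makes the lag of an arrow in the graph of \<open>\<alpha>\<close> a
  function of \<open>\<alpha>\<close>, hence the representing set unique, and it leaves room beside
  a given word for the auxiliary short words used in conjugations. The clopen set \<open>Y\<close>
  only contributes a root level \<open>N0\<close>; visits before that level are the same for every
  tree.\<close>

definition conc :: "'a list \<Rightarrow> (nat \<Rightarrow> 'a) \<Rightarrow> nat \<Rightarrow> 'a" where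
  "conc \<mu> z = (\<lambda>k. if k < length \<mu> then \<mu> ! k else z (k - length \<mu>))"

definition pre :: "nat \<Rightarrow> (nat \<Rightarrow> 'a) \<Rightarrow> 'a list" where
  "pre n x = map x [0..<n]"

lemma shift_pow: "(shift ^^ n) x = (\<lambda>k. x (k + n))"
  by (induction n arbitrary: x) (auto simp: shift_def fun_eq_iff funpow_swap1)

lemma length_pre [simp]: "length (pre n x) = n"
  by (simp add: pre_def)

lemma nth_pre [simp]: "i < n \<Longrightarrow> pre n x ! i = x i"
  by (simp add: pre_def)

lemma pre_0 [simp]: "pre 0 x = []"
  by (simp add: pre_def)

lemma pre_Suc: "pre (Suc n) x = pre n x @ [x n]"
  by (simp add: pre_def)

lemma pre_eq_iff: "pre n x = pre n y \<longleftrightarrow> (\<forall>i<n. x i = y i)"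
  by (auto simp: pre_def list_eq_iff_nth_eq)

lemma take_pre: "take m (pre n x) = pre (min m n) x"
  by (rule nth_equalityI) auto

lemma conc_Nil [simp]: "conc [] z = z"
  by (simp add: conc_def)

lemma conc_append: "conc (\<mu> @ \<nu>) z = conc \<mu> (conc \<nu> z)"
  by (auto simp: conc_def fun_eq_iff nth_append)

lemma conc_pre_shift: "conc (pre n x) ((shift ^^ n) x) = x"
  by (auto simp: conc_def shift_pow)

lemma shift_conc [simp]: "(shift ^^ length \<mu>) (conc \<mu> z) = z"
  by (auto simp: conc_def shift_pow)

lemma pre_conc [simp]: "pre (length \<mu>) (conc \<mu> z) = \<mu>"
  by (auto simp: conc_def list_eq_iff_nth_eq)

lemma pre_conc_add: "pre (length \<mu> + n) (conc \<mu> z) = \<mu> @ pre n z"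
  by (rule nth_equalityI) (auto simp: conc_def nth_append)

lemma conc_inject [simp]: "conc \<mu> z = conc \<mu> z' \<longleftrightarrow> z = z'"
  by (metis shift_conc)

lemma conc_of_pre: "pre (length \<mu>) x = \<mu> \<Longrightarrow> conc \<mu> ((shift ^^ length \<mu>) x) = x"
  by (metis conc_pre_shift)

lemma pre_add: "pre (m + n) x = pre m x @ pre n ((shift ^^ m) x)"
  by (rule nth_equalityI) (auto simp: nth_append shift_pow)

lemma prefix_pre_iff: "prefix \<mu> (pre n x) \<longleftrightarrow> length \<mu> \<le> n \<and> pre (length \<mu>) x = \<mu>"
  by (metis length_pre prefix_length_le min.absorb1 min.commute take_pre take_is_prefix
      append_eq_conv_conj prefixE)

lemma prefix_pre_mono: "m \<le> n \<Longrightarrow> prefix (pre m x) (pre n x)"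
  by (simp add: prefix_pre_iff)

lemma pre_comparable:
  assumes "pre (length \<mu>) x = \<mu>" "pre (length \<nu>) x = \<nu>"
  shows "\<not> \<mu> \<parallel> \<nu>"
  by (metis assms linorder_linear parallelE prefix_pre_mono)

lemma parallel_append_same: "\<mu> \<parallel> \<nu> \<Longrightarrow> \<rho> @ \<mu> \<parallel> \<rho> @ \<nu>"
  by (simp add: parallel_def)

lemma parallel_extend: "\<mu> \<parallel> \<nu> \<Longrightarrow> prefix \<mu> \<mu>' \<Longrightarrow> prefix \<nu> \<nu>' \<Longrightarrow> \<mu>' \<parallel> \<nu>'"
  by (auto simp: prefix_def parallel_append)

lemma parallel_of_same_length: "length \<mu> = length \<nu> \<Longrightarrow> \<mu> \<noteq> \<nu> \<Longrightarrow> \<mu> \<parallel> \<nu>"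
  by (auto simp: parallel_def prefix_def)

section \<open>The graph\<close>

locale irred_graph = fin_digraph D for D :: "('v, 'e) pre_digraph" +
  assumes irr: "irreducible_matrix (verts D) (adjacency D)"
    and not_perm: "\<not> permutation_matrix (verts D) (adjacency D)"
begin

text \<open>The empty word is excluded because \<open>hd []\<close> and \<open>last []\<close> are
  unspecified, which would make \<open>ini\<close> and \<open>fin\<close> meaningless.\<close>

definition path :: "'e list \<Rightarrow> bool" where
  "path \<mu> \<longleftrightarrow> \<mu> \<noteq> [] \<and> set \<mu> \<subseteq> arcs D \<and>
     (\<forall>i. Suc i < length \<mu> \<longrightarrow> head D (\<mu> ! i) = tail D (\<mu> ! Suc i))"

definition ini :: "'e list \<Rightarrow> 'v" where "ini \<mu> = tail D (hd \<mu>)"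

definition fin :: "'e list \<Rightarrow> 'v" where "fin \<mu> = head D (last \<mu>)"

definition X :: "(nat \<Rightarrow> 'e) set" where "X = topspace (sft D)"

lemma X_iff: "x \<in> X \<longleftrightarrow> (\<forall>k. x k \<in> arcs D) \<and> (\<forall>k. head D (x k) = tail D (x (Suc k)))"
  by (auto simp: X_def sft_def PiE_def Pi_def)

lemma path_not_Nil [simp]: "\<not> path []"
  by (simp add: path_def)

lemma path_append_iff:
  assumes "\<mu> \<noteq> []" "\<nu> \<noteq> []"
  shows "path (\<mu> @ \<nu>) \<longleftrightarrow> path \<mu> \<and> path \<nu> \<and> fin \<mu> = ini \<nu>"
proof
  assume *: "path (\<mu> @ \<nu>)"
  have h: "head D ((\<mu> @ \<nu>) ! i) = tail D ((\<mu> @ \<nu>) ! Suc i)" if "Suc i < length \<mu> + length \<nu>" for i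
    using * that by (simp add: path_def)
  have "head D (\<mu> ! i) = tail D (\<mu> ! Suc i)" if "Suc i < length \<mu>" for i
    using h[of i] that by (simp add: nth_append)
  moreover have "head D (\<nu> ! i) = tail D (\<nu> ! Suc i)" if "Suc i < length \<nu>" for i
    using h[of "length \<mu> + i"] that by (simp add: nth_append)
  moreover have "fin \<mu> = ini \<nu>"
    using h[of "length \<mu> - 1"] assms
    by (simp add: nth_append fin_def ini_def last_conv_nth hd_conv_nth split: if_splits)
  ultimately show "path \<mu> \<and> path \<nu> \<and> fin \<mu> = ini \<nu>"
    using assms * by (simp add: path_def)
next
  assume *: "path \<mu> \<and> path \<nu> \<and> fin \<mu> = ini \<nu>"
  have "head D ((\<mu> @ \<nu>) ! i) = tail D ((\<mu> @ \<nu>) ! Suc i)" if i: "Suc i < length (\<mu> @ \<nu>)" for i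
  proof -
    consider "Suc i < length \<mu>" | "Suc i = length \<mu>" | "i \<ge> length \<mu>" by linarith
    then show ?thesis
    proof cases
      case 1 then show ?thesis using * by (simp add: nth_append path_def)
    next
      case 2
      then have "i = length \<mu> - 1" by simp
      then show ?thesis using * 2 assms
        by (simp add: nth_append fin_def ini_def last_conv_nth hd_conv_nth)
    next
      case 3
      then have "Suc i - length \<mu> = Suc (i - length \<mu>)" by simp
      then show ?thesis using * i 3 by (simp add: nth_append path_def)
    qed
  qed
  then show "path (\<mu> @ \<nu>)" using * by (simp add: path_def)
qed

lemma fin_append [simp]: "\<nu> \<noteq> [] \<Longrightarrow> fin (\<mu> @ \<nu>) = fin \<nu>"
  by (simp add: fin_def)

lemma ini_append [simp]: "\<mu> \<noteq> [] \<Longrightarrow> ini (\<mu> @ \<nu>) = ini \<mu>"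
  by (simp add: ini_def)

lemma fin_append_cong: "fin \<mu> = fin \<nu> \<Longrightarrow> fin (\<mu> @ s) = fin (\<nu> @ s)"
  by (cases "s = []") auto

lemma path_replace:
  assumes "path (\<mu> @ s)" "path \<mu>" "path \<nu>" "fin \<mu> = fin \<nu>"
  shows "path (\<nu> @ s)"
  using assms by (cases "s = []") (auto simp: path_append_iff path_def[of "[]"], 
      metis path_append_iff path_not_Nil)

lemma fin_in_verts: "path \<mu> \<Longrightarrow> fin \<mu> \<in> verts D"
  by (metis fin_def head_in_verts last_in_set path_def subset_eq)

lemma X_shift: "x \<in> X \<Longrightarrow> (shift ^^ n) x \<in> X"
  by (auto simp: X_iff shift_pow)

lemma path_pre: "x \<in> X \<Longrightarrow> n > 0 \<Longrightarrow> path (pre n x)"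
  by (auto simp: path_def X_iff pre_def)

lemma fin_pre: "x \<in> X \<Longrightarrow> n > 0 \<Longrightarrow> fin (pre n x) = tail D (x n)"
  by (auto simp: fin_def X_iff last_conv_nth gr0_conv_Suc pre_Suc)

text \<open>At the junction only the edge condition between \<open>last \<mu>\<close> and
  \<open>z 0\<close> matters, so the tails allowed after \<open>\<mu>\<close> depend on
  \<open>fin \<mu>\<close> alone. This is why words with equal \<open>fin\<close> can be exchanged
  as prefixes.\<close>

lemma conc_X_iff:
  assumes "path \<mu>"
  shows "conc \<mu> z \<in> X \<longleftrightarrow> z \<in> X \<and> tail D (z 0) = fin \<mu>"
proof
  assume c: "conc \<mu> z \<in> X"
  from X_shift[OF this, of "length \<mu>"] have "z \<in> X" by simp
  moreover have "fin (pre (length \<mu>) (conc \<mu> z)) = tail D (conc \<mu> z (length \<mu>))"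
    using assms by (intro fin_pre c) (auto simp: path_def)
  ultimately show "z \<in> X \<and> tail D (z 0) = fin \<mu>"
    by (metis pre_conc conc_def diff_self_eq_0 less_irrefl)
next
  assume z: "z \<in> X \<and> tail D (z 0) = fin \<mu>"
  have "head D (conc \<mu> z k) = tail D (conc \<mu> z (Suc k))" for k
  proof -
    consider "Suc k < length \<mu>" | "Suc k = length \<mu>" | "k \<ge> length \<mu>" by linarith
    then show ?thesis
    proof cases
      case 1 then show ?thesis using assms by (simp add: conc_def path_def)
    next
      case 2
      then have "k = length \<mu> - 1" "\<mu> \<noteq> []" by auto
      then show ?thesis using z 2 by (simp add: conc_def fin_def last_conv_nth)
    next
      case 3
      then have "Suc k - length \<mu> = Suc (k - length \<mu>)" by simp
      then show ?thesis using z 3 by (simp add: conc_def X_iff)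
    qed
  qed
  moreover have "conc \<mu> z k \<in> arcs D" for k
    using z assms by (auto simp: conc_def path_def X_iff)
  ultimately show "conc \<mu> z \<in> X" by (simp add: X_iff)
qed

lemma adjacency_posD:
  assumes "adjacency D \<xi> \<eta> > 0"
  obtains e where "e \<in> arcs D" "tail D e = \<xi>" "head D e = \<eta>"
  using assms unfolding adjacency_def card_gt_0_iff by auto

lemma matrix_power_path:
  assumes "matrix_power (verts D) (adjacency D) n \<xi> \<eta> > 0" "n \<ge> 1"
  shows "\<exists>\<pi>. path \<pi> \<and> ini \<pi> = \<xi> \<and> fin \<pi> = \<eta>"
  using assms
proof (induction n arbitrary: \<eta>)
  case (Suc n)
  then obtain \<zeta> where \<zeta>: "\<zeta> \<in> verts D" "matrix_power (verts D) (adjacency D) n \<xi> \<zeta> > 0"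
    "adjacency D \<zeta> \<eta> > 0"
    by (auto simp: sum_nonneg_eq_0_iff simp flip: neq0_conv)
  then obtain e where e: "e \<in> arcs D" "tail D e = \<zeta>" "head D e = \<eta>"
    using adjacency_posD by blast
  then have pe: "path [e]" "ini [e] = \<zeta>" "fin [e] = \<eta>" by (auto simp: path_def ini_def fin_def)
  show ?case
  proof (cases "n = 0")
    case True
    with \<zeta> have "\<zeta> = \<xi>" by (auto split: if_splits)
    with pe show ?thesis by blast
  next
    case False
    with Suc.IH \<zeta> obtain \<pi> where "path \<pi>" "ini \<pi> = \<xi>" "fin \<pi> = \<zeta>" by auto
    with pe show ?thesis
      by (intro exI[of _ "\<pi> @ [e]"]) (metis fin_append ini_append not_Cons_self2 path_append_iff path_not_Nil)
  qed
qed simp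

lemma connected_path:
  assumes "v \<in> verts D" "w \<in> verts D"
  obtains \<pi> where "path \<pi>" "ini \<pi> = v" "fin \<pi> = w"
  using irr assms matrix_power_path unfolding irreducible_matrix_def by metis

text \<open>If every vertex emitted only one edge, following it would define a map on the vertices
  which irreducibility makes surjective. On a finite set this map is a permutation, and the
  adjacency matrix would be its matrix.\<close>

lemma branching:
  obtains e1 e2 where "e1 \<in> arcs D" "e2 \<in> arcs D" "e1 \<noteq> e2" "tail D e1 = tail D e2"
proof -
  have "\<exists>e1\<in>arcs D. \<exists>e2\<in>arcs D. e1 \<noteq> e2 \<and> tail D e1 = tail D e2"
  proof (rule ccontr)
    assume n: "\<not> ?thesis"
    have "\<exists>e\<in>arcs D. tail D e = v" if "v \<in> verts D" for v
      using connected_path[OF that that] by (metis ini_def path_def hd_in_set subset_eq)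
    then obtain f where f: "\<And>v. v \<in> verts D \<Longrightarrow> f v \<in> arcs D \<and> tail D (f v) = v" by metis
    define g where "g v = (if v \<in> verts D then head D (f v) else v)" for v
    have adj: "adjacency D v w = (if w = g v then 1 else 0)" if "v \<in> verts D" for v w
    proof -
      have "{e \<in> arcs D. tail D e = v \<and> head D e = w} = (if w = g v then {f v} else {})"
        using n f[OF that] that unfolding g_def by (auto; metis)
      then show ?thesis by (simp add: adjacency_def)
    qed
    have "\<exists>v\<in>verts D. g v = w" if w: "w \<in> verts D" for w
    proof -
      obtain \<pi> where \<pi>: "path \<pi>" "fin \<pi> = w" by (rule connected_path[OF w w])
      then have e: "last \<pi> \<in> arcs D" "head D (last \<pi>) = w" by (auto simp: path_def fin_def)
      \<comment> \<open>The last edge of a path to \<open>w\<close> is the only edge leaving its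
        tail, so \<open>g\<close> sends that tail to \<open>w\<close>.\<close>
      then have "f (tail D (last \<pi>)) = last \<pi>" using f n by (metis tail_in_verts)
      then show ?thesis using e unfolding g_def by (intro bexI[of _ "tail D (last \<pi>)"]) auto
    qed
    then have "verts D \<subseteq> g ` verts D" by blast
    moreover have "g ` verts D \<subseteq> verts D" using f by (auto simp: g_def)
    ultimately have "g ` verts D = verts D" by blast
    then have "bij_betw g (verts D) (verts D)"
      by (simp add: bij_betw_def eq_card_imp_inj_on)
    then have "g permutes verts D" by (intro bij_imp_permutes) (auto simp: g_def)
    then show False using not_perm adj unfolding permutation_matrix_def by blast
  qed
  then show ?thesis using that by blast
qed

text \<open>Walk from \<open>v\<close> to a vertex with two outgoing edges, take either of them, and
  walk on to \<open>w\<close>: the two paths diverge at that vertex and are therefore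
  incomparable.\<close>

lemma branching_paths:
  assumes "v \<in> verts D" "w \<in> verts D"
  obtains \<kappa>1 \<kappa>2 where "path \<kappa>1" "path \<kappa>2" "ini \<kappa>1 = v" "ini \<kappa>2 = v" "fin \<kappa>1 = w" "fin \<kappa>2 = w"
    "\<kappa>1 \<parallel> \<kappa>2"
proof -
  obtain e1 e2 where e: "e1 \<in> arcs D" "e2 \<in> arcs D" "e1 \<noteq> e2" "tail D e1 = tail D e2"
    by (rule branching)
  obtain \<pi> where \<pi>: "path \<pi>" "ini \<pi> = v" "fin \<pi> = tail D e1"
    using connected_path assms e by (metis tail_in_verts)
  obtain \<pi>1 where \<pi>1: "path \<pi>1" "ini \<pi>1 = head D e1" "fin \<pi>1 = w"
    using connected_path assms e by (metis head_in_verts)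
  obtain \<pi>2 where \<pi>2: "path \<pi>2" "ini \<pi>2 = head D e2" "fin \<pi>2 = w"
    using connected_path assms e by (metis head_in_verts)
  have pe: "path [e1]" "path [e2]" "ini [e1] = tail D e1" "ini [e2] = tail D e1"
      "fin [e1] = head D e1" "fin [e2] = head D e2"
    using e by (auto simp: path_def ini_def fin_def)
  have ne: "\<pi> \<noteq> []" "\<pi>1 \<noteq> []" "\<pi>2 \<noteq> []" using \<pi> \<pi>1 \<pi>2 by auto
  have q: "path ([e1] @ \<pi>1)" "path ([e2] @ \<pi>2)"
    using pe ne \<pi>1 \<pi>2 path_append_iff[of "[e1]" \<pi>1] path_append_iff[of "[e2]" \<pi>2] by simp_all
  have "path (\<pi> @ [e1] @ \<pi>1)" "path (\<pi> @ [e2] @ \<pi>2)"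
    using q pe ne \<pi> path_append_iff[of \<pi> "[e1] @ \<pi>1"] path_append_iff[of \<pi> "[e2] @ \<pi>2"]
    by (simp_all add: ini_def)
  moreover have "\<pi> @ [e1] @ \<pi>1 \<parallel> \<pi> @ [e2] @ \<pi>2"
    using e by (intro parallel_append_same) (auto simp: parallel_def)
  ultimately show ?thesis
    using \<pi> \<pi>1 \<pi>2 ne
    by (intro that[of "\<pi> @ [e1] @ \<pi>1" "\<pi> @ [e2] @ \<pi>2"]) (simp_all add: fin_def)
qed

lemma point_from:
  assumes "v \<in> verts D"
  obtains z where "z \<in> X" "tail D (z 0) = v"
proof -
  have "\<exists>e\<in>arcs D. tail D e = v" if "v \<in> verts D" for v
    using connected_path[OF that that] by (metis ini_def path_def hd_in_set subset_eq)
  then obtain f where f: "\<And>v. v \<in> verts D \<Longrightarrow> f v \<in> arcs D \<and> tail D (f v) = v" by metis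
  define z where "z = rec_nat (f v) (\<lambda>_ e. f (head D e))"
  have z: "z k \<in> arcs D" for k
    by (induction k) (auto simp: z_def f assms)
  have "z (Suc k) = f (head D (z k))" for k by (simp add: z_def)
  then have "z \<in> X" using z f by (auto simp: X_iff)
  moreover have "tail D (z 0) = v" using f assms by (simp add: z_def)
  ultimately show ?thesis using that by blast
qed

lemma point_extending:
  assumes "path \<mu>"
  obtains z where "conc \<mu> z \<in> X"
  using point_from[OF fin_in_verts[OF assms]] conc_X_iff[OF assms] by metis

lemma branching_extensions:
  assumes "path \<rho>" "w \<in> verts D"
  obtains \<kappa>1 \<kappa>2 where "path \<kappa>1" "path \<kappa>2" "fin \<kappa>1 = w" "fin \<kappa>2 = w"
    "prefix \<rho> \<kappa>1" "prefix \<rho> \<kappa>2" "\<kappa>1 \<parallel> \<kappa>2"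
proof -
  obtain \<kappa>1 \<kappa>2 where k: "path \<kappa>1" "path \<kappa>2" "ini \<kappa>1 = fin \<rho>" "ini \<kappa>2 = fin \<rho>" "fin \<kappa>1 = w"
    "fin \<kappa>2 = w" "\<kappa>1 \<parallel> \<kappa>2"
    using branching_paths[OF fin_in_verts[OF assms(1)] assms(2)] .
  then have "\<kappa>1 \<noteq> []" "\<kappa>2 \<noteq> []" "\<rho> \<noteq> []" using assms by auto
  then show ?thesis using k assms
    by (intro that[of "\<rho> @ \<kappa>1" "\<rho> @ \<kappa>2"]) (auto simp: path_append_iff parallel_append_same)
qed

text \<open>This is what makes the groupoid essentially principal.\<close>

lemma shift_powers_differ:
  assumes "path \<mu>" "\<And>z. conc \<mu> z \<in> X \<Longrightarrow> (shift ^^ a) (conc \<mu> z) = (shift ^^ b) (conc \<mu> z)"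
  shows "a = b"
proof -
  \<comment> \<open>For \<open>a < b\<close> the equation says \<open>y (i + a) = y (i + b)\<close>:
    every point of the cylinder is eventually periodic and determined by an initial segment. Two
    incomparable extensions of that segment contradict this.\<close>
  have *: False if ab: "a < b" and eq: "\<And>z. conc \<mu> z \<in> X \<Longrightarrow> (shift ^^ a) (conc \<mu> z) = (shift ^^ b) (conc \<mu> z)" for a b
  proof -
    obtain z where z: "conc \<mu> z \<in> X" using point_extending[OF assms(1)] .
    define x where "x = conc \<mu> z"
    \<comment> \<open>Long enough to contain the prefix \<open>\<mu>\<close> and to start the
      recursion, which steps back from \<open>i\<close> to \<open>i - b + a\<close>.\<close>
    define n where "n = b + length \<mu>"
    have n: "n > 0" using assms by (auto simp: n_def)
    have \<rho>: "path (pre n x)" using path_pre[OF z n] by (simp add: x_def)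
    have pm: "prefix \<mu> (pre n x)" by (simp add: prefix_pre_iff n_def x_def)
    obtain \<kappa>1 \<kappa>2 where k: "path \<kappa>1" "path \<kappa>2" "prefix (pre n x) \<kappa>1" "prefix (pre n x) \<kappa>2" "\<kappa>1 \<parallel> \<kappa>2"
      using branching_extensions[OF \<rho> fin_in_verts[OF \<rho>]] by metis
    obtain z1 where z1: "conc \<kappa>1 z1 \<in> X" using point_extending[OF k(1)] .
    obtain z2 where z2: "conc \<kappa>2 z2 \<in> X" using point_extending[OF k(2)] .
    have agree: "y i = x i" if "y \<in> X" "pre n y = pre n x" for y i
    proof -
      have in\<mu>: "pre (length \<mu>) y = \<mu>" using pm that(2) by (metis prefix_pre_iff)
      have "(shift ^^ a) y = (shift ^^ b) y"
        using eq[of "(shift ^^ length \<mu>) y"] conc_of_pre[OF in\<mu>] that(1) by simp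
      then have py: "y (i + a) = y (i + b)" for i by (simp add: shift_pow fun_eq_iff)
      have "(shift ^^ a) x = (shift ^^ b) x" using eq z by (simp add: x_def)
      then have px: "x (i + a) = x (i + b)" for i by (simp add: shift_pow fun_eq_iff)
      show ?thesis
      proof (induction i rule: less_induct)
        case (less i)
        show ?case
        proof (cases "i < n")
          case True then show ?thesis using that(2) by (simp add: pre_eq_iff)
        next
          case False
          then have "i \<ge> b" by (simp add: n_def)
          then show ?thesis using less[of "i - b + a"] py[of "i - b"] px[of "i - b"] ab by simp
        qed
      qed
    qed
    have "pre n (conc \<kappa>1 z1) = pre n x" "pre n (conc \<kappa>2 z2) = pre n x"
      using k(3,4) prefix_pre_iff[of "pre n x" "length \<kappa>1" "conc \<kappa>1 z1"]
        prefix_pre_iff[of "pre n x" "length \<kappa>2" "conc \<kappa>2 z2"] by simp_all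
    then have "conc \<kappa>1 z1 = conc \<kappa>2 z2" using agree[OF z1] agree[OF z2] by (intro ext) simp
    then show False using k(5) pre_comparable[OF pre_conc, of \<kappa>2 \<kappa>1 z1] by simp
  qed
  show ?thesis using *[of a b] *[of b a] assms(2) by (metis linorder_neqE_nat)
qed

lemma finite_paths: "finite {\<mu>. path \<mu> \<and> length \<mu> \<le> n}"
  by (rule finite_subset[OF _ finite_lists_length_le[OF finite_arcs, of n]]) (auto simp: path_def)

end

section \<open>The topology of the groupoid\<close>

lemma pre_eq_mono: "pre k x = pre k y \<Longrightarrow> n \<le> k \<Longrightarrow> pre n x = pre n y"
  by (simp add: pre_eq_iff)

context irred_graph
begin

definition cyl :: "'e list \<Rightarrow> (nat \<Rightarrow> 'e) set" where
  "cyl \<mu> = {x \<in> X. pre (length \<mu>) x = \<mu>}"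

text \<open>The arrows that replace the prefix \<open>\<nu>\<close> of the source by
  \<open>\<mu>\<close>; they are the basic bisections. Both memberships in \<open>X\<close> are
  demanded, so for paths with different terminal vertices the set is empty.\<close>

definition Z :: "'e list \<Rightarrow> 'e list \<Rightarrow> ((nat \<Rightarrow> 'e) \<times> int \<times> (nat \<Rightarrow> 'e)) set" where
  "Z \<mu> \<nu> = {(conc \<mu> z, int (length \<mu>) - int (length \<nu>), conc \<nu> z) | z.
     conc \<mu> z \<in> X \<and> conc \<nu> z \<in> X}"

lemma conc_in_cyl: "conc \<mu> z \<in> X \<Longrightarrow> conc \<mu> z \<in> cyl \<mu>"
  by (simp add: cyl_def)

lemma cylE:
  assumes "x \<in> cyl \<mu>"
  obtains z where "x = conc \<mu> z" "conc \<mu> z \<in> X"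
proof (rule that)
  show "x = conc \<mu> ((shift ^^ length \<mu>) x)" using assms conc_of_pre[of \<mu> x] by (simp add: cyl_def)
  then show "conc \<mu> ((shift ^^ length \<mu>) x) \<in> X" using assms by (simp add: cyl_def)
qed

lemma in_cyl_pre: "x \<in> X \<Longrightarrow> x \<in> cyl (pre n x)"
  by (simp add: cyl_def)

lemma cyl_mono: "prefix \<mu> \<nu> \<Longrightarrow> cyl \<nu> \<subseteq> cyl \<mu>"
  unfolding cyl_def by (auto dest: prefix_length_le) (metis prefix_pre_iff)

lemma cyl_disjoint: "\<mu> \<parallel> \<nu> \<Longrightarrow> cyl \<mu> \<inter> cyl \<nu> = {}"
  unfolding cyl_def using pre_comparable by blast

lemma shift_conc_pre:
  "j \<le> k \<Longrightarrow> (shift ^^ j) (conc (pre k x) z) = conc (pre (k - j) ((shift ^^ j) x)) z"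
  by (auto simp: shift_pow conc_def fun_eq_iff)

text \<open>Cylinders are a base of the product topology, so being open means being decided by
  finite prefixes. The later topological arguments are comparisons of prefixes.\<close>

lemma openin_sft_iff:
  "openin (sft D) A \<longleftrightarrow> A \<subseteq> X \<and> (\<forall>x\<in>A. \<exists>n. \<forall>y\<in>X. pre n y = pre n x \<longrightarrow> y \<in> A)"
  (is "?L \<longleftrightarrow> ?R")
proof
  assume L: ?L
  then have sub: "A \<subseteq> X" using openin_subset X_def by blast
  from L obtain B where B: "openin (product_topology (\<lambda>_::nat. discrete_topology (arcs D)) UNIV) B"
    "A = B \<inter> {x. \<forall>k. head D (x k) = tail D (x (Suc k))}"
    unfolding sft_def openin_subtopology by auto
  have "\<exists>n. \<forall>y\<in>X. pre n y = pre n x \<longrightarrow> y \<in> A" if x: "x \<in> A" for x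
  proof -
    obtain U where U: "finite {i. U i \<noteq> arcs D}" "x \<in> Pi\<^sub>E UNIV U" "Pi\<^sub>E UNIV U \<subseteq> B"
      using B x unfolding openin_product_topology_alt by (auto; metis)
    obtain n where n: "\<And>i. U i \<noteq> arcs D \<Longrightarrow> i < n"
      using finite_nat_set_iff_bounded[THEN iffD1, OF U(1)] by auto
    have "y \<in> A" if y: "y \<in> X" "pre n y = pre n x" for y
    proof -
      have "y i \<in> U i" for i
        using n[of i] y U(2) by (cases "i < n") (auto simp: pre_eq_iff X_iff PiE_def Pi_def)
      then have "y \<in> B" using U(3) by auto
      then show ?thesis using y by (auto simp: B(2) X_iff)
    qed
    then show ?thesis by blast
  qed
  with sub show ?R by blast
next
  assume R: ?R
  then obtain n where n: "\<And>x y. x \<in> A \<Longrightarrow> y \<in> X \<Longrightarrow> pre (n x) y = pre (n x) x \<Longrightarrow> y \<in> A" by metis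
  define B where "B = {y. (\<forall>k. y k \<in> arcs D) \<and> (\<exists>x\<in>A. pre (n x) y = pre (n x) x)}"
  have "\<exists>U. finite {i. U i \<noteq> arcs D} \<and> (\<forall>i. U i \<subseteq> arcs D) \<and> y \<in> Pi\<^sub>E UNIV U \<and> Pi\<^sub>E UNIV U \<subseteq> B"
    if y: "y \<in> B" for y
  proof -
    obtain x where x: "x \<in> A" "pre (n x) y = pre (n x) x" using y by (auto simp: B_def)
    define U where "U = (\<lambda>i. if i < n x then {y i} else arcs D)"
    have "finite {i. U i \<noteq> arcs D}"
      by (rule finite_subset[of _ "{..<n x}"]) (auto simp: U_def)
    moreover have "\<forall>i. U i \<subseteq> arcs D" "y \<in> Pi\<^sub>E UNIV U" using y by (auto simp: U_def B_def)
    moreover have "w \<in> B" if w: "w \<in> Pi\<^sub>E UNIV U" for w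
    proof -
      have wi: "w i \<in> U i" for i using w by auto
      have "w i = y i" if "i < n x" for i using wi[of i] that by (simp add: U_def)
      moreover have "w i \<in> arcs D" for i using wi[of i] y by (auto simp: U_def B_def split: if_splits)
      ultimately show ?thesis using x by (auto simp: B_def pre_eq_iff)
    qed
    ultimately show ?thesis by blast
  qed
  then have "openin (product_topology (\<lambda>_::nat. discrete_topology (arcs D)) UNIV) B"
    unfolding openin_product_topology_alt by simp
  moreover have "A = B \<inter> {x. \<forall>k. head D (x k) = tail D (x (Suc k))}"
  proof
    show "A \<subseteq> B \<inter> {x. \<forall>k. head D (x k) = tail D (x (Suc k))}"
      using R by (auto simp: B_def X_iff)
  next
    show "B \<inter> {x. \<forall>k. head D (x k) = tail D (x (Suc k))} \<subseteq> A"
      using n by (auto simp: B_def X_iff)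
  qed
  ultimately show ?L unfolding sft_def openin_subtopology by blast
qed

lemma openin_cyl: "openin (sft D) (cyl \<mu>)"
  unfolding openin_sft_iff by (auto simp: cyl_def intro!: exI[of _ "length \<mu>"])

lemma compact_sft: "compact_space (sft D)"
proof -
  have "closedin (product_topology (\<lambda>_::nat. discrete_topology (arcs D)) UNIV) X"
    unfolding closedin_def
  proof
    show "X \<subseteq> topspace (product_topology (\<lambda>_::nat. discrete_topology (arcs D)) UNIV)"
      by (auto simp: X_iff)
    let ?P = "topspace (product_topology (\<lambda>_::nat. discrete_topology (arcs D)) UNIV)"
    have "\<exists>U. finite {i. U i \<noteq> arcs D} \<and> (\<forall>i. U i \<subseteq> arcs D) \<and> y \<in> Pi\<^sub>E UNIV U \<and> Pi\<^sub>E UNIV U \<subseteq> ?P - X"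
      if y: "y \<in> ?P - X" for y
    proof -
      obtain k where k: "head D (y k) \<noteq> tail D (y (Suc k))" using y by (auto simp: X_iff)
      \<comment> \<open>The coordinates \<open>k\<close> and \<open>k + 1\<close> already witness
        the violated edge condition.\<close>
      define U where "U = (\<lambda>i. if i < k + 2 then {y i} else arcs D)"
      have "finite {i. U i \<noteq> arcs D}"
        by (rule finite_subset[of _ "{..<k+2}"]) (auto simp: U_def)
      moreover have U: "\<forall>i. U i \<subseteq> arcs D" "y \<in> Pi\<^sub>E UNIV U" using y by (auto simp: U_def)
      moreover have "w \<in> ?P - X" if w: "w \<in> Pi\<^sub>E UNIV U" for w
      proof -
        have wi: "w i \<in> U i" for i using w by auto
        have "w k = y k" "w (Suc k) = y (Suc k)" using wi[of k] wi[of "Suc k"] by (auto simp: U_def)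
        moreover have "w i \<in> arcs D" for i using wi U by blast
        ultimately show ?thesis using k by (auto simp: X_iff intro!: exI[of _ k])
      qed
      ultimately show ?thesis by blast
    qed
    then show "openin (product_topology (\<lambda>_::nat. discrete_topology (arcs D)) UNIV) (?P - X)"
      unfolding openin_product_topology_alt by simp
  qed
  moreover have "compact_space (product_topology (\<lambda>_::nat. discrete_topology (arcs D)) UNIV)"
    by (simp add: compact_space_product_topology compact_space_discrete_topology)
  ultimately have "compactin (product_topology (\<lambda>_::nat. discrete_topology (arcs D)) UNIV) X"
    by (rule closedin_compact_space[rotated])
  moreover have "sft D = subtopology (product_topology (\<lambda>_. discrete_topology (arcs D)) UNIV) X"
  proof -
    have "sft D = subtopology (product_topology (\<lambda>_. discrete_topology (arcs D)) UNIV)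
       (topspace (product_topology (\<lambda>_. discrete_topology (arcs D)) UNIV) \<inter> {x. \<forall>k. head D (x k) = tail D (x (Suc k))})"
      unfolding sft_def by (rule subtopology_restrict[symmetric])
    also have "topspace (product_topology (\<lambda>_::nat. discrete_topology (arcs D)) UNIV) \<inter> {x. \<forall>k. head D (x k) = tail D (x (Suc k))} = X"
      by (auto simp: X_iff PiE_def Pi_def)
    finally show ?thesis .
  qed
  ultimately show ?thesis by (metis compact_space_subtopology)
qed

abbreviation GX where "GX \<equiv> sft_groupoid D"

definition arrows :: "((nat \<Rightarrow> 'e) \<times> int \<times> (nat \<Rightarrow> 'e)) set" where
  "arrows = {(x, m, y). x \<in> X \<and> y \<in> X \<and> (\<exists>k l. m = int k - int l \<and> (shift ^^ k) x = (shift ^^ l) y)}"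

lemma shift_add_eq: "(shift ^^ k) x = (shift ^^ l) y \<Longrightarrow> (shift ^^ (k + n)) x = (shift ^^ (l + n)) y"
proof
  fix i assume "(shift ^^ k) x = (shift ^^ l) y"
  from fun_cong[OF this, of "i + n"] show "(shift ^^ (k + n)) x i = (shift ^^ (l + n)) y i"
    by (simp add: shift_pow ac_simps)
qed

text \<open>Both levels can be raised by the same amount without changing the lag, so any lower
  bound on them can be met: \<open>1\<close> for the generators of the topology, \<open>N0\<close>
  for words that describe cylinders inside \<open>Y\<close>.\<close>

lemma arrow_levels:
  assumes "(x, m, y) \<in> arrows"
  obtains k l where "k \<ge> n" "l \<ge> n" "m = int k - int l" "(shift ^^ k) x = (shift ^^ l) y"
proof -
  obtain k l where "m = int k - int l" "(shift ^^ k) x = (shift ^^ l) y"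
    using assms by (auto simp: arrows_def)
  then show ?thesis using shift_add_eq by (intro that[of "k + n" "l + n"]) auto
qed

lemma arrow_in_Z:
  assumes "x \<in> X" "y \<in> X" "(shift ^^ k) x = (shift ^^ l) y"
  shows "(x, int k - int l, y) \<in> Z (pre k x) (pre l y)"
  unfolding Z_def using assms conc_pre_shift[of k x] conc_pre_shift[of l y]
  by (auto intro!: exI[of _ "(shift ^^ k) x"])

lemma Z_eq_generator:
  "Z \<mu> \<nu> = {(x, int (length \<mu>) - int (length \<nu>), y) | x y.
     x \<in> cyl \<mu> \<and> y \<in> cyl \<nu> \<and> (shift ^^ length \<mu>) x = (shift ^^ length \<nu>) y}"
proof safe
  fix g1 m g2 assume "(g1, m, g2) \<in> Z \<mu> \<nu>"
  then obtain z where "g1 = conc \<mu> z" "m = int (length \<mu>) - int (length \<nu>)" "g2 = conc \<nu> z"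
     "conc \<mu> z \<in> X" "conc \<nu> z \<in> X"
    by (auto simp: Z_def)
  then show "\<exists>x y. (g1, m, g2) = (x, int (length \<mu>) - int (length \<nu>), y) \<and>
          x \<in> cyl \<mu> \<and> y \<in> cyl \<nu> \<and> (shift ^^ length \<mu>) x = (shift ^^ length \<nu>) y"
    by (auto simp: conc_in_cyl)
next
  fix x y assume *: "x \<in> cyl \<mu>" "y \<in> cyl \<nu>" "(shift ^^ length \<mu>) x = (shift ^^ length \<nu>) y"
  then have "x = conc \<mu> ((shift ^^ length \<mu>) x)" "y = conc \<nu> ((shift ^^ length \<mu>) x)" "x \<in> X" "y \<in> X"
    using conc_of_pre[of \<mu> x] conc_of_pre[of \<nu> y] by (auto simp: cyl_def)
  then show "(x, int (length \<mu>) - int (length \<nu>), y) \<in> Z \<mu> \<nu>"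
    unfolding Z_def by (auto intro!: exI[of _ "(shift ^^ length \<mu>) x"])
qed

lemma Z_arrows: "Z \<mu> \<nu> \<subseteq> arrows"
  by (auto simp: Z_def arrows_def) (metis shift_conc)

lemma openin_Z: "\<mu> \<noteq> [] \<Longrightarrow> \<nu> \<noteq> [] \<Longrightarrow> openin (arrow_top GX) (Z \<mu> \<nu>)"
  unfolding sft_groupoid_def Z_eq_generator top_groupoid.simps
  by (rule topology_generated_by_Basis) (auto intro!: openin_cyl exI simp: Suc_le_eq)

lemma topspace_GX: "topspace (arrow_top GX) = arrows"
proof -
  have "topspace (arrow_top GX) \<subseteq> arrows"
    unfolding sft_groupoid_def top_groupoid.simps topology_generated_by_topspace arrows_def
    by (auto simp: openin_sft_iff)
  moreover have "g \<in> topspace (arrow_top GX)" if "g \<in> arrows" for g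
  proof -
    obtain x m y where g: "g = (x, m, y)" by (cases g)
    obtain k l where "k \<ge> 1" "l \<ge> 1" "m = int k - int l" "(shift ^^ k) x = (shift ^^ l) y"
      using arrow_levels \<open>g \<in> arrows\<close> unfolding g by metis
    moreover have "x \<in> X" "y \<in> X" using that by (auto simp: g arrows_def)
    ultimately have "g \<in> Z (pre k x) (pre l y)" using arrow_in_Z g by auto
    moreover have "pre k x \<noteq> []" "pre l y \<noteq> []" using \<open>k \<ge> 1\<close> \<open>l \<ge> 1\<close> by (simp_all flip: length_greater_0_conv)
    ultimately show ?thesis using openin_subset[OF openin_Z] by blast
  qed
  ultimately show ?thesis by blast
qed

text \<open>All sufficiently large levels are quantified rather than a single pair, so that the
  property survives finite intersections by taking a maximum.\<close>

definition basic_nbhd where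
  "basic_nbhd W x m y N \<longleftrightarrow> (\<forall>k\<ge>N. \<forall>l\<ge>N. m = int k - int l \<longrightarrow> (shift ^^ k) x = (shift ^^ l) y
     \<longrightarrow> Z (pre k x) (pre l y) \<subseteq> W)"

lemma open_basic_nbhd:
  assumes "openin (arrow_top GX) W" "(x, m, y) \<in> W"
  shows "\<exists>N. basic_nbhd W x m y N"
proof -
  let ?S = "{{(x, int k - int l, y) | x y. x \<in> A \<and> y \<in> B \<and> (shift ^^ k) x = (shift ^^ l) y}
         | A B k l. openin (sft D) A \<and> openin (sft D) B \<and> k \<ge> 1 \<and> l \<ge> 1}"
  have "generate_topology_on ?S W"
    using assms(1) unfolding sft_groupoid_def by (simp add: openin_topology_generated_by_iff)
  then show ?thesis using assms(2)
  proof (induction arbitrary: x m y)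
    case (Int a b)
    then obtain N1 N2 where "basic_nbhd a x m y N1" "basic_nbhd b x m y N2" by (metis IntE)
    then have "basic_nbhd (a \<inter> b) x m y (max N1 N2)" unfolding basic_nbhd_def by auto
    then show ?case by blast
  next
    case (UN K)
    then obtain a where "a \<in> K" "(x, m, y) \<in> a" by blast
    with UN.IH obtain N where "basic_nbhd a x m y N" by metis
    then have "basic_nbhd (\<Union>K) x m y N" using \<open>a \<in> K\<close> unfolding basic_nbhd_def by blast
    then show ?case by blast
  next
    case (Basis s)
    then obtain A B k0 l0 where s: "s = {(x, int k0 - int l0, y) | x y. x \<in> A \<and> y \<in> B \<and> (shift ^^ k0) x = (shift ^^ l0) y}"
      and A: "openin (sft D) A" and B: "openin (sft D) B" by auto
    with Basis have xy: "m = int k0 - int l0" "x \<in> A" "y \<in> B" "(shift ^^ k0) x = (shift ^^ l0) y" by auto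
    obtain n1 where n1: "\<And>w. w \<in> X \<Longrightarrow> pre n1 w = pre n1 x \<Longrightarrow> w \<in> A"
      using A xy(2) unfolding openin_sft_iff by blast
    obtain n2 where n2: "\<And>w. w \<in> X \<Longrightarrow> pre n2 w = pre n2 y \<Longrightarrow> w \<in> B"
      using B xy(3) unfolding openin_sft_iff by blast
    \<comment> \<open>Levels beyond \<open>n1\<close> and \<open>n2\<close> keep the prefixes that
      place the two ends in \<open>A\<close> and \<open>B\<close>. Levels beyond \<open>k0\<close>
      and \<open>l0\<close> keep the relation of the generator, since equal lags give
      \<open>k - k0 = l - l0\<close>.\<close>
    have "basic_nbhd s x m y (n1 + n2 + k0 + l0)"
      unfolding basic_nbhd_def
    proof (intro allI impI subsetI)
      fix k l g assume kl: "k \<ge> n1 + n2 + k0 + l0" "l \<ge> n1 + n2 + k0 + l0" "m = int k - int l"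
         "(shift ^^ k) x = (shift ^^ l) y" and "g \<in> Z (pre k x) (pre l y)"
      then obtain z where g: "g = (conc (pre k x) z, m, conc (pre l y) z)"
        and z: "conc (pre k x) z \<in> X" "conc (pre l y) z \<in> X" by (auto simp: Z_def)
      have "pre n1 (conc (pre k x) z) = pre n1 x" "pre n2 (conc (pre l y) z) = pre n2 y"
        using kl by (auto simp: pre_eq_iff conc_def)
      moreover have "k - k0 = l - l0" using kl xy by linarith
      then have "(shift ^^ k0) (conc (pre k x) z) = (shift ^^ l0) (conc (pre l y) z)"
        using kl xy by (simp add: shift_conc_pre)
      ultimately show "g \<in> s" using n1 n2 z xy unfolding g s by auto
    qed
    then show ?case by blast
  qed simp
qed

end

text \<open>\<open>Y_level\<close> is clopenness made uniform; \<open>clopen_level\<close> obtains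
  \<open>N0\<close> from compactness. Its positivity makes all words of length at least
  \<open>N0\<close> non-empty.\<close>

locale sft_clopen = irred_graph D for D :: "('v, 'e) pre_digraph" +
  fixes Y :: "(nat \<Rightarrow> 'e) set" and N0 :: nat
  assumes Y_sub: "Y \<subseteq> X" and Y_ne: "Y \<noteq> {}" and N0_pos: "N0 > 0"
    and Y_level: "\<And>x y. x \<in> Y \<Longrightarrow> y \<in> X \<Longrightarrow> pre N0 y = pre N0 x \<Longrightarrow> y \<in> Y"
begin

abbreviation G where "G \<equiv> sft_reduction D Y"

abbreviation u :: "(nat \<Rightarrow> 'e) \<Rightarrow> (nat \<Rightarrow> 'e) \<times> int \<times> (nat \<Rightarrow> 'e)" where "u \<equiv> unit_arrow"

text \<open>Since \<open>Y\<close> is a union of cylinders of words of length \<open>N0\<close>, the words below are the nodes of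
  a forest with root level \<open>N0\<close>.\<close>

definition Yp :: "'e list \<Rightarrow> bool" where
  "Yp \<mu> \<longleftrightarrow> path \<mu> \<and> N0 \<le> length \<mu> \<and> cyl \<mu> \<subseteq> Y"

definition arr :: "((nat \<Rightarrow> 'e) \<times> int \<times> (nat \<Rightarrow> 'e)) set" where
  "arr = {(x, m, y) \<in> arrows. x \<in> Y \<and> y \<in> Y}"

lemma inj_u: "inj_on u A"
  by (auto simp: inj_on_def unit_arrow_def)

lemma u_eq [simp]: "u x = u y \<longleftrightarrow> x = y"
  by (auto simp: unit_arrow_def)

lemma u_in_image [simp]: "u x \<in> u ` A \<longleftrightarrow> x \<in> A"
  by (auto simp: unit_arrow_def)

lemma groupoid_simps [simp]:
  "rng G (x, m, y) = u x" "src G (x, m, y) = u y" "gcomp G (x, m, y) (x', n, z) = (x, m + n, z)"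
  "rng GX (x, m, y) = u x" "src GX (x, m, y) = u y"
  by (simp_all add: rng_def src_def sft_reduction_def reduction_def sft_groupoid_def unit_arrow_def)

lemma arrow_top_G: "arrow_top G = subtopology (arrow_top GX) arr"
proof -
  have "arrow_top G = subtopology (arrow_top GX) {g. rng GX g \<in> u ` Y \<and> src GX g \<in> u ` Y}"
    by (simp add: sft_reduction_def reduction_def)
  also have "\<dots> = subtopology (arrow_top GX)
      (topspace (arrow_top GX) \<inter> {g. rng GX g \<in> u ` Y \<and> src GX g \<in> u ` Y})"
    by (rule subtopology_restrict[symmetric])
  also have "topspace (arrow_top GX) \<inter> {g. rng GX g \<in> u ` Y \<and> src GX g \<in> u ` Y} = arr"
    by (auto simp: topspace_GX arr_def)
  finally show ?thesis .
qed

lemma arr_arrows: "arr \<subseteq> arrows"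
  by (auto simp: arr_def)

lemma topspace_G [simp]: "topspace (arrow_top G) = arr"
  using arr_arrows by (auto simp: arrow_top_G topspace_GX)

lemma in_Y_if_long: "x \<in> Y \<Longrightarrow> y \<in> X \<Longrightarrow> N0 \<le> n \<Longrightarrow> pre n y = pre n x \<Longrightarrow> y \<in> Y"
  by (rule Y_level) (auto simp: pre_eq_iff)

lemma Yp_pre: "x \<in> Y \<Longrightarrow> N0 \<le> n \<Longrightarrow> Yp (pre n x)"
  unfolding Yp_def cyl_def using path_pre[of x n] Y_sub N0_pos in_Y_if_long by auto

lemma Yp_prefix: "Yp \<mu> \<Longrightarrow> prefix \<mu> \<nu> \<Longrightarrow> path \<nu> \<Longrightarrow> Yp \<nu>"
  unfolding Yp_def using cyl_mono prefix_length_le by (metis le_trans subset_trans)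

lemma Yp_path: "Yp \<mu> \<Longrightarrow> path \<mu>"
  by (simp add: Yp_def)

lemma Yp_not_Nil: "Yp \<mu> \<Longrightarrow> \<mu> \<noteq> []"
  by (auto simp: Yp_def)

lemma Yp_conc: "Yp \<mu> \<Longrightarrow> conc \<mu> z \<in> X \<Longrightarrow> conc \<mu> z \<in> Y"
  unfolding Yp_def using conc_in_cyl by blast

lemma Z_arr: "Yp \<mu> \<Longrightarrow> Yp \<nu> \<Longrightarrow> Z \<mu> \<nu> \<subseteq> arr"
  using Z_arrows[of \<mu> \<nu>] Yp_conc by (auto simp: arr_def Z_def)

lemma openin_Z_G: "Yp \<mu> \<Longrightarrow> Yp \<nu> \<Longrightarrow> openin (arrow_top G) (Z \<mu> \<nu>)"
  unfolding arrow_top_G openin_subtopology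
  using openin_Z[OF Yp_not_Nil Yp_not_Nil, of \<mu> \<nu>] Z_arr[of \<mu> \<nu>] by (auto simp: Int_absorb2)

lemma openin_arr: "openin (arrow_top GX) arr"
proof (subst openin_subopen, safe)
  fix x m y assume g: "(x, m, y) \<in> arr"
  then obtain k l where kl: "k \<ge> N0" "l \<ge> N0" "m = int k - int l" "(shift ^^ k) x = (shift ^^ l) y"
    using arrow_levels arr_arrows by blast
  have xy: "x \<in> Y" "y \<in> Y" using g by (auto simp: arr_def)
  then have Yp: "Yp (pre k x)" "Yp (pre l y)" using Yp_pre kl by auto
  moreover have "(x, m, y) \<in> Z (pre k x) (pre l y)"
    using arrow_in_Z[OF _ _ kl(4)] xy Y_sub kl(3) by blast
  ultimately show "\<exists>T. openin (arrow_top GX) T \<and> (x, m, y) \<in> T \<and> T \<subseteq> arr"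
    using openin_Z[OF Yp_not_Nil Yp_not_Nil, OF Yp] Z_arr[OF Yp] by blast
qed

text \<open>For the converse, each arrow of the reduction lies in sets \<open>Z\<close> of
  arbitrarily high levels, and these are open once the levels reach \<open>N0\<close>. This
  criterion replaces the generated topology from here on.\<close>

lemma openin_G_iff:
  "openin (arrow_top G) W \<longleftrightarrow> W \<subseteq> arr \<and> (\<forall>x m y. (x, m, y) \<in> W \<longrightarrow> (\<exists>N. basic_nbhd W x m y N))"
proof
  assume L: "openin (arrow_top G) W"
  then have "openin (arrow_top GX) W \<and> W \<subseteq> arr"
    unfolding arrow_top_G openin_open_subtopology[OF openin_arr] .
  then show "W \<subseteq> arr \<and> (\<forall>x m y. (x, m, y) \<in> W \<longrightarrow> (\<exists>N. basic_nbhd W x m y N))"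
    using open_basic_nbhd by blast
next
  assume R: "W \<subseteq> arr \<and> (\<forall>x m y. (x, m, y) \<in> W \<longrightarrow> (\<exists>N. basic_nbhd W x m y N))"
  show "openin (arrow_top G) W"
  proof (subst openin_subopen, safe)
    fix x m y assume g: "(x, m, y) \<in> W"
    then obtain N where N: "basic_nbhd W x m y N" using R by blast
    have "(x, m, y) \<in> arrows" using g R arr_arrows by blast
    then obtain k l where kl: "k \<ge> N + N0" "l \<ge> N + N0" "m = int k - int l" "(shift ^^ k) x = (shift ^^ l) y"
      using arrow_levels by blast
    have xy: "x \<in> Y" "y \<in> Y" using g R by (auto simp: arr_def)
    then have "Yp (pre k x)" "Yp (pre l y)" using Yp_pre kl by auto
    moreover have "Z (pre k x) (pre l y) \<subseteq> W" using N kl unfolding basic_nbhd_def by auto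
    moreover have "(x, m, y) \<in> Z (pre k x) (pre l y)"
      using arrow_in_Z[OF _ _ kl(4)] xy Y_sub kl(3) by blast
    ultimately show "\<exists>T. openin (arrow_top G) T \<and> (x, m, y) \<in> T \<and> T \<subseteq> W"
      using openin_Z_G by blast
  qed
qed

lemma unit_in_arr: "x \<in> Y \<Longrightarrow> u x \<in> arr"
  using Y_sub by (auto simp: arr_def arrows_def unit_arrow_def intro!: exI[of _ 0])

lemma unit_space_G [simp]: "unit_space G = u ` Y"
proof -
  have "rng G g \<in> u ` Y" if "g \<in> arr" for g using that by (cases g) (auto simp: arr_def)
  moreover have "u x \<in> rng G ` arr" if "x \<in> Y" for x
    using unit_in_arr[OF that] by (auto simp: unit_arrow_def intro!: image_eqI)
  ultimately show ?thesis unfolding unit_space_def by auto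
qed

lemma Z_diag: "Z \<mu> \<mu> = u ` {x \<in> X. x \<in> cyl \<mu>}"
proof -
  have "u x \<in> Z \<mu> \<mu>" if "x \<in> cyl \<mu>" for x
    using that by (auto simp: Z_def unit_arrow_def elim: cylE)
  moreover have "g \<in> u ` {x \<in> X. x \<in> cyl \<mu>}" if "g \<in> Z \<mu> \<mu>" for g
    using that conc_in_cyl by (auto simp: Z_def unit_arrow_def)
  ultimately show ?thesis by auto
qed

text \<open>By \<open>Z_diag\<close> the sets \<open>Z \<mu> \<mu>\<close> are the images of the
  cylinders, so the unit space carries the topology of \<open>Y\<close> as a subspace of
  \<open>X\<close>.\<close>

lemma openin_unit_iff:
  "openin (unit_top G) (u ` A) \<longleftrightarrow> A \<subseteq> Y \<and> (\<forall>x\<in>A. \<exists>n. \<forall>y\<in>X. pre n y = pre n x \<longrightarrow> y \<in> A)"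
proof
  assume L: "openin (unit_top G) (u ` A)"
  then obtain W where W: "openin (arrow_top G) W" "u ` A = W \<inter> u ` Y"
    unfolding unit_top_def openin_subtopology by auto
  have sub: "A \<subseteq> Y" using W(2) by (metis inf.cobounded2 subset_image_iff inj_on_image_eq_iff inj_u subset_UNIV)
  have "\<exists>n. \<forall>y\<in>X. pre n y = pre n x \<longrightarrow> y \<in> A" if x: "x \<in> A" for x
  proof -
    have "u x \<in> W" using W(2) x by blast
    then obtain N where N: "basic_nbhd W x 0 x N" using W(1) unfolding openin_G_iff unit_arrow_def by blast
    have "y \<in> A" if y: "y \<in> X" "pre (N + N0) y = pre (N + N0) x" for y
    proof -
      have "Z (pre (N + N0) x) (pre (N + N0) x) \<subseteq> W" using N by (simp add: basic_nbhd_def)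
      moreover have "y \<in> cyl (pre (N + N0) x)" using y by (simp add: cyl_def)
      ultimately have "u y \<in> W" using y Z_diag by blast
      moreover have "y \<in> Y" using in_Y_if_long[OF _ y(1) _ y(2)] x sub by auto
      ultimately have "u y \<in> u ` A" using W(2) by blast
      then show ?thesis by simp
    qed
    then show ?thesis by blast
  qed
  with sub show "A \<subseteq> Y \<and> (\<forall>x\<in>A. \<exists>n. \<forall>y\<in>X. pre n y = pre n x \<longrightarrow> y \<in> A)" by blast
next
  assume R: "A \<subseteq> Y \<and> (\<forall>x\<in>A. \<exists>n. \<forall>y\<in>X. pre n y = pre n x \<longrightarrow> y \<in> A)"
  have "openin (arrow_top G) (u ` A)"
    unfolding openin_G_iff
  proof (intro conjI allI impI)
    show "u ` A \<subseteq> arr" using R unit_in_arr by blast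
    fix x m y assume "(x, m, y) \<in> u ` A"
    then have xy: "m = 0" "y = x" "x \<in> A" by (auto simp: unit_arrow_def)
    then obtain n where n: "\<And>y. y \<in> X \<Longrightarrow> pre n y = pre n x \<Longrightarrow> y \<in> A" using R by blast
    have "basic_nbhd (u ` A) x m y n"
      unfolding basic_nbhd_def
    proof (intro allI impI)
      fix k l assume kl: "k \<ge> n" "l \<ge> n" "m = int k - int l"
      then have "l = k" using xy by simp
      have "w \<in> A" if "w \<in> cyl (pre k x)" for w
        using that n[of w] kl by (auto simp: cyl_def pre_eq_iff)
      then show "Z (pre k x) (pre l y) \<subseteq> u ` A" unfolding \<open>l = k\<close> xy Z_diag by auto
    qed
    then show "\<exists>N. basic_nbhd (u ` A) x m y N" by blast
  qed
  then show "openin (unit_top G) (u ` A)"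
    unfolding unit_top_def openin_subtopology using R by auto
qed

lemma topspace_unit [simp]: "topspace (unit_top G) = u ` Y"
  using unit_in_arr by (auto simp: unit_top_def)

lemma openin_unit_image: "openin (unit_top G) W \<Longrightarrow> \<exists>A\<subseteq>Y. W = u ` A"
  using openin_subset[of "unit_top G" W] by (simp add: subset_image_iff)

text \<open>Distinct arrows differ in range, source or lag, and a set \<open>Z\<close> at high
  levels pins down the lag and long prefixes of both ends. The property later turns compact open
  sets into closed ones, so that their indicators are chains.\<close>

lemma Hausdorff_G: "Hausdorff_space (arrow_top G)"
  unfolding Hausdorff_space_def
proof (intro allI impI)
  fix g g' assume *: "g \<in> topspace (arrow_top G) \<and> g' \<in> topspace (arrow_top G) \<and> g \<noteq> g'"
  obtain x m y where g: "g = (x, m, y)" by (cases g)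
  obtain x' m' y' where g': "g' = (x', m', y')" by (cases g')
  have arr: "(x, m, y) \<in> arr" "(x', m', y') \<in> arr" using * g g' by auto
  then have Y: "x \<in> Y" "y \<in> Y" "x' \<in> Y" "y' \<in> Y" by (auto simp: arr_def)
  obtain n where n: "x \<noteq> x' \<Longrightarrow> pre n x \<noteq> pre n x'" "y \<noteq> y' \<Longrightarrow> pre n y \<noteq> pre n y'"
  proof -
    obtain i j where ij: "x \<noteq> x' \<Longrightarrow> x i \<noteq> x' i" "y \<noteq> y' \<Longrightarrow> y j \<noteq> y' j" by (metis ext)
    show ?thesis using ij by (intro that[of "Suc (i + j)"]) (auto simp: pre_eq_iff)
  qed
  obtain k l where kl: "k \<ge> n + N0" "l \<ge> n + N0" "m = int k - int l" "(shift ^^ k) x = (shift ^^ l) y"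
    using arrow_levels arr(1) arr_arrows by blast
  obtain k' l' where kl': "k' \<ge> n + N0" "l' \<ge> n + N0" "m' = int k' - int l'" "(shift ^^ k') x' = (shift ^^ l') y'"
    using arrow_levels arr(2) arr_arrows by blast
  have "disjnt (Z (pre k x) (pre l y)) (Z (pre k' x') (pre l' y'))"
  proof -
    have False if h: "h \<in> Z (pre k x) (pre l y)" "h \<in> Z (pre k' x') (pre l' y')" for h
    proof -
      obtain a p b where abp: "h = (a, p, b)" by (cases h)
      have "p = m" "a \<in> cyl (pre k x)" "b \<in> cyl (pre l y)"
        using h(1) kl(3) by (auto simp: Z_eq_generator abp)
      moreover have "p = m'" "a \<in> cyl (pre k' x')" "b \<in> cyl (pre l' y')"
        using h(2) kl'(3) by (auto simp: Z_eq_generator abp)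
      ultimately have pre: "m = m'" "pre k a = pre k x" "pre l b = pre l y" "pre k' a = pre k' x'" "pre l' b = pre l' y'"
        by (simp_all add: cyl_def)
      then have "pre n x = pre n x'" "pre n y = pre n y'"
        using pre(2-)[THEN pre_eq_mono, of n] kl(1,2) kl'(1,2) by simp_all
      with pre(1) show False using n * g g' by auto
    qed
    then show ?thesis by (auto simp: disjnt_def)
  qed
  moreover have "openin (arrow_top G) (Z (pre k x) (pre l y))" "openin (arrow_top G) (Z (pre k' x') (pre l' y'))"
    using openin_Z_G Yp_pre Y kl kl' by auto
  moreover have "g \<in> Z (pre k x) (pre l y)" "g' \<in> Z (pre k' x') (pre l' y')"
    using arrow_in_Z[OF _ _ kl(4)] arrow_in_Z[OF _ _ kl'(4)] Y Y_sub kl(3) kl'(3) g g' by blast+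
  ultimately show "\<exists>U V. openin (arrow_top G) U \<and> openin (arrow_top G) V \<and> g \<in> U \<and> g' \<in> V \<and> disjnt U V"
    by blast
qed

text \<open>The tails starting at the common terminal vertex form a compact set \<open>C\<close>,
  and \<open>Z \<mu> \<nu>\<close> is its image under the continuous map that puts both prefixes in
  front of a tail.\<close>

lemma compactin_Z:
  assumes "Yp \<mu>" "Yp \<nu>" "fin \<mu> = fin \<nu>"
  shows "compactin (arrow_top G) (Z \<mu> \<nu>)"
proof -
  define C where "C = {z \<in> X. tail D (z 0) = fin \<mu>}"
  define f where "f z = (conc \<mu> z, int (length \<mu>) - int (length \<nu>), conc \<nu> z)" for z
  have conc: "conc \<mu> z \<in> X" "conc \<nu> z \<in> X" if "z \<in> C" for z
    using that assms conc_X_iff Yp_path by (auto simp: C_def)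
  have fC: "f ` C = Z \<mu> \<nu>"
    using conc conc_X_iff[OF Yp_path[OF assms(1)]] by (auto simp: Z_def f_def C_def image_def)
  have "openin (sft D) (X - C)"
    unfolding openin_sft_iff by (auto simp: C_def pre_eq_iff intro!: exI[of _ "Suc 0"])
  then have "closedin (sft D) C" by (auto simp: closedin_def C_def X_def)
  then have "compactin (sft D) C" by (rule closedin_compact_space[OF compact_sft])
  then have "compactin (subtopology (sft D) C) C" by (simp add: compactin_subtopology)
  moreover have "continuous_map (subtopology (sft D) C) (arrow_top G) f"
    unfolding continuous_map_def
  proof (intro conjI allI impI)
    show "f \<in> topspace (subtopology (sft D) C) \<rightarrow> topspace (arrow_top G)"
      using fC Z_arr[OF assms(1,2)] by auto
    fix W assume W: "openin (arrow_top G) W"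
    have "openin (sft D) {z \<in> C. f z \<in> W}"
      unfolding openin_sft_iff
    proof (intro conjI ballI)
      show "{z \<in> C. f z \<in> W} \<subseteq> X" by (auto simp: C_def)
      fix z assume z: "z \<in> {z \<in> C. f z \<in> W}"
      then obtain N where N: "basic_nbhd W (conc \<mu> z) (int (length \<mu>) - int (length \<nu>)) (conc \<nu> z) N"
        using W unfolding openin_G_iff f_def by blast
      \<comment> \<open>The extra letter in \<open>Suc N\<close> guarantees that the first edge of
        the tail is kept, and with it membership in \<open>C\<close>.\<close>
      have "z' \<in> {z \<in> C. f z \<in> W}" if z': "z' \<in> X" "pre (Suc N) z' = pre (Suc N) z" for z'
      proof -
        have C: "z' \<in> C" using z z' by (auto simp: C_def pre_eq_iff)
        have "(shift ^^ (length \<mu> + Suc N)) (conc \<mu> z) = (shift ^^ (length \<nu> + Suc N)) (conc \<nu> z)"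
          by (rule shift_add_eq) simp
        then have "Z (\<mu> @ pre (Suc N) z) (\<nu> @ pre (Suc N) z) \<subseteq> W"
          using N[unfolded basic_nbhd_def, rule_format, of "length \<mu> + Suc N" "length \<nu> + Suc N"]
          unfolding pre_conc_add by simp
        moreover have "f z' \<in> Z (\<mu> @ pre (Suc N) z) (\<nu> @ pre (Suc N) z)"
          unfolding Z_def f_def using conc[OF C] conc_pre_shift[of "Suc N" z'] z'
          by (auto simp: conc_append intro!: exI[of _ "(shift ^^ (Suc N)) z'"])
        ultimately show ?thesis using C by blast
      qed
      then show "\<exists>n. \<forall>y\<in>X. pre n y = pre n z \<longrightarrow> y \<in> {z \<in> C. f z \<in> W}" by blast
    qed
    moreover have "{z \<in> topspace (subtopology (sft D) C). f z \<in> W} = {z \<in> C. f z \<in> W} \<inter> C"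
      by (auto simp: C_def simp flip: X_def)
    ultimately show "openin (subtopology (sft D) C) {z \<in> topspace (subtopology (sft D) C). f z \<in> W}"
      by (metis openin_subtopology_Int)
  qed
  ultimately have "compactin (arrow_top G) (f ` C)" by (rule image_compactin)
  then show ?thesis by (simp add: fC)
qed

section \<open>Elements of the topological full group\<close>

text \<open>The source word comes first and its image second, opposite to
  \<open>Z \<mu> \<nu>\<close>, which lists the range first. Equal terminal vertices ensure that the
  same tails fit both words.\<close>

definition moves where
  "moves \<alpha> \<nu> \<mu> \<longleftrightarrow> Yp \<nu> \<and> Yp \<mu> \<and> fin \<nu> = fin \<mu> \<and>
     (\<forall>z. conc \<nu> z \<in> X \<longrightarrow> \<alpha> (u (conc \<nu> z)) = u (conc \<mu> z))"

definition locally_moves where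
  "locally_moves \<alpha> \<longleftrightarrow> (\<forall>x\<in>Y. \<exists>\<nu> \<mu>. x \<in> cyl \<nu> \<and> moves \<alpha> \<nu> \<mu>)"

text \<open>The candidate for the unique compact open \<open>G\<close>-set representing
  \<open>\<alpha>\<close>. The union over all local descriptions avoids a choice of levels; that at
  most one arrow starts at each point is then a fact to prove,
  \<open>graph_set_functional\<close>.\<close>

definition graph_set where
  "graph_set \<alpha> = \<Union> {Z \<mu> \<nu> | \<mu> \<nu>. moves \<alpha> \<nu> \<mu>}"

lemma conc_X_cong: "path \<mu> \<Longrightarrow> path \<nu> \<Longrightarrow> fin \<mu> = fin \<nu> \<Longrightarrow> conc \<mu> z \<in> X \<longleftrightarrow> conc \<nu> z \<in> X"
  by (simp add: conc_X_iff)

lemma moves_conc_X: "moves \<alpha> \<nu> \<mu> \<Longrightarrow> conc \<nu> z \<in> X \<longleftrightarrow> conc \<mu> z \<in> X"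
  by (auto simp: moves_def Yp_path conc_X_iff)

lemma moves_apply: "moves \<alpha> \<nu> \<mu> \<Longrightarrow> conc \<nu> z \<in> X \<Longrightarrow> \<alpha> (u (conc \<nu> z)) = u (conc \<mu> z)"
  by (simp add: moves_def)

lemma moves_extend:
  assumes "moves \<alpha> \<nu> \<mu>" "path (\<nu> @ s)"
  shows "moves \<alpha> (\<nu> @ s) (\<mu> @ s)"
proof -
  have *: "Yp \<nu>" "Yp \<mu>" "fin \<nu> = fin \<mu>" using assms by (auto simp: moves_def)
  then have "path (\<mu> @ s)" using path_replace assms(2) Yp_path by blast
  then have "Yp (\<nu> @ s)" "Yp (\<mu> @ s)" "fin (\<nu> @ s) = fin (\<mu> @ s)"
    using *(1,2) Yp_prefix assms(2) fin_append_cong[OF *(3)] by auto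
  then show ?thesis using assms(1) by (simp add: moves_def conc_append)
qed

lemma moves_at:
  assumes "moves \<alpha> \<nu> \<mu>" "x \<in> cyl \<nu>" "length \<nu> \<le> n"
  shows "moves \<alpha> (pre n x) (\<mu> @ pre (n - length \<nu>) ((shift ^^ length \<nu>) x))"
proof -
  have "pre n x = \<nu> @ pre (n - length \<nu>) ((shift ^^ length \<nu>) x)"
    using assms(2,3) pre_add[of "length \<nu>" "n - length \<nu>" x] by (simp add: cyl_def)
  moreover have "path (pre n x)"
    using assms path_pre[of x n] by (cases "n = 0") (auto simp: cyl_def moves_def Yp_def)
  ultimately show ?thesis using moves_extend[OF assms(1)] by metis
qed

lemma moves_compose:
  assumes "moves \<beta> \<nu> \<mu>" "moves \<alpha> \<mu> \<rho>"
  shows "moves (compose (u ` Y) \<alpha> \<beta>) \<nu> \<rho>"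
  using assms moves_conc_X[OF assms(1)] Yp_conc[of \<nu>] unfolding moves_def by (auto simp: compose_def)

text \<open>On the smaller cylinder both descriptions give the same point,
  \<open>conc (\<mu> @ s) z = conc \<mu>' z\<close>, for all admissible tails. Shifting it by either
  length returns \<open>z\<close>, and \<open>shift_powers_differ\<close> forces the lengths to
  agree. So the lag is determined by the map.\<close>

lemma moves_lag_aux:
  assumes "moves \<alpha> \<nu> \<mu>" "moves \<alpha> \<nu>' \<mu>'" "prefix \<nu> \<nu>'"
  shows "length \<mu> + length \<nu>' = length \<mu>' + length \<nu>"
proof -
  obtain s where s: "\<nu>' = \<nu> @ s" using assms(3) by (rule prefixE)
  have m: "moves \<alpha> \<nu>' (\<mu> @ s)" using moves_extend[OF assms(1), of s] assms(2) s
    by (auto simp: moves_def Yp_path)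
  have eq: "conc (\<mu> @ s) z = conc \<mu>' z" if "conc \<nu>' z \<in> X" for z
    using moves_apply[OF m that] moves_apply[OF assms(2) that] by simp
  have "length (\<mu> @ s) = length \<mu>'"
  proof (rule shift_powers_differ)
    show "path (\<mu> @ s)" using m by (simp add: moves_def Yp_path)
    fix z assume "conc (\<mu> @ s) z \<in> X"
    then have "conc (\<mu> @ s) z = conc \<mu>' z" using eq moves_conc_X[OF m] by blast
    then show "(shift ^^ length (\<mu> @ s)) (conc (\<mu> @ s) z) = (shift ^^ length \<mu>') (conc (\<mu> @ s) z)"
      by (metis shift_conc)
  qed
  then show ?thesis by (simp add: s)
qed

lemma moves_lag:
  assumes "moves \<alpha> \<nu> \<mu>" "moves \<alpha> \<nu>' \<mu>'" "x \<in> cyl \<nu>" "x \<in> cyl \<nu>'"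
  shows "int (length \<mu>) - int (length \<nu>) = int (length \<mu>') - int (length \<nu>')"
proof -
  have "prefix \<nu> \<nu>' \<or> prefix \<nu>' \<nu>" using assms(3,4) cyl_disjoint by blast
  then show ?thesis using moves_lag_aux assms(1,2) by fastforce
qed

lemma graph_set_iff:
  "(a, m, b) \<in> graph_set \<alpha> \<longleftrightarrow>
     (\<exists>\<nu> \<mu>. moves \<alpha> \<nu> \<mu> \<and> b \<in> cyl \<nu> \<and> m = int (length \<mu>) - int (length \<nu>) \<and> \<alpha> (u b) = u a)"
  (is "?L \<longleftrightarrow> ?R")
proof
  assume ?L
  then obtain \<mu> \<nu> z where "moves \<alpha> \<nu> \<mu>" "a = conc \<mu> z" "b = conc \<nu> z"
    "m = int (length \<mu>) - int (length \<nu>)" "conc \<nu> z \<in> X"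
    unfolding graph_set_def Z_def by auto
  then show ?R using moves_apply conc_in_cyl by blast
next
  assume ?R
  then obtain \<nu> \<mu> where *: "moves \<alpha> \<nu> \<mu>" "b \<in> cyl \<nu>" "m = int (length \<mu>) - int (length \<nu>)" "\<alpha> (u b) = u a"
    by blast
  from *(2) obtain z where z: "b = conc \<nu> z" "conc \<nu> z \<in> X" by (rule cylE)
  then have "a = conc \<mu> z" using *(4) moves_apply[OF *(1)] by simp
  then have "(a, m, b) \<in> Z \<mu> \<nu>" using * z moves_conc_X[OF *(1)] by (auto simp: Z_def)
  then show ?L using *(1) unfolding graph_set_def by blast
qed

lemma graph_set_functional:
  assumes "(a, m, b) \<in> graph_set \<alpha>" "(a', m', b) \<in> graph_set \<alpha>"
  shows "a = a' \<and> m = m'"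
  using assms moves_lag unfolding graph_set_iff by (metis u_eq)

lemma graph_set_src: "(a, m, b) \<in> graph_set \<alpha> \<Longrightarrow> a \<in> Y \<and> b \<in> Y \<and> \<alpha> (u b) = u a"
  unfolding graph_set_iff by (metis Yp_conc cylE moves_apply moves_conc_X moves_def u_eq)

lemma graph_set_total:
  assumes "locally_moves \<alpha>" "x \<in> Y"
  shows "\<exists>a m. (a, m, x) \<in> graph_set \<alpha>"
proof -
  obtain \<nu> \<mu> where *: "x \<in> cyl \<nu>" "moves \<alpha> \<nu> \<mu>" using assms by (auto simp: locally_moves_def)
  from *(1) obtain z where "x = conc \<nu> z" "conc \<nu> z \<in> X" by (rule cylE)
  with * have "\<alpha> (u x) = u (conc \<mu> z)" using moves_apply by blast
  with * show ?thesis unfolding graph_set_iff by blast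
qed

lemma openin_graph_set: "openin (arrow_top G) (graph_set \<alpha>)"
  unfolding graph_set_def by (rule openin_Union) (auto simp: moves_def intro: openin_Z_G)

lemma compactin_Y: "compactin (sft D) Y"
proof -
  have "openin (sft D) (X - Y)"
    unfolding openin_sft_iff using Y_level by (auto intro!: exI[of _ N0])
  then have "closedin (sft D) Y" using Y_sub by (auto simp: closedin_def X_def)
  then show ?thesis by (rule closedin_compact_space[OF compact_sft])
qed

text \<open>Compactness of \<open>Y\<close> leaves finitely many local descriptions; extending their
  source words to one length \<open>n\<close>, at least as large as all of theirs, gives a finite
  table.\<close>

lemma uniform_level:
  assumes "locally_moves \<alpha>"
  obtains n b where "n \<ge> N0" "\<forall>x\<in>Y. moves \<alpha> (pre n x) (b (pre n x))"
proof -
  let ?C = "{\<nu>. \<exists>\<mu>. moves \<alpha> \<nu> \<mu>}"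
  have "Y \<subseteq> \<Union> (cyl ` ?C)" using assms unfolding locally_moves_def by blast
  then obtain \<F> where "finite \<F>" "\<F> \<subseteq> cyl ` ?C" "Y \<subseteq> \<Union> \<F>"
    using compactin_Y openin_cyl unfolding compactin_def by (metis (no_types, lifting) imageE)
  then obtain V where V: "finite V" "V \<subseteq> ?C" "Y \<subseteq> \<Union> (cyl ` V)"
    by (metis (no_types, lifting) finite_subset_image)
  define n where "n = N0 + (\<Sum>\<nu>\<in>V. length \<nu>)"
  have "\<exists>\<mu>. moves \<alpha> (pre n x) \<mu>" if x: "x \<in> Y" for x
  proof -
    obtain \<nu> where \<nu>: "\<nu> \<in> V" "x \<in> cyl \<nu>" using V x by blast
    then obtain \<mu> where "moves \<alpha> \<nu> \<mu>" using V by blast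
    moreover have "length \<nu> \<le> n" unfolding n_def using V(1) \<nu>(1)
      by (simp add: member_le_sum trans_le_add2)
    ultimately show ?thesis using moves_at \<nu>(2) by blast
  qed
  then show ?thesis by (intro that[of n "\<lambda>\<nu>. SOME \<mu>. moves \<alpha> \<nu> \<mu>"]) (auto simp: n_def intro: someI_ex)
qed

lemma finite_level: "finite (pre n ` Y)"
proof -
  have "pre n ` Y \<subseteq> {xs. set xs \<subseteq> arcs D \<and> length xs \<le> n}"
    using subsetD[OF Y_sub] by (force simp: pre_def X_iff)
  then show ?thesis using finite_lists_length_le[OF finite_arcs] finite_subset by blast
qed

lemma graph_set_level:
  assumes "n \<ge> N0" "\<forall>x\<in>Y. moves \<alpha> (pre n x) (b (pre n x))"
  shows "graph_set \<alpha> = (\<Union>\<nu>\<in>pre n ` Y. Z (b \<nu>) \<nu>)"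
proof
  show "graph_set \<alpha> \<subseteq> (\<Union>\<nu>\<in>pre n ` Y. Z (b \<nu>) \<nu>)"
  proof clarify
    fix a m x assume g: "(a, m, x) \<in> graph_set \<alpha>"
    then have x: "x \<in> Y" using graph_set_src by blast
    let ?\<nu> = "pre n x"
    have mv: "moves \<alpha> ?\<nu> (b ?\<nu>)" using assms(2) x by blast
    have xe: "x = conc ?\<nu> ((shift ^^ n) x)" by (simp add: conc_pre_shift)
    have xX: "conc ?\<nu> ((shift ^^ n) x) \<in> X" using x Y_sub xe by auto
    have g': "(conc (b ?\<nu>) ((shift ^^ n) x), int (length (b ?\<nu>)) - int (length ?\<nu>), x) \<in> Z (b ?\<nu>) ?\<nu>"
      using xX xe moves_conc_X[OF mv] unfolding Z_def by blast
    then have "(conc (b ?\<nu>) ((shift ^^ n) x), int (length (b ?\<nu>)) - int (length ?\<nu>), x) \<in> graph_set \<alpha>"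
      using mv unfolding graph_set_def by blast
    then show "(a, m, x) \<in> (\<Union>\<nu>\<in>pre n ` Y. Z (b \<nu>) \<nu>)"
      using graph_set_functional[OF g] g' x by blast
  qed
  show "(\<Union>\<nu>\<in>pre n ` Y. Z (b \<nu>) \<nu>) \<subseteq> graph_set \<alpha>"
    using assms(2) unfolding graph_set_def by blast
qed

lemma compactin_graph_set:
  assumes "locally_moves \<alpha>"
  shows "compactin (arrow_top G) (graph_set \<alpha>)"
proof -
  obtain n b where n: "n \<ge> N0" "\<forall>x\<in>Y. moves \<alpha> (pre n x) (b (pre n x))"
    using uniform_level[OF assms] .
  have "compactin (arrow_top G) (Z (b \<nu>) \<nu>)" if "\<nu> \<in> pre n ` Y" for \<nu>
    using n(2) that by (auto simp: moves_def intro!: compactin_Z)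
  then show ?thesis unfolding graph_set_level[OF n]
    using finite_level[of n] by (intro compactin_Union) auto
qed

lemma represents_graph_set:
  assumes "\<alpha> \<in> Bij (u ` Y)" "locally_moves \<alpha>"
  shows "represents G (graph_set \<alpha>) \<alpha>"
proof -
  have bij: "bij_betw \<alpha> (u ` Y) (u ` Y)" and ext: "\<alpha> \<in> extensional (u ` Y)"
    using assms(1) by (auto simp: Bij_def)
  have inj_src: "inj_on (src G) (graph_set \<alpha>)"
    using graph_set_functional by (auto simp: inj_on_def)
  have inj_rng: "inj_on (rng G) (graph_set \<alpha>)"
  proof (rule inj_onI)
    fix g h assume gh: "g \<in> graph_set \<alpha>" "h \<in> graph_set \<alpha>" "rng G g = rng G h"
    obtain a m b where g: "g = (a, m, b)" by (cases g)
    obtain a' m' b' where h: "h = (a', m', b')" by (cases h)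
    have "a' = a" using gh(3) by (simp add: g h)
    moreover have "b \<in> Y" "b' \<in> Y" "\<alpha> (u b) = u a" "\<alpha> (u b') = u a'"
      using gh(1,2)[unfolded g h, THEN graph_set_src] by auto
    ultimately have "b \<in> Y" "b' \<in> Y" "\<alpha> (u b) = \<alpha> (u b')" by simp_all
    then have "b = b'" using bij by (metis bij_betw_inv_into_left image_eqI u_eq)
    then show "g = h" using gh graph_set_functional by (auto simp: g h)
  qed
  have src: "src G ` graph_set \<alpha> = u ` Y"
  proof
    show "src G ` graph_set \<alpha> \<subseteq> u ` Y" using graph_set_src by auto
    show "u ` Y \<subseteq> src G ` graph_set \<alpha>"
    proof (rule image_subsetI)
      fix x assume "x \<in> Y"
      then obtain a m where "(a, m, x) \<in> graph_set \<alpha>" using graph_set_total assms(2) by blast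
      then show "u x \<in> src G ` graph_set \<alpha>" by (metis groupoid_simps(2) imageI)
    qed
  qed
  have rs: "rng G g = \<alpha> (src G g)" if "g \<in> graph_set \<alpha>" for g
    using graph_set_src that by (cases g) auto
  have "rng G ` graph_set \<alpha> = \<alpha> ` (src G ` graph_set \<alpha>)"
    using rs by (auto simp: image_image)
  then have rng: "rng G ` graph_set \<alpha> = u ` Y" using src bij by (simp add: bij_betw_def)
  have "\<alpha> = G_set_map G (graph_set \<alpha>)"
  proof
    fix w
    show "\<alpha> w = G_set_map G (graph_set \<alpha>) w"
    proof (cases "w \<in> u ` Y")
      case True
      then obtain g where g: "g \<in> graph_set \<alpha>" "w = src G g" using src by (metis imageE)
      then show ?thesis using rs[OF g(1)] inj_src src True
        by (simp add: G_set_map_def the_inv_into_f_f)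
    next
      case False
      then show ?thesis using extensional_arb[OF ext False] src by (simp add: G_set_map_def)
    qed
  qed
  then show ?thesis
    unfolding represents_def compact_open_G_set_def
    using compactin_graph_set[OF assms(2)] openin_graph_set inj_rng inj_src src rng by simp
qed

text \<open>An open set contains a full \<open>Z\<close> around each of its arrows, so
  \<open>\<alpha>\<close> is a prefix replacement there and \<open>V\<close> lies in the graph. Both
  sets have an arrow over every source and the graph has only one, so they coincide. This makes the
  definite description in \<open>index_map\<close> meaningful.\<close>

lemma represents_unique:
  assumes "represents G V \<alpha>"
  shows "V = graph_set \<alpha> \<and> locally_moves \<alpha>"
proof -
  have V: "openin (arrow_top G) V" "inj_on (src G) V" "src G ` V = u ` Y" "\<alpha> = G_set_map G V"
    using assms by (auto simp: represents_def compact_open_G_set_def)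
  have Va: "V \<subseteq> arr" using V(1) openin_G_iff by blast
  have val: "\<alpha> (u b) = u a" if "(a, m, b) \<in> V" for a m b
  proof -
    have "b \<in> Y" using that Va by (auto simp: arr_def)
    then show ?thesis using the_inv_into_f_f[OF V(2) that] V(3) by (simp add: V(4) G_set_map_def)
  qed
  have mv: "\<exists>\<nu> \<mu>. moves \<alpha> \<nu> \<mu> \<and> b \<in> cyl \<nu> \<and> m = int (length \<mu>) - int (length \<nu>)"
    if g: "(a, m, b) \<in> V" for a m b
  proof -
    obtain N where N: "basic_nbhd V a m b N" using V(1) g openin_G_iff by blast
    have "(a, m, b) \<in> arrows" using g Va arr_arrows by blast
    then obtain k l where kl: "k \<ge> N + N0" "l \<ge> N + N0" "m = int k - int l" "(shift ^^ k) a = (shift ^^ l) b"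
      using arrow_levels by blast
    have sub: "Z (pre k a) (pre l b) \<subseteq> V" using N kl unfolding basic_nbhd_def by auto
    have ab: "a \<in> Y" "b \<in> Y" using g Va by (auto simp: arr_def)
    then have Yp: "Yp (pre k a)" "Yp (pre l b)" using Yp_pre kl by auto
    have "tail D (a k) = tail D (b l)" using fun_cong[OF kl(4), of 0] by (simp add: shift_pow)
    then have f: "fin (pre k a) = fin (pre l b)" using ab Y_sub kl N0_pos by (subst (1 2) fin_pre) auto
    have "\<alpha> (u (conc (pre l b) z)) = u (conc (pre k a) z)" if z: "conc (pre l b) z \<in> X" for z
    proof (rule val)
      show "(conc (pre k a) z, int (length (pre k a)) - int (length (pre l b)), conc (pre l b) z) \<in> V"
        using sub z conc_X_cong[OF Yp_path Yp_path, OF Yp f] by (auto simp: Z_def)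
    qed
    then have "moves \<alpha> (pre l b) (pre k a)" using Yp f by (simp add: moves_def)
    then show ?thesis using kl(3) in_cyl_pre ab Y_sub by (metis length_pre subsetD)
  qed
  have sub: "V \<subseteq> graph_set \<alpha>"
    using mv val unfolding subset_iff by (auto simp: graph_set_iff)
  moreover have "graph_set \<alpha> \<subseteq> V"
  proof clarify
    fix a m b assume g: "(a, m, b) \<in> graph_set \<alpha>"
    then have "u b \<in> src G ` V" using V(3) graph_set_src by auto
    then obtain a' m' where g': "(a', m', b) \<in> V" by auto
    then show "(a, m, b) \<in> V" using graph_set_functional[OF g] sub by blast
  qed
  moreover have "locally_moves \<alpha>"
    unfolding locally_moves_def
  proof
    fix x assume "x \<in> Y"
    then have "u x \<in> src G ` V" using V(3) by auto
    then obtain a m where "(a, m, x) \<in> V" by auto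
    then show "\<exists>\<nu> \<mu>. x \<in> cyl \<nu> \<and> moves \<alpha> \<nu> \<mu>" using mv by blast
  qed
  ultimately show ?thesis by blast
qed

lemma locally_moves_maps: "locally_moves \<alpha> \<Longrightarrow> x \<in> Y \<Longrightarrow> \<alpha> (u x) \<in> u ` Y"
  using graph_set_total graph_set_src by (metis u_in_image)

lemma continuous_locally_moves:
  assumes "locally_moves \<alpha>"
  shows "continuous_map (unit_top G) (unit_top G) \<alpha>"
  unfolding continuous_map_def
proof (intro conjI allI impI)
  show "\<alpha> \<in> topspace (unit_top G) \<rightarrow> topspace (unit_top G)"
    using locally_moves_maps[OF assms] by auto
  fix W assume W: "openin (unit_top G) W"
  then obtain A where A: "W = u ` A" using openin_unit_image by blast
  have A': "A \<subseteq> Y" "\<And>x. x \<in> A \<Longrightarrow> \<exists>n. \<forall>y\<in>X. pre n y = pre n x \<longrightarrow> y \<in> A"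
    using W unfolding A openin_unit_iff by auto
  define B where "B = {x \<in> Y. \<alpha> (u x) \<in> u ` A}"
  have "openin (unit_top G) (u ` B)"
    unfolding openin_unit_iff
  proof (intro conjI ballI)
    show "B \<subseteq> Y" by (auto simp: B_def)
    fix x assume x: "x \<in> B"
    then obtain \<nu> \<mu> where mv: "x \<in> cyl \<nu>" "moves \<alpha> \<nu> \<mu>" using assms by (auto simp: B_def locally_moves_def)
    from mv(1) obtain z where z: "x = conc \<nu> z" "conc \<nu> z \<in> X" by (rule cylE)
    then have "u (conc \<mu> z) \<in> u ` A" using x moves_apply[OF mv(2)] by (simp add: B_def)
    then obtain n where n: "\<And>y. y \<in> X \<Longrightarrow> pre n y = pre n (conc \<mu> z) \<Longrightarrow> y \<in> A"
      using A'(2)[of "conc \<mu> z"] by auto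
    have "y \<in> B" if y: "y \<in> X" "pre (length \<nu> + n) y = pre (length \<nu> + n) x" for y
    proof -
      have "pre (length \<nu>) y = \<nu>" "pre n ((shift ^^ length \<nu>) y) = pre n z"
        using y(2) unfolding z pre_conc_add by (simp_all add: pre_add)
      then obtain z' where z': "y = conc \<nu> z'" "pre n z' = pre n z" using conc_of_pre by metis
      have "conc \<mu> z' \<in> A"
      proof (rule n)
        show "conc \<mu> z' \<in> X" using moves_conc_X[OF mv(2)] y z' by blast
        show "pre n (conc \<mu> z') = pre n (conc \<mu> z)" using z'(2) by (auto simp: pre_eq_iff conc_def)
      qed
      moreover have "y \<in> Y" using z' y mv(2) Yp_conc by (auto simp: moves_def)
      ultimately show ?thesis using moves_apply[OF mv(2)] y z' by (simp add: B_def)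
    qed
    then show "\<exists>n. \<forall>y\<in>X. pre n y = pre n x \<longrightarrow> y \<in> B" by blast
  qed
  moreover have "{x \<in> topspace (unit_top G). \<alpha> x \<in> W} = u ` B" by (auto simp: B_def A)
  ultimately show "openin (unit_top G) {x \<in> topspace (unit_top G). \<alpha> x \<in> W}" by simp
qed

section \<open>The full group as the group of bijections that are locally prefix
  replacements\<close>

definition inv_map where "inv_map \<alpha> = restrict (inv_into (u ` Y) \<alpha>) (u ` Y)"

lemma moves_inv:
  assumes "\<alpha> \<in> Bij (u ` Y)" "moves \<alpha> \<nu> \<mu>"
  shows "moves (inv_map \<alpha>) \<mu> \<nu>"
proof -
  have inj: "inj_on \<alpha> (u ` Y)" using assms by (auto simp: Bij_def bij_betw_def)
  have "inv_map \<alpha> (u (conc \<mu> z)) = u (conc \<nu> z)" if z: "conc \<mu> z \<in> X" for z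
  proof -
    have Y: "conc \<mu> z \<in> Y" "conc \<nu> z \<in> Y" "conc \<nu> z \<in> X"
      using z assms(2) moves_conc_X[OF assms(2)] Yp_conc by (auto simp: moves_def)
    then have "\<alpha> (u (conc \<nu> z)) = u (conc \<mu> z)" using moves_apply assms(2) by blast
    then show ?thesis using Y inv_into_f_f[OF inj, of "u (conc \<nu> z)"] by (simp add: inv_map_def)
  qed
  then show ?thesis using assms(2) by (auto simp: moves_def)
qed

lemma locally_moves_inv:
  assumes "\<alpha> \<in> Bij (u ` Y)" "locally_moves \<alpha>"
  shows "locally_moves (inv_map \<alpha>)"
  unfolding locally_moves_def
proof
  fix x assume "x \<in> Y"
  then have "u x \<in> \<alpha> ` u ` Y" using assms(1) by (simp add: Bij_def bij_betw_def)
  then obtain w where w: "w \<in> Y" "\<alpha> (u w) = u x" by (metis imageE)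
  obtain \<nu> \<mu> where mv: "w \<in> cyl \<nu>" "moves \<alpha> \<nu> \<mu>" using assms(2) w by (auto simp: locally_moves_def)
  from mv(1) obtain z where z: "w = conc \<nu> z" "conc \<nu> z \<in> X" by (rule cylE)
  then have "x = conc \<mu> z" using w moves_apply[OF mv(2)] by simp
  then have "x \<in> cyl \<mu>" using z moves_conc_X[OF mv(2)] conc_in_cyl by simp
  then show "\<exists>\<nu> \<mu>. x \<in> cyl \<nu> \<and> moves (inv_map \<alpha>) \<nu> \<mu>" using moves_inv assms(1) mv(2) by blast
qed

text \<open>Homeomorphisms and \<open>G\<close>-sets become a combinatorial condition. The inverse
  of a local prefix replacement is again one, which gives continuity in both directions, and
  \<open>graph_set\<close> is the representing set.\<close>

lemma carrier_iff:
  "\<alpha> \<in> carrier (full_group G) \<longleftrightarrow> \<alpha> \<in> Bij (u ` Y) \<and> locally_moves \<alpha>"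
proof
  assume "\<alpha> \<in> carrier (full_group G)"
  then show "\<alpha> \<in> Bij (u ` Y) \<and> locally_moves \<alpha>"
    using represents_unique by (auto simp: full_group_def)
next
  assume *: "\<alpha> \<in> Bij (u ` Y) \<and> locally_moves \<alpha>"
  have bij: "bij_betw \<alpha> (u ` Y) (u ` Y)" using * by (simp add: Bij_def)
  have "homeomorphic_maps (unit_top G) (unit_top G) \<alpha> (inv_map \<alpha>)"
    unfolding homeomorphic_maps_def
  proof (intro conjI ballI)
    show "continuous_map (unit_top G) (unit_top G) \<alpha>" using * continuous_locally_moves by blast
    show "continuous_map (unit_top G) (unit_top G) (inv_map \<alpha>)"
      using * continuous_locally_moves locally_moves_inv by blast
    show "inv_map \<alpha> (\<alpha> w) = w" if "w \<in> topspace (unit_top G)" for w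
      using bij_betw_inv_into_left[OF bij] bij_betw_apply[OF bij] that by (simp add: inv_map_def)
    show "\<alpha> (inv_map \<alpha> w) = w" if "w \<in> topspace (unit_top G)" for w
      using bij_betw_inv_into_right[OF bij] that by (simp add: inv_map_def)
  qed
  then have "homeomorphic_map (unit_top G) (unit_top G) \<alpha>" using homeomorphic_map_maps by blast
  then show "\<alpha> \<in> carrier (full_group G)"
    using * represents_graph_set by (auto simp: full_group_def)
qed

lemma locally_moves_compose:
  assumes "locally_moves \<alpha>" "locally_moves \<beta>"
  shows "locally_moves (compose (u ` Y) \<alpha> \<beta>)"
  unfolding locally_moves_def
proof
  fix x assume x: "x \<in> Y"
  then obtain \<nu> \<mu> where mv: "x \<in> cyl \<nu>" "moves \<beta> \<nu> \<mu>" using assms(2) by (auto simp: locally_moves_def)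
  from mv(1) obtain z where z: "x = conc \<nu> z" "conc \<nu> z \<in> X" by (rule cylE)
  then have z': "conc \<mu> z \<in> X" using moves_conc_X[OF mv(2)] by blast
  then have "conc \<mu> z \<in> Y" using mv(2) Yp_conc by (auto simp: moves_def)
  then obtain \<nu>' \<mu>' where mv': "conc \<mu> z \<in> cyl \<nu>'" "moves \<alpha> \<nu>' \<mu>'"
    using assms(1) by (auto simp: locally_moves_def)
  \<comment> \<open>Lengthening the source word by this many letters makes its image under
    \<open>\<beta>\<close> long enough for \<open>\<alpha>\<close> to act on it by a single
    replacement.\<close>
  let ?k = "length \<nu>'"
  have p: "pre (length \<nu> + ?k) x = \<nu> @ pre ?k z" by (simp add: z pre_conc_add)
  have x': "x \<in> cyl (\<nu> @ pre ?k z)" using in_cyl_pre[of x] z unfolding p[symmetric] by auto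
  have "path (\<nu> @ pre ?k z)" using path_pre[of x] z Yp_not_Nil mv(2) unfolding p[symmetric] moves_def by auto
  then have "moves \<beta> (\<nu> @ pre ?k z) (\<mu> @ pre ?k z)" using moves_extend[OF mv(2)] by blast
  moreover have "\<exists>\<rho>. moves \<alpha> (\<mu> @ pre ?k z) \<rho>"
    using moves_at[OF mv'(2,1), of "length \<mu> + ?k"] unfolding pre_conc_add by auto
  ultimately show "\<exists>\<nu> \<mu>. x \<in> cyl \<nu> \<and> moves (compose (u ` Y) \<alpha> \<beta>) \<nu> \<mu>"
    using x' moves_compose by blast
qed

lemma moves_id: "Yp \<mu> \<Longrightarrow> moves (\<lambda>x\<in>u ` Y. x) \<mu> \<mu>"
  by (simp add: moves_def Yp_conc)

lemma locally_moves_id: "locally_moves (\<lambda>x\<in>u ` Y. x)"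
  unfolding locally_moves_def using moves_id Yp_pre[OF _ order_refl] in_cyl_pre Y_sub by blast

lemma subgroup_full: "subgroup (carrier (full_group G)) (BijGroup (u ` Y))"
proof
  show "carrier (full_group G) \<subseteq> carrier (BijGroup (u ` Y))"
    by (auto simp: carrier_iff BijGroup_def)
  show "\<one>\<^bsub>BijGroup (u ` Y)\<^esub> \<in> carrier (full_group G)"
    by (simp add: carrier_iff BijGroup_def id_Bij locally_moves_id)
  fix \<alpha> assume \<alpha>: "\<alpha> \<in> carrier (full_group G)"
  show "inv\<^bsub>BijGroup (u ` Y)\<^esub> \<alpha> \<in> carrier (full_group G)"
    using \<alpha> locally_moves_inv[of \<alpha>] by (simp add: carrier_iff inv_BijGroup restrict_inv_into_Bij inv_map_def)
  fix \<beta> assume \<beta>: "\<beta> \<in> carrier (full_group G)"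
  show "\<alpha> \<otimes>\<^bsub>BijGroup (u ` Y)\<^esub> \<beta> \<in> carrier (full_group G)"
    using \<alpha> \<beta> by (simp add: carrier_iff BijGroup_def compose_Bij locally_moves_compose)
qed

lemma full_group_eq: "full_group G = (BijGroup (u ` Y))\<lparr>carrier := carrier (full_group G)\<rparr>"
  by (simp add: full_group_def)

lemma group_full: "group (full_group G)"
  using subgroup.subgroup_is_group[OF subgroup_full group_BijGroup] full_group_eq by simp

lemma mult_full:
  "\<alpha> \<in> carrier (full_group G) \<Longrightarrow> \<beta> \<in> carrier (full_group G) \<Longrightarrow>
     \<alpha> \<otimes>\<^bsub>full_group G\<^esub> \<beta> = compose (u ` Y) \<alpha> \<beta>"
  by (simp add: carrier_iff) (simp add: full_group_def BijGroup_def)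

lemma one_full: "\<one>\<^bsub>full_group G\<^esub> = (\<lambda>x\<in>u ` Y. x)"
  by (simp add: full_group_def BijGroup_def)

lemma full_ext:
  assumes "\<alpha> \<in> carrier (full_group G)" "\<beta> \<in> carrier (full_group G)" "\<And>x. x \<in> Y \<Longrightarrow> \<alpha> (u x) = \<beta> (u x)"
  shows "\<alpha> = \<beta>"
  using assms by (intro extensionalityI[of _ "u ` Y"]) (auto simp: carrier_iff Bij_def)

lemma the_represents: "\<alpha> \<in> carrier (full_group G) \<Longrightarrow> (THE V. represents G V \<alpha>) = graph_set \<alpha>"
  by (rule the_equality) (auto simp: carrier_iff intro: represents_graph_set dest: represents_unique)

lemma full_inj: "\<alpha> \<in> carrier (full_group G) \<Longrightarrow> x \<in> Y \<Longrightarrow> y \<in> Y \<Longrightarrow> \<alpha> (u x) = \<alpha> (u y) \<Longrightarrow> x = y"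
  by (auto simp: carrier_iff Bij_def bij_betw_def inj_on_def)

lemma full_surj: "\<alpha> \<in> carrier (full_group G) \<Longrightarrow> y \<in> Y \<Longrightarrow> \<exists>x\<in>Y. \<alpha> (u x) = u y"
proof -
  assume "\<alpha> \<in> carrier (full_group G)" "y \<in> Y"
  then have "u y \<in> \<alpha> ` u ` Y" by (simp add: carrier_iff Bij_def bij_betw_def)
  then show ?thesis by (metis imageE)
qed

end

section \<open>Prefix swaps\<close>

text \<open>The swap of two prefixes as an operation on words. It describes the swap of cylinders
  only if \<open>p\<close> and \<open>r\<close> are incomparable and \<open>m\<close> is not a
  proper prefix of either.\<close>

definition sw :: "'a list \<Rightarrow> 'a list \<Rightarrow> 'a list \<Rightarrow> 'a list" where
  "sw p r m = (if prefix p m then r @ drop (length p) m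
     else if prefix r m then p @ drop (length r) m else m)"

lemma sw_left [simp]: "sw p r (p @ s) = r @ s"
  by (simp add: sw_def)

lemma sw_right [simp]: "p \<parallel> r \<Longrightarrow> sw p r (r @ s) = p @ s"
  using parallel_append[of p r "[]" s] by (auto simp: sw_def parallel_def)

lemma sw_left0 [simp]: "sw p r p = r"
  using sw_left[of p r "[]"] by simp

lemma sw_right0 [simp]: "p \<parallel> r \<Longrightarrow> sw p r r = p"
  using sw_right[of p r "[]"] by simp

lemma sw_other: "\<not> prefix p m \<Longrightarrow> \<not> prefix r m \<Longrightarrow> sw p r m = m"
  by (simp add: sw_def)

lemma sw_cases [case_names left right other]:
  assumes "\<And>s. m = p @ s \<Longrightarrow> P" "\<And>s. m = r @ s \<Longrightarrow> P" "\<not> prefix p m \<Longrightarrow> \<not> prefix r m \<Longrightarrow> P"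
  shows P
  using assms by (auto simp: prefix_def)

lemma sw_sw: "p \<parallel> r \<Longrightarrow> sw p r (sw p r m) = m"
  by (cases rule: sw_cases[where m = m and p = p and r = r]) (auto simp: sw_other)

lemma sw_commute: "p \<parallel> r \<Longrightarrow> sw p r m = sw r p m"
  by (cases rule: sw_cases[where m = m and p = p and r = r]) (auto simp: sw_other parallel_commute[of p r])

lemma inj_sw: "p \<parallel> r \<Longrightarrow> inj_on (sw p r) A"
  by (metis inj_onI sw_sw)

context sft_clopen
begin

definition good_pair where
  "good_pair \<mu> \<nu> \<longleftrightarrow> Yp \<mu> \<and> Yp \<nu> \<and> fin \<mu> = fin \<nu> \<and> \<mu> \<parallel> \<nu>"

definition swx where
  "swx \<mu> \<nu> x = (if x \<in> cyl \<mu> then conc \<nu> ((shift ^^ length \<mu>) x)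
     else if x \<in> cyl \<nu> then conc \<mu> ((shift ^^ length \<nu>) x) else x)"

definition swap where
  "swap \<mu> \<nu> = (\<lambda>w\<in>u ` Y. u (swx \<mu> \<nu> (fst w)))"

definition swaps where "swaps = {swap \<mu> \<nu> | \<mu> \<nu>. good_pair \<mu> \<nu>}"

lemma fst_u [simp]: "fst (u x) = x"
  by (simp add: unit_arrow_def)

lemma good_pair_sym: "good_pair \<mu> \<nu> \<Longrightarrow> good_pair \<nu> \<mu>"
  by (auto simp: good_pair_def parallel_commute)

lemma swap_left:
  assumes "good_pair \<mu> \<nu>" "conc \<mu> z \<in> X"
  shows "swap \<mu> \<nu> (u (conc \<mu> z)) = u (conc \<nu> z)"
  using assms by (simp add: swap_def swx_def good_pair_def conc_in_cyl Yp_conc)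

lemma swap_right:
  assumes "good_pair \<mu> \<nu>" "conc \<nu> z \<in> X"
  shows "swap \<mu> \<nu> (u (conc \<nu> z)) = u (conc \<mu> z)"
proof -
  have "conc \<nu> z \<notin> cyl \<mu>" using assms cyl_disjoint[of \<mu> \<nu>] conc_in_cyl[of \<nu> z] by (auto simp: good_pair_def)
  then show ?thesis using assms by (simp add: swap_def swx_def good_pair_def conc_in_cyl Yp_conc)
qed

lemma swap_other: "x \<in> Y \<Longrightarrow> x \<notin> cyl \<mu> \<Longrightarrow> x \<notin> cyl \<nu> \<Longrightarrow> swap \<mu> \<nu> (u x) = u x"
  by (simp add: swap_def swx_def)

lemma good_pair_conc_X: "good_pair \<mu> \<nu> \<Longrightarrow> conc \<mu> z \<in> X \<longleftrightarrow> conc \<nu> z \<in> X"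
  by (auto simp: good_pair_def Yp_path conc_X_iff)

text \<open>A cylinder that properly contains a swapped one is torn apart instead of being moved by
  one replacement; the two conditions on \<open>strict_prefix\<close> exclude this.\<close>

lemma swap_moves:
  assumes g: "good_pair p r" and m: "Yp m" "\<not> strict_prefix m p" "\<not> strict_prefix m r"
  shows "moves (swap p r) m (sw p r m)"
proof -
  have pr: "p \<parallel> r" "Yp p" "Yp r" "fin p = fin r" using g by (auto simp: good_pair_def)
  show ?thesis
  proof (cases rule: sw_cases[where m = m and p = p and r = r])
    case (left s)
    have "moves (swap p r) p r" using pr g swap_left by (simp add: moves_def)
    then show ?thesis using moves_extend[of "swap p r" p r s] m left by (simp add: Yp_path)
  next
    case (right s)
    have "moves (swap p r) r p" using pr g swap_right by (simp add: moves_def)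
    then show ?thesis using moves_extend[of "swap p r" r p s] m right pr(1) by (simp add: Yp_path)
  next
    case other
    have par: "m \<parallel> p" "m \<parallel> r" using other m by (auto simp: strict_prefix_def)
    have "conc m z \<notin> cyl p" "conc m z \<notin> cyl r" if "conc m z \<in> X" for z
      using cyl_disjoint[OF par(1)] cyl_disjoint[OF par(2)] conc_in_cyl[OF that] by auto
    then have "moves (swap p r) m m" using m swap_other Yp_conc by (simp add: moves_def)
    then show ?thesis using other by (simp add: sw_other)
  qed
qed

lemma cases_cyl [consumes 1, case_names left right other]:
  assumes "x \<in> Y" "\<And>z. x = conc \<mu> z \<Longrightarrow> conc \<mu> z \<in> X \<Longrightarrow> P" "\<And>z. x = conc \<nu> z \<Longrightarrow> conc \<nu> z \<in> X \<Longrightarrow> P"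
    "x \<notin> cyl \<mu> \<Longrightarrow> x \<notin> cyl \<nu> \<Longrightarrow> P"
  shows P
  using assms by (metis cylE)

lemma swap_swap:
  assumes "good_pair \<mu> \<nu>" "x \<in> Y"
  shows "swap \<mu> \<nu> (swap \<mu> \<nu> (u x)) = u x"
  using assms(2)
proof (cases rule: cases_cyl[where \<mu> = \<mu> and \<nu> = \<nu>])
  case (left z)
  then show ?thesis using assms(1) good_pair_conc_X swap_left swap_right by metis
next
  case (right z)
  then show ?thesis using assms(1) good_pair_conc_X swap_left swap_right by metis
next
  case other
  then show ?thesis using swap_other assms by simp
qed

lemma swap_carrier:
  assumes "good_pair \<mu> \<nu>"
  shows "swap \<mu> \<nu> \<in> carrier (full_group G)"
proof -
  have loc: "locally_moves (swap \<mu> \<nu>)"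
    unfolding locally_moves_def
  proof
    fix x assume x: "x \<in> Y"
    define m where "m = pre (N0 + length \<mu> + length \<nu>) x"
    have "Yp m" using x Yp_pre by (simp add: m_def)
    moreover have "\<not> strict_prefix m \<mu>" "\<not> strict_prefix m \<nu>"
      by (auto simp: m_def dest: prefix_length_less)
    ultimately have "moves (swap \<mu> \<nu>) m (sw \<mu> \<nu> m)" using swap_moves assms by blast
    then show "\<exists>\<nu>' \<mu>'. x \<in> cyl \<nu>' \<and> moves (swap \<mu> \<nu>) \<nu>' \<mu>'"
      using in_cyl_pre[of x] x Y_sub unfolding m_def by blast
  qed
  have "bij_betw (swap \<mu> \<nu>) (u ` Y) (u ` Y)"
    by (rule bij_betw_byWitness[where f' = "swap \<mu> \<nu>"])
      (use swap_swap[OF assms] locally_moves_maps[OF loc] in auto)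
  then show ?thesis using loc by (simp add: carrier_iff Bij_def swap_def)
qed

lemma swap_comm: "good_pair \<mu> \<nu> \<Longrightarrow> swap \<mu> \<nu> = swap \<nu> \<mu>"
proof -
  assume g: "good_pair \<mu> \<nu>"
  then have "cyl \<mu> \<inter> cyl \<nu> = {}" by (simp add: good_pair_def cyl_disjoint)
  then have "swx \<mu> \<nu> x = swx \<nu> \<mu> x" for x unfolding swx_def by auto
  then show ?thesis by (simp add: swap_def)
qed

lemma swap_invol:
  assumes "good_pair \<mu> \<nu>"
  shows "swap \<mu> \<nu> \<otimes>\<^bsub>full_group G\<^esub> swap \<mu> \<nu> = \<one>\<^bsub>full_group G\<^esub>"
  using swap_carrier[OF assms] swap_swap[OF assms]
  by (auto simp: mult_full one_full compose_def restrict_def fun_eq_iff)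

lemma cyl_Yp: "Yp \<mu> \<Longrightarrow> cyl \<mu> \<subseteq> Y"
  by (simp add: Yp_def)

lemma clopen_unit_cyl:
  assumes "Yp \<mu>"
  shows "openin (unit_top G) (u ` cyl \<mu>)" "closedin (unit_top G) (u ` cyl \<mu>)"
proof -
  show "openin (unit_top G) (u ` cyl \<mu>)"
    unfolding openin_unit_iff using cyl_Yp[OF assms] by (auto simp: cyl_def intro!: exI[of _ "length \<mu>"])
  have "openin (unit_top G) (u ` (Y - cyl \<mu>))"
    unfolding openin_unit_iff
  proof (intro conjI ballI)
    fix x assume x: "x \<in> Y - cyl \<mu>"
    have "y \<in> Y - cyl \<mu>" if y: "y \<in> X" "pre (N0 + length \<mu>) y = pre (N0 + length \<mu>) x" for y
    proof -
      have "y \<in> Y" using in_Y_if_long[OF _ y(1) _ y(2)] x by simp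
      moreover have "pre (length \<mu>) y = pre (length \<mu>) x" using y(2) by (rule pre_eq_mono) simp
      ultimately show ?thesis using x Y_sub by (auto simp: cyl_def)
    qed
    then show "\<exists>n. \<forall>y\<in>X. pre n y = pre n x \<longrightarrow> y \<in> Y - cyl \<mu>" by blast
  qed simp
  moreover have "u ` (Y - cyl \<mu>) = u ` Y - u ` cyl \<mu>" by auto
  ultimately show "closedin (unit_top G) (u ` cyl \<mu>)"
    using cyl_Yp[OF assms] by (auto simp: closedin_def)
qed

text \<open>The clopen set is the cylinder of \<open>\<mu>\<close>, whose image is that of
  \<open>\<nu>\<close>. Both are closed, so the set of moved points is its own closure.\<close>

lemma swap_transposition:
  assumes g: "good_pair \<mu> \<nu>"
  shows "swap \<mu> \<nu> \<in> transpositions G"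
proof -
  have Yp: "Yp \<mu>" "Yp \<nu>" and disj: "cyl \<mu> \<inter> cyl \<nu> = {}"
    using g cyl_disjoint by (auto simp: good_pair_def)
  have lr: "swap \<mu> \<nu> (u x) \<in> u ` cyl \<nu>" if x: "x \<in> cyl \<mu>" for x
  proof -
    from x obtain z where "x = conc \<mu> z" "conc \<mu> z \<in> X" by (rule cylE)
    then show ?thesis using swap_left[OF g] good_pair_conc_X[OF g] conc_in_cyl by simp
  qed
  have rl: "\<exists>y\<in>cyl \<mu>. u x = swap \<mu> \<nu> (u y) \<and> u y = swap \<mu> \<nu> (u x)" if x: "x \<in> cyl \<nu>" for x
  proof -
    from x obtain z where "x = conc \<nu> z" "conc \<nu> z \<in> X" by (rule cylE)
    then show ?thesis
      using swap_left[OF g, of z] swap_right[OF g, of z] good_pair_conc_X[OF g] conc_in_cyl[of \<mu> z] by auto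
  qed
  have img: "swap \<mu> \<nu> ` u ` cyl \<mu> = u ` cyl \<nu>"
    using lr rl by blast
  have nonfix: "{w \<in> unit_space G. swap \<mu> \<nu> w \<noteq> w} = u ` cyl \<mu> \<union> u ` cyl \<nu>"
  proof -
    have "swap \<mu> \<nu> (u x) \<noteq> u x" if "x \<in> cyl \<mu>" for x
      using lr[OF that] disj that by auto
    moreover have "swap \<mu> \<nu> (u x) \<noteq> u x" if "x \<in> cyl \<nu>" for x
      using rl[OF that] disj that by auto
    moreover have "x \<in> cyl \<mu> \<union> cyl \<nu>" if "x \<in> Y" "swap \<mu> \<nu> (u x) \<noteq> u x" for x
      using swap_other that by blast
    moreover have "cyl \<mu> \<subseteq> Y" "cyl \<nu> \<subseteq> Y" using cyl_Yp Yp by auto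
    ultimately show ?thesis unfolding unit_space_G by blast
  qed
  have "closedin (unit_top G) (u ` cyl \<mu> \<union> u ` cyl \<nu>)"
    using clopen_unit_cyl Yp by (intro closedin_Un) auto
  then have "supp G (swap \<mu> \<nu>) = u ` cyl \<mu> \<union> swap \<mu> \<nu> ` u ` cyl \<mu>"
    unfolding supp_def nonfix img by (rule closure_of_closedin)
  moreover have "u ` cyl \<mu> \<inter> swap \<mu> \<nu> ` u ` cyl \<mu> = {}" unfolding img using disj by auto
  ultimately show ?thesis
    using swap_carrier[OF g] swap_invol[OF g] clopen_unit_cyl[OF Yp(1)]
    unfolding transpositions_def by blast
qed

text \<open>Injectivity: comparable image words would give two disjoint cylinders a common image
  point.\<close>

lemma moves_parallel:
  assumes "\<alpha> \<in> carrier (full_group G)" "moves \<alpha> a a'" "moves \<alpha> b b'" "a \<parallel> b"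
  shows "a' \<parallel> b'"
proof (rule ccontr)
  assume n: "\<not> a' \<parallel> b'"
  have *: False if mv: "moves \<alpha> a a'" "moves \<alpha> b b'" "a \<parallel> b" "prefix a' b'" for a a' b b'
  proof -
    obtain s where s: "b' = a' @ s" using mv(4) by (rule prefixE)
    have "path b'" using mv(2) by (simp add: moves_def Yp_path)
    then obtain z where z: "conc b' z \<in> X" by (rule point_extending)
    have X: "conc b z \<in> X" "conc a (conc s z) \<in> X"
      using z moves_conc_X[OF that(1)] moves_conc_X[OF that(2)] by (auto simp: s conc_append)
    then have "\<alpha> (u (conc b z)) = \<alpha> (u (conc a (conc s z)))"
      using moves_apply[OF that(1)] moves_apply[OF that(2)] by (simp add: s conc_append)
    moreover have "conc b z \<in> Y" "conc a (conc s z) \<in> Y" using X Yp_conc that by (auto simp: moves_def)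
    ultimately have "conc b z = conc a (conc s z)" using full_inj[OF assms(1)] by blast
    then show False using cyl_disjoint[OF that(3)] conc_in_cyl X by (metis IntI empty_iff)
  qed
  show False
  proof (cases "prefix a' b'")
    case True then show ?thesis using * assms by blast
  next
    case False
    then have "prefix b' a'" using n by blast
    then show ?thesis using *[of b b' a a'] assms parallel_commute by blast
  qed
qed

text \<open>The conjugation rule of symmetric groups,
  \<open>\<alpha> (\<mu> \<nu>) \<alpha>^-1 = (\<mu>' \<nu>')\<close>, written without the
  inverse.\<close>

lemma swap_conj:
  assumes \<alpha>: "\<alpha> \<in> carrier (full_group G)" and g: "good_pair \<mu> \<nu>"
    and mv: "moves \<alpha> \<mu> \<mu>'" "moves \<alpha> \<nu> \<nu>'"
  shows "good_pair \<mu>' \<nu>'"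
    "\<alpha> \<otimes>\<^bsub>full_group G\<^esub> swap \<mu> \<nu> = swap \<mu>' \<nu>' \<otimes>\<^bsub>full_group G\<^esub> \<alpha>"
proof -
  show g': "good_pair \<mu>' \<nu>'" using g mv moves_parallel[OF \<alpha> mv] by (auto simp: good_pair_def moves_def)
  interpret F: group "full_group G" by (rule group_full)
  note sc = swap_carrier[OF g] swap_carrier[OF g']
  show "\<alpha> \<otimes>\<^bsub>full_group G\<^esub> swap \<mu> \<nu> = swap \<mu>' \<nu>' \<otimes>\<^bsub>full_group G\<^esub> \<alpha>"
  proof (rule full_ext)
    fix x assume x: "x \<in> Y"
    have e: "(\<alpha> \<otimes>\<^bsub>full_group G\<^esub> swap \<mu> \<nu>) (u x) = \<alpha> (swap \<mu> \<nu> (u x))"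
      "(swap \<mu>' \<nu>' \<otimes>\<^bsub>full_group G\<^esub> \<alpha>) (u x) = swap \<mu>' \<nu>' (\<alpha> (u x))"
      using x \<alpha> sc by (simp_all add: mult_full compose_def)
    show "(\<alpha> \<otimes>\<^bsub>full_group G\<^esub> swap \<mu> \<nu>) (u x) = (swap \<mu>' \<nu>' \<otimes>\<^bsub>full_group G\<^esub> \<alpha>) (u x)"
      using x
    proof (cases rule: cases_cyl[where \<mu> = \<mu> and \<nu> = \<nu>])
      case (left z)
      then have "conc \<nu> z \<in> X" "conc \<mu>' z \<in> X" using good_pair_conc_X[OF g] moves_conc_X[OF mv(1)] by auto
      then show ?thesis unfolding e using left(2)
        by (simp add: left(1) swap_left[OF g] moves_apply[OF mv(1)] moves_apply[OF mv(2)] swap_left[OF g'])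
    next
      case (right z)
      then have "conc \<mu> z \<in> X" "conc \<nu>' z \<in> X" using good_pair_conc_X[OF g] moves_conc_X[OF mv(2)] by auto
      then show ?thesis unfolding e using right(2)
        by (simp add: right(1) swap_right[OF g] moves_apply[OF mv(1)] moves_apply[OF mv(2)] swap_right[OF g'])
    next
      case other
      obtain y where y: "y \<in> Y" "\<alpha> (u x) = u y"
        using \<alpha> x locally_moves_maps by (metis carrier_iff imageE)
      have out: False if mv: "moves \<alpha> \<rho> \<rho>'" "y \<in> cyl \<rho>'" "x \<notin> cyl \<rho>" for \<rho> \<rho>'
      proof -
        from mv(2) obtain z where z: "y = conc \<rho>' z" "conc \<rho>' z \<in> X" by (rule cylE)
        then have z': "conc \<rho> z \<in> X" using moves_conc_X[OF that(1)] by blast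
        then have "\<alpha> (u (conc \<rho> z)) = \<alpha> (u x)" using moves_apply[OF that(1)] z y by simp
        moreover have "conc \<rho> z \<in> Y" using z' Yp_conc that(1) by (auto simp: moves_def)
        ultimately have "conc \<rho> z = x" using full_inj[OF \<alpha>] x by blast
        then show False using that(3) conc_in_cyl[OF z'] by simp
      qed
      have "y \<notin> cyl \<mu>'" "y \<notin> cyl \<nu>'" using out mv other by blast+
      then show ?thesis unfolding e using other swap_other x y by simp
    qed
  qed (use \<alpha> sc in auto)
qed

section \<open>Finitely many swaps generate all swaps\<close>

lemma Yp_take:
  assumes "Yp \<nu>" "N0 \<le> n" "n \<le> length \<nu>"
  shows "Yp (take n \<nu>)"
proof -
  obtain z where z: "conc \<nu> z \<in> X" using point_extending assms Yp_path by blast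
  have "take n \<nu> = pre n (conc \<nu> z)"
    using take_pre[of n "length \<nu>" "conc \<nu> z"] assms(3) by (simp add: min_absorb1)
  then show ?thesis using Yp_pre[OF Yp_conc[OF assms(1) z] assms(2)] by simp
qed

lemma finite_Yp: "finite {\<mu>. Yp \<mu> \<and> length \<mu> \<le> n}"
  by (rule finite_subset[OF _ finite_paths[of n]]) (auto simp: Yp_path)

text \<open>A word has at most one of two incomparable words as a prefix, and at this length being
  comparable means having it as a prefix.\<close>

lemma parallel_long:
  assumes "\<kappa>1 \<parallel> \<kappa>2" "length \<kappa>1 \<le> length \<nu>" "length \<kappa>2 \<le> length \<nu>"
  shows "\<kappa>1 \<parallel> \<nu> \<or> \<kappa>2 \<parallel> \<nu>"
proof (rule ccontr)
  assume "\<not> ?thesis"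
  then have "prefix \<kappa>1 \<nu>" "prefix \<kappa>2 \<nu>"
    using assms(2,3) unfolding parallel_def by (metis not_equal_is_parallel parallelE prefix_length_le prefix_order.refl le_antisym)+
  then show False using assms(1) prefix_same_cases by blast
qed

lemma branching_Yp:
  assumes "Yp \<rho>" "v \<in> verts D"
  obtains \<kappa>1 \<kappa>2 where "Yp \<kappa>1" "Yp \<kappa>2" "fin \<kappa>1 = v" "fin \<kappa>2 = v"
    "prefix \<rho> \<kappa>1" "prefix \<rho> \<kappa>2" "\<kappa>1 \<parallel> \<kappa>2"
  using branching_extensions[OF Yp_path[OF assms(1)] assms(2)] Yp_prefix[OF assms(1)] by metis

text \<open>The point is that \<open>L\<close> does not depend on \<open>\<nu>\<close>. Truncating
  \<open>\<nu>\<close> to length \<open>L0\<close> leaves finitely many cases and only enlarges its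
  cylinder; \<open>L0\<close> bounds two incomparable words \<open>\<rho>1\<close> and
  \<open>\<rho>2\<close>, one of which stays disjoint from the truncation. Two words are produced so
  that one of them can also avoid a further long word, by \<open>parallel_long\<close>.\<close>

lemma short_avoiding:
  obtains L where "N0 \<le> L" "\<And>\<nu> \<rho> v. Yp \<nu> \<Longrightarrow> Yp \<rho> \<Longrightarrow> \<rho> \<parallel> \<nu> \<Longrightarrow> v \<in> verts D \<Longrightarrow>
    \<exists>\<kappa>1 \<kappa>2. Yp \<kappa>1 \<and> Yp \<kappa>2 \<and> fin \<kappa>1 = v \<and> fin \<kappa>2 = v \<and> length \<kappa>1 \<le> L \<and> length \<kappa>2 \<le> L \<and>
      \<kappa>1 \<parallel> \<kappa>2 \<and> \<kappa>1 \<parallel> \<nu> \<and> \<kappa>2 \<parallel> \<nu>"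
proof -
  obtain x where "x \<in> Y" using Y_ne by blast
  then have x: "Yp (pre N0 x)" by (simp add: Yp_pre)
  obtain \<rho>1 \<rho>2 where \<rho>12: "Yp \<rho>1" "Yp \<rho>2" "\<rho>1 \<parallel> \<rho>2"
    using branching_Yp[OF x fin_in_verts[OF Yp_path[OF x]]] by metis
  define L0 where "L0 = N0 + length \<rho>1 + length \<rho>2"
  \<comment> \<open>A word whose cylinder is all of \<open>Y\<close> has nothing disjoint from it,
    hence the last condition.\<close>
  define S where "S = {\<nu>. Yp \<nu> \<and> length \<nu> \<le> L0 \<and> (\<exists>\<rho>. Yp \<rho> \<and> \<rho> \<parallel> \<nu>)}"
  have "finite S" by (rule finite_subset[OF _ finite_Yp[of L0]]) (auto simp: S_def)
  then have finS: "finite (S \<times> verts D)" by simp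
  have "\<exists>\<kappa>1 \<kappa>2. Yp \<kappa>1 \<and> Yp \<kappa>2 \<and> fin \<kappa>1 = v \<and> fin \<kappa>2 = v \<and> \<kappa>1 \<parallel> \<kappa>2 \<and> \<kappa>1 \<parallel> \<nu> \<and> \<kappa>2 \<parallel> \<nu>"
    if \<nu>v: "\<nu> \<in> S" "v \<in> verts D" for \<nu> v
  proof -
    obtain \<rho> where \<rho>: "Yp \<rho>" "\<rho> \<parallel> \<nu>" using \<nu>v by (auto simp: S_def)
    obtain \<kappa>1 \<kappa>2 where "Yp \<kappa>1" "Yp \<kappa>2" "fin \<kappa>1 = v" "fin \<kappa>2 = v"
      "prefix \<rho> \<kappa>1" "prefix \<rho> \<kappa>2" "\<kappa>1 \<parallel> \<kappa>2" using branching_Yp[OF \<rho>(1) \<nu>v(2)] .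
    then show ?thesis using parallel_extend[OF \<rho>(2)] by blast
  qed
  then obtain k1 k2 where k: "\<And>\<nu> v. \<nu> \<in> S \<Longrightarrow> v \<in> verts D \<Longrightarrow>
      Yp (k1 \<nu> v) \<and> Yp (k2 \<nu> v) \<and> fin (k1 \<nu> v) = v \<and> fin (k2 \<nu> v) = v \<and>
      k1 \<nu> v \<parallel> k2 \<nu> v \<and> k1 \<nu> v \<parallel> \<nu> \<and> k2 \<nu> v \<parallel> \<nu>"
    by metis
  define L where "L = N0 + (\<Sum>(\<nu>, v)\<in>S \<times> verts D. length (k1 \<nu> v) + length (k2 \<nu> v))"
  have len: "length (k1 \<nu> v) + length (k2 \<nu> v) \<le> L" if "\<nu> \<in> S" "v \<in> verts D" for \<nu> v
    using member_le_sum[of "(\<nu>, v)" "S \<times> verts D" "\<lambda>(\<nu>, v). length (k1 \<nu> v) + length (k2 \<nu> v)"] finS that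
    by (auto simp: L_def)
  show ?thesis
  proof (rule that)
    show "N0 \<le> L" by (simp add: L_def)
    fix \<nu> \<rho> v assume *: "Yp \<nu>" "Yp \<rho>" "\<rho> \<parallel> \<nu>" "v \<in> verts D"
    obtain \<nu>' where \<nu>': "\<nu>' \<in> S" "prefix \<nu>' \<nu>"
    proof (cases "length \<nu> \<le> L0")
      case True
      then show ?thesis using * by (intro that[of \<nu>]) (auto simp: S_def)
    next
      case False
      have "Yp (take L0 \<nu>)" using Yp_take[OF *(1)] False by (simp add: L0_def)
      moreover have "\<rho>1 \<parallel> take L0 \<nu> \<or> \<rho>2 \<parallel> take L0 \<nu>"
        using parallel_long[OF \<rho>12(3)] False by (simp add: L0_def)
      ultimately show ?thesis
        using \<rho>12 by (intro that[of "take L0 \<nu>"]) (auto simp: S_def take_is_prefix)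
    qed
    have "k1 \<nu>' v \<parallel> \<nu>" "k2 \<nu>' v \<parallel> \<nu>" using k[OF \<nu>'(1) *(4)] parallel_extend \<nu>'(2) by blast+
    then show "\<exists>\<kappa>1 \<kappa>2. Yp \<kappa>1 \<and> Yp \<kappa>2 \<and> fin \<kappa>1 = v \<and> fin \<kappa>2 = v \<and> length \<kappa>1 \<le> L \<and> length \<kappa>2 \<le> L \<and>
      \<kappa>1 \<parallel> \<kappa>2 \<and> \<kappa>1 \<parallel> \<nu> \<and> \<kappa>2 \<parallel> \<nu>"
      using k[OF \<nu>'(1) *(4)] len[OF \<nu>'(1) *(4)]
      by (intro exI[of _ "k1 \<nu>' v"] exI[of _ "k2 \<nu>' v"]) auto
  qed
qed

definition short_swaps where
  "short_swaps L = {swap \<mu> \<nu> | \<mu> \<nu>. good_pair \<mu> \<nu> \<and> length \<mu> \<le> L \<and> length \<nu> \<le> L}"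

lemma finite_short_swaps: "finite (short_swaps L)"
proof -
  have "short_swaps L \<subseteq> (\<lambda>(\<mu>, \<nu>). swap \<mu> \<nu>) ` ({\<mu>. Yp \<mu> \<and> length \<mu> \<le> L} \<times> {\<mu>. Yp \<mu> \<and> length \<mu> \<le> L})"
    by (auto simp: short_swaps_def good_pair_def)
  then show ?thesis using finite_Yp by (meson finite_SigmaI finite_imageI finite_subset)
qed

lemma short_swaps_sub: "short_swaps L \<subseteq> swaps"
  by (auto simp: short_swaps_def swaps_def)

lemma swaps_carrier: "swaps \<subseteq> carrier (full_group G)"
  using swap_carrier by (auto simp: swaps_def)

lemma short_swaps_generate:
  obtains L where "swaps \<subseteq> generate (full_group G) (short_swaps L)"
proof -
  interpret F: group "full_group G" by (rule group_full)
  obtain L where L: "N0 \<le> L" and avoid: "\<And>\<nu> \<rho> v. Yp \<nu> \<Longrightarrow> Yp \<rho> \<Longrightarrow> \<rho> \<parallel> \<nu> \<Longrightarrow> v \<in> verts D \<Longrightarrow>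
    \<exists>\<kappa>1 \<kappa>2. Yp \<kappa>1 \<and> Yp \<kappa>2 \<and> fin \<kappa>1 = v \<and> fin \<kappa>2 = v \<and> length \<kappa>1 \<le> L \<and> length \<kappa>2 \<le> L \<and>
      \<kappa>1 \<parallel> \<kappa>2 \<and> \<kappa>1 \<parallel> \<nu> \<and> \<kappa>2 \<parallel> \<nu>"
    using short_avoiding by blast
  let ?H = "generate (full_group G) (short_swaps (Suc L))"
  \<comment> \<open>Conjugation by \<open>swap (butlast \<mu>) \<kappa>\<close>, which is its own
    inverse, carries \<open>\<mu>\<close> to \<open>\<kappa>\<close> followed by one edge. The
    conjugating swap itself uses words shorter than \<open>\<mu>\<close>.\<close>
  have reduce: "\<exists>\<kappa> \<mu>2 \<nu>2. good_pair (butlast \<mu>) \<kappa> \<and> length \<kappa> \<le> L \<and> good_pair \<mu>2 \<nu>2 \<and> length \<mu>2 \<le> Suc L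
      \<and> length \<nu>2 \<le> length \<nu> \<and>
      swap \<mu> \<nu> = swap (butlast \<mu>) \<kappa> \<otimes>\<^bsub>full_group G\<^esub> (swap \<mu>2 \<nu>2 \<otimes>\<^bsub>full_group G\<^esub> swap (butlast \<mu>) \<kappa>)"
    if g: "good_pair \<mu> \<nu>" and len: "length \<mu> = Suc n" "Suc L \<le> n" for \<mu> \<nu> n
  proof -
    define \<mu>' where "\<mu>' = butlast \<mu>"
    have \<mu>: "\<mu> = \<mu>' @ [last \<mu>]" using len by (auto simp: \<mu>'_def intro!: append_butlast_last_id[symmetric])
    have Yp: "Yp \<mu>" "Yp \<nu>" "\<mu> \<parallel> \<nu>" using g by (auto simp: good_pair_def)
    have Yp': "Yp \<mu>'" using Yp_take[OF Yp(1), of n] len L by (simp add: \<mu>'_def butlast_conv_take)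
    have l': "length \<mu>' = n" using len by (simp add: \<mu>'_def)
    obtain \<kappa>1 \<kappa>2 where k: "Yp \<kappa>1" "Yp \<kappa>2" "fin \<kappa>1 = fin \<mu>'" "fin \<kappa>2 = fin \<mu>'" "length \<kappa>1 \<le> L"
      "length \<kappa>2 \<le> L" "\<kappa>1 \<parallel> \<kappa>2" "\<kappa>1 \<parallel> \<nu>" "\<kappa>2 \<parallel> \<nu>"
      using avoid[OF Yp(2,1,3) fin_in_verts[OF Yp_path[OF Yp']]] by blast
    \<comment> \<open>Both candidates avoid \<open>\<nu>\<close>, and at least one of them also
      avoids the long word \<open>\<mu>'\<close>.\<close>
    then have "\<kappa>1 \<parallel> \<mu>' \<or> \<kappa>2 \<parallel> \<mu>'" using parallel_long[OF k(7)] l' len by simp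
    then obtain \<kappa> where \<kappa>: "Yp \<kappa>" "fin \<kappa> = fin \<mu>'" "length \<kappa> \<le> L" "\<kappa> \<parallel> \<mu>'" "\<kappa> \<parallel> \<nu>"
      using k by blast
    have gc: "good_pair \<mu>' \<kappa>" using \<kappa> Yp' by (simp add: good_pair_def parallel_commute)
    let ?c = "swap \<mu>' \<kappa>"
    have "\<not> strict_prefix \<mu> \<mu>'" "\<not> strict_prefix \<mu> \<kappa>"
      using prefix_length_less[of \<mu>] l' len \<kappa>(3) by fastforce+
    then have m1: "moves ?c \<mu> (sw \<mu>' \<kappa> \<mu>)" by (rule swap_moves[OF gc Yp(1)])
    \<comment> \<open>A proper prefix of \<open>\<mu>'\<close> would also be a prefix of
      \<open>\<mu>\<close>, from which \<open>\<nu>\<close> is disjoint.\<close>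
    have "\<not> strict_prefix \<nu> \<mu>'" using Yp(3) \<mu> by (metis parallelE prefix_prefix strict_prefix_def)
    moreover have "\<not> strict_prefix \<nu> \<kappa>" using \<kappa>(5) by (auto simp: strict_prefix_def)
    ultimately have m2: "moves ?c \<nu> (sw \<mu>' \<kappa> \<nu>)" using swap_moves[OF gc Yp(2)] by blast
    have g2: "good_pair (sw \<mu>' \<kappa> \<mu>) (sw \<mu>' \<kappa> \<nu>)" and
      eq: "?c \<otimes>\<^bsub>full_group G\<^esub> swap \<mu> \<nu> = swap (sw \<mu>' \<kappa> \<mu>) (sw \<mu>' \<kappa> \<nu>) \<otimes>\<^bsub>full_group G\<^esub> ?c"
      using swap_conj[OF swap_carrier[OF gc] g m1 m2] .
    have "swap \<mu> \<nu> = (?c \<otimes>\<^bsub>full_group G\<^esub> ?c) \<otimes>\<^bsub>full_group G\<^esub> swap \<mu> \<nu>"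
      using swap_invol[OF gc] swap_carrier[OF g] by simp
    also have "\<dots> = ?c \<otimes>\<^bsub>full_group G\<^esub> (swap (sw \<mu>' \<kappa> \<mu>) (sw \<mu>' \<kappa> \<nu>) \<otimes>\<^bsub>full_group G\<^esub> ?c)"
      using eq swap_carrier[OF g] swap_carrier[OF gc] by (simp add: F.m_assoc)
    finally have e: "swap \<mu> \<nu> = \<dots>" .
    have "sw \<mu>' \<kappa> \<mu> = \<kappa> @ [last \<mu>]" using sw_left \<mu> by metis
    then have "length (sw \<mu>' \<kappa> \<mu>) \<le> Suc L" using \<kappa>(3) by simp
    \<comment> \<open>Only extensions of \<open>\<kappa>\<close> become longer, and
      \<open>\<nu>\<close> is disjoint from \<open>\<kappa>\<close>; an extension of
      \<open>\<mu>'\<close> becomes shorter because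
      \<open>length \<kappa> \<le> L < n\<close>.\<close>
    moreover have "length (sw \<mu>' \<kappa> \<nu>) \<le> length \<nu>"
      using \<kappa>(3,5) l' len unfolding sw_def by (auto dest: prefix_length_le)
    ultimately show ?thesis using gc \<kappa>(3) g2 e unfolding \<mu>'_def by blast
  qed
  have "\<forall>\<mu> \<nu>. good_pair \<mu> \<nu> \<longrightarrow> length \<mu> \<le> n \<longrightarrow> length \<nu> \<le> n \<longrightarrow> swap \<mu> \<nu> \<in> ?H" for n
  proof (induction n)
    case 0
    then show ?case by (auto simp: good_pair_def)
  next
    case (Suc n)
    note IH = Suc.IH[rule_format]
    show ?case
    proof (cases "Suc n \<le> Suc L")
      case True
      have "swap \<mu> \<nu> \<in> ?H"
        if "good_pair \<mu> \<nu>" "length \<mu> \<le> Suc n" "length \<nu> \<le> Suc n" for \<mu> \<nu>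
        using that True unfolding short_swaps_def by (intro generate.incl CollectI exI conjI refl) auto
      then show ?thesis by blast
    next
      case False
      then have n: "Suc L \<le> n" by simp
      have stage1: "swap \<mu> \<nu> \<in> ?H" if g: "good_pair \<mu> \<nu>" "length \<mu> = Suc n" "length \<nu> \<le> n" for \<mu> \<nu>
      proof -
        obtain \<kappa> \<mu>2 \<nu>2 where r: "good_pair (butlast \<mu>) \<kappa>" "length \<kappa> \<le> L" "good_pair \<mu>2 \<nu>2" "length \<mu>2 \<le> Suc L"
          "length \<nu>2 \<le> length \<nu>"
          "swap \<mu> \<nu> = swap (butlast \<mu>) \<kappa> \<otimes>\<^bsub>full_group G\<^esub> (swap \<mu>2 \<nu>2 \<otimes>\<^bsub>full_group G\<^esub> swap (butlast \<mu>) \<kappa>)"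
          using reduce[OF g(1,2) n] by blast
        have "swap (butlast \<mu>) \<kappa> \<in> ?H" using r g n by (intro IH) auto
        moreover have "swap \<mu>2 \<nu>2 \<in> ?H" using r g n by (intro IH) auto
        ultimately show ?thesis unfolding r(6) by (intro generate.eng)
      qed
      \<comment> \<open>Reducing \<open>\<mu>\<close> may leave the other word at length
        \<open>Suc n\<close>. Then the first one is short, and the previous case applies with the
        roles exchanged.\<close>
      have stage2: "swap \<mu> \<nu> \<in> ?H" if g: "good_pair \<mu> \<nu>" "length \<mu> = Suc n" "length \<nu> = Suc n" for \<mu> \<nu>
      proof -
        obtain \<kappa> \<mu>2 \<nu>2 where r: "good_pair (butlast \<mu>) \<kappa>" "length \<kappa> \<le> L" "good_pair \<mu>2 \<nu>2" "length \<mu>2 \<le> Suc L"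
          "length \<nu>2 \<le> length \<nu>"
          "swap \<mu> \<nu> = swap (butlast \<mu>) \<kappa> \<otimes>\<^bsub>full_group G\<^esub> (swap \<mu>2 \<nu>2 \<otimes>\<^bsub>full_group G\<^esub> swap (butlast \<mu>) \<kappa>)"
          using reduce[OF g(1,2) n] by blast
        have "swap (butlast \<mu>) \<kappa> \<in> ?H" using r g n by (intro IH) auto
        moreover have "swap \<mu>2 \<nu>2 \<in> ?H"
        proof (cases "length \<nu>2 \<le> n")
          case True then show ?thesis using r n by (intro IH) auto
        next
          case False
          then have "length \<nu>2 = Suc n" using r g by simp
          then show ?thesis using stage1[OF good_pair_sym[OF r(3)]] swap_comm[OF r(3)] r n by simp
        qed
        ultimately show ?thesis unfolding r(6) by (intro generate.eng)
      qed
      show ?thesis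
      proof (intro allI impI)
        fix \<mu> \<nu> assume *: "good_pair \<mu> \<nu>" "length \<mu> \<le> Suc n" "length \<nu> \<le> Suc n"
        consider "length \<mu> \<le> n" "length \<nu> \<le> n" | "length \<mu> = Suc n" "length \<nu> \<le> n"
          | "length \<mu> \<le> n" "length \<nu> = Suc n" | "length \<mu> = Suc n" "length \<nu> = Suc n"
          using * by linarith
        then show "swap \<mu> \<nu> \<in> ?H"
          using IH[OF *(1)] stage1[OF *(1)] stage1[OF good_pair_sym[OF *(1)]] stage2[OF *(1)] swap_comm[OF *(1)]
          by cases auto
      qed
    qed
  qed
  then have "swaps \<subseteq> ?H" unfolding swaps_def by (auto intro: order_refl) (metis linorder_linear)
  then show ?thesis by (rule that)
qed

section \<open>Tree pairs\<close>

text \<open>A tree is represented by its interior nodes, which are the words of length at least \<open>N0\<close>; the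
  leaves are the minimal words outside of it.\<close>

definition tree where
  "tree I \<longleftrightarrow> finite I \<and> (\<forall>m\<in>I. Yp m) \<and> (\<forall>m\<in>I. N0 < length m \<longrightarrow> butlast m \<in> I)"

text \<open>Words of length \<open>N0\<close> are roots and have no parent to check; the empty tree
  has all of them as leaves.\<close>

definition leaves where
  "leaves I = {m. Yp m \<and> m \<notin> I \<and> (N0 < length m \<longrightarrow> butlast m \<in> I)}"

text \<open>These are the tree pairs familiar from Higman-Thompson groups. The condition runs over
  the source leaves; their images are disjoint because \<open>\<alpha>\<close> is injective.\<close>

definition table where
  "table \<alpha> I J \<longleftrightarrow> tree I \<and> tree J \<and> (\<forall>\<nu>\<in>leaves I. \<exists>\<mu>\<in>leaves J. moves \<alpha> \<nu> \<mu>)"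

definition cnt where "cnt I v = card {m \<in> I. fin m = v}"

lemma strict_prefix_butlast: "strict_prefix m m' \<Longrightarrow> prefix m (butlast m')"
  by (auto simp: strict_prefix_def prefix_def butlast_append)

lemma tree_prefix:
  assumes "tree I" "m \<in> I" "prefix m' m" "N0 \<le> length m'"
  shows "m' \<in> I"
  using assms(2,3)
proof (induction m rule: length_induct)
  case (1 m)
  show ?case
  proof (cases "m' = m")
    case False
    then have "strict_prefix m' m" using 1 by (simp add: strict_prefix_def)
    then have "prefix m' (butlast m)" "N0 < length m"
      using strict_prefix_butlast prefix_length_less[of m' m] assms(4) by auto
    moreover from this have "butlast m \<in> I" using 1(2) assms(1) by (auto simp: tree_def)
    moreover have "length (butlast m) < length m" using \<open>N0 < length m\<close> by simp
    ultimately show ?thesis using 1(1) by blast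
  qed (use 1 in simp)
qed

lemma leaf_exists:
  assumes "tree I" "x \<in> Y"
  shows "\<exists>n\<ge>N0. pre n x \<in> leaves I"
proof -
  have "\<exists>n\<ge>N0. pre n x \<notin> I"
  proof (rule ccontr)
    assume "\<not> ?thesis"
    then have "(\<lambda>n. pre n x) ` {N0..} \<subseteq> I" by auto
    moreover have "inj_on (\<lambda>n. pre n x) {N0..}" by (rule inj_onI) (metis length_pre)
    ultimately have "finite {N0..}" using assms(1) finite_imageD finite_subset unfolding tree_def by metis
    then show False using infinite_Ici by blast
  qed
  then obtain n where n: "n \<ge> N0" "pre n x \<notin> I" and least: "\<And>k. k < n \<Longrightarrow> \<not> (k \<ge> N0 \<and> pre k x \<notin> I)"
    using exists_least_iff[of "\<lambda>n. n \<ge> N0 \<and> pre n x \<notin> I"] by blast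
  have "butlast (pre n x) \<in> I" if "N0 < n"
    using least[of "n - 1"] that by (cases n) (auto simp: pre_Suc)
  then show ?thesis using n Yp_pre assms(2) unfolding leaves_def by auto
qed

lemma leaves_not_prefix:
  assumes "tree I" "m \<in> leaves I" "m' \<in> leaves I"
  shows "\<not> strict_prefix m m'"
proof
  assume sp: "strict_prefix m m'"
  have "N0 < length m'" using sp assms(2) prefix_length_less[OF sp] by (simp add: leaves_def Yp_def)
  then have "butlast m' \<in> I" using assms(3) by (simp add: leaves_def)
  then have "m \<in> I" using tree_prefix[OF assms(1) _ strict_prefix_butlast[OF sp]] assms(2)
    by (simp add: leaves_def Yp_def)
  then show False using assms(2) by (simp add: leaves_def)
qed

lemma leaves_parallel:
  "tree I \<Longrightarrow> m \<in> leaves I \<Longrightarrow> m' \<in> leaves I \<Longrightarrow> m \<noteq> m' \<Longrightarrow> m \<parallel> m'"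
  using leaves_not_prefix by (metis parallelI strict_prefixI)

lemma finite_leaves: assumes "tree I" shows "finite (leaves I)"
proof -
  have "leaves I \<subseteq> {\<mu>. Yp \<mu> \<and> length \<mu> \<le> N0} \<union> (\<lambda>(m, e). m @ [e]) ` (I \<times> arcs D)"
  proof
    fix m assume m: "m \<in> leaves I"
    show "m \<in> {\<mu>. Yp \<mu> \<and> length \<mu> \<le> N0} \<union> (\<lambda>(m, e). m @ [e]) ` (I \<times> arcs D)"
    proof (cases "N0 < length m")
      case True
      then have "m \<noteq> []" by auto
      then have "m = butlast m @ [last m]" "last m \<in> arcs D" "butlast m \<in> I"
        using m True by (auto simp: leaves_def Yp_def path_def)
      then show ?thesis by (metis (no_types, lifting) SigmaI UnCI case_prod_conv image_eqI)
    qed (use m in \<open>auto simp: leaves_def\<close>)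
  qed
  moreover have "finite ({\<mu>. Yp \<mu> \<and> length \<mu> \<le> N0} \<union> (\<lambda>(m, e). m @ [e]) ` (I \<times> arcs D))"
    using assms finite_Yp by (auto simp: tree_def)
  ultimately show ?thesis by (rule finite_subset)
qed

lemma sw_leaves:
  assumes "tree I" "\<mu> \<in> leaves I" "\<nu> \<in> leaves I" "m \<in> leaves I"
  shows "sw \<mu> \<nu> m = (if m = \<mu> then \<nu> else if m = \<nu> then \<mu> else m)"
  using leaves_not_prefix[OF assms(1)] assms
  by (auto simp: sw_def strict_prefix_def)

text \<open>A permutation of leaves is a product of transpositions: composing with the swap of
  \<open>\<nu>\<close> and its image \<open>\<mu>\<close> fixes \<open>\<nu>\<close> and keeps the
  leaves that are already fixed.\<close>

lemma table_same:
  assumes "table \<alpha> I I" "\<alpha> \<in> carrier (full_group G)"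
  shows "\<alpha> \<in> generate (full_group G) swaps"
  using assms
proof (induction "card {\<nu> \<in> leaves I. \<not> moves \<alpha> \<nu> \<nu>}" arbitrary: \<alpha> rule: less_induct)
  case less
  interpret F: group "full_group G" by (rule group_full)
  have I: "tree I" and t: "\<And>\<nu>. \<nu> \<in> leaves I \<Longrightarrow> \<exists>\<mu>\<in>leaves I. moves \<alpha> \<nu> \<mu>"
    using less.prems(1) by (auto simp: table_def)
  show ?case
  proof (cases "\<forall>\<nu>\<in>leaves I. moves \<alpha> \<nu> \<nu>")
    case True
    have "\<alpha> = \<one>\<^bsub>full_group G\<^esub>"
    proof (rule full_ext[OF less.prems(2) F.one_closed])
      fix x assume x: "x \<in> Y"
      then obtain n where "n \<ge> N0" "pre n x \<in> leaves I" using leaf_exists[OF I] by blast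
      then have "\<alpha> (u (conc (pre n x) ((shift ^^ n) x))) = u (conc (pre n x) ((shift ^^ n) x))"
        using True x Y_sub by (intro moves_apply) (auto simp: conc_pre_shift)
      then show "\<alpha> (u x) = \<one>\<^bsub>full_group G\<^esub> (u x)" using x by (simp add: conc_pre_shift one_full)
    qed
    then show ?thesis by (simp add: generate.one)
  next
    case False
    then obtain \<nu> where \<nu>: "\<nu> \<in> leaves I" "\<not> moves \<alpha> \<nu> \<nu>" by blast
    obtain \<mu> where \<mu>: "\<mu> \<in> leaves I" "moves \<alpha> \<nu> \<mu>" using t \<nu> by blast
    have ne: "\<mu> \<noteq> \<nu>" using \<mu> \<nu> by auto
    have par: "\<mu> \<parallel> \<nu>" using leaves_parallel[OF I] \<mu> \<nu> ne by blast
    have g: "good_pair \<mu> \<nu>" using par \<mu>(2) by (simp add: good_pair_def moves_def)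
    note sc = swap_carrier[OF g]
    let ?\<beta> = "swap \<mu> \<nu> \<otimes>\<^bsub>full_group G\<^esub> \<alpha>"
    have \<beta>: "?\<beta> \<in> carrier (full_group G)" using sc less.prems by simp
    have mv: "moves ?\<beta> \<rho> (sw \<mu> \<nu> \<rho>')" if "moves \<alpha> \<rho> \<rho>'" "\<rho>' \<in> leaves I" for \<rho> \<rho>'
    proof -
      have "moves (swap \<mu> \<nu>) \<rho>' (sw \<mu> \<nu> \<rho>')"
        using swap_moves[OF g] that leaves_not_prefix[OF I that(2)] \<mu> \<nu> by (auto simp: leaves_def)
      then show ?thesis using moves_compose[OF that(1)] sc less.prems(2) by (simp add: mult_full)
    qed
    have "table ?\<beta> I I"
      unfolding table_def
    proof (intro conjI ballI)
      fix \<rho> assume "\<rho> \<in> leaves I"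
      then obtain \<rho>' where r: "\<rho>' \<in> leaves I" "moves \<alpha> \<rho> \<rho>'" using t by blast
      have "sw \<mu> \<nu> \<rho>' \<in> leaves I" using sw_leaves[OF I \<mu>(1) \<nu>(1) r(1)] \<mu> \<nu> r by simp
      then show "\<exists>\<mu>'\<in>leaves I. moves ?\<beta> \<rho> \<mu>'" using mv r by blast
    qed (use I in auto)
    moreover have "{\<rho> \<in> leaves I. \<not> moves ?\<beta> \<rho> \<rho>} \<subset> {\<rho> \<in> leaves I. \<not> moves \<alpha> \<rho> \<rho>}"
    proof (rule psubsetI)
      show "{\<rho> \<in> leaves I. \<not> moves ?\<beta> \<rho> \<rho>} \<subseteq> {\<rho> \<in> leaves I. \<not> moves \<alpha> \<rho> \<rho>}"
      proof safe
        fix \<rho> assume r: "\<rho> \<in> leaves I" "\<not> moves ?\<beta> \<rho> \<rho>" "moves \<alpha> \<rho> \<rho>"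
        have "\<rho> \<noteq> \<nu>" using r \<nu> by auto
        \<comment> \<open>If \<open>\<alpha>\<close> fixed the leaf \<open>\<mu>\<close>, it would
          map the cylinders of both \<open>\<mu>\<close> and \<open>\<nu>\<close> onto that of
          \<open>\<mu>\<close>.\<close>
        moreover have "\<rho> \<noteq> \<mu>"
        proof
          assume "\<rho> = \<mu>"
          then have "\<mu> \<parallel> \<mu>" using moves_parallel[OF less.prems(2) _ \<mu>(2), of \<mu> \<mu>] r par by simp
          then show False by (simp add: parallel_def)
        qed
        ultimately have "sw \<mu> \<nu> \<rho> = \<rho>" using sw_leaves[OF I \<mu>(1) \<nu>(1) r(1)] by simp
        then show False using mv[OF r(3,1)] r by simp
      qed
      have "moves ?\<beta> \<nu> \<nu>" using mv[OF \<mu>(2,1)] by simp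
      then show "{\<rho> \<in> leaves I. \<not> moves ?\<beta> \<rho> \<rho>} \<noteq> {\<rho> \<in> leaves I. \<not> moves \<alpha> \<rho> \<rho>}" using \<nu> by blast
    qed
    then have "card {\<rho> \<in> leaves I. \<not> moves ?\<beta> \<rho> \<rho>} < card {\<rho> \<in> leaves I. \<not> moves \<alpha> \<rho> \<rho>}"
      using finite_leaves[OF I] by (intro psubset_card_mono) auto
    ultimately have "?\<beta> \<in> generate (full_group G) swaps" using less.hyps \<beta> by blast
    moreover have "swap \<mu> \<nu> \<in> generate (full_group G) swaps"
      using g by (intro generate.incl) (auto simp: swaps_def)
    ultimately have "swap \<mu> \<nu> \<otimes>\<^bsub>full_group G\<^esub> ?\<beta> \<in> generate (full_group G) swaps" by (rule generate.eng[rotated])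
    moreover have "swap \<mu> \<nu> \<otimes>\<^bsub>full_group G\<^esub> ?\<beta> = \<alpha>"
      using sc less.prems(2) swap_invol[OF g] by (simp flip: F.m_assoc)
    ultimately show ?thesis by simp
  qed
qed

lemma sw_Yp:
  assumes "good_pair p r" "Yp m"
  shows "Yp (sw p r m)"
proof (cases rule: sw_cases[where m = m and p = p and r = r])
  case (left s)
  then have "path (r @ s)" using path_replace[of p s r] assms by (simp add: good_pair_def Yp_path)
  then show ?thesis using left Yp_prefix[of r "r @ s"] assms by (simp add: good_pair_def)
next
  case (right s)
  then have "path (p @ s)" using path_replace[of r s p] assms by (simp add: good_pair_def Yp_path)
  then show ?thesis using right Yp_prefix[of p "p @ s"] assms by (simp add: good_pair_def)
qed (use assms in \<open>simp add: sw_other\<close>)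

lemma fin_sw: "good_pair p r \<Longrightarrow> fin (sw p r m) = fin m"
  by (cases rule: sw_cases[where m = m and p = p and r = r]) (auto simp: good_pair_def sw_other intro: fin_append_cong)

text \<open>No node of \<open>I\<close> lies below the leaf \<open>r\<close>, so the swap
  transplants the branch at \<open>p\<close> to \<open>r\<close> and leaves \<open>p\<close> behind
  as a leaf. Parents are carried along, except that the root of the branch acquires the parent of
  \<open>r\<close>.\<close>

lemma tree_exchange:
  assumes I: "tree I" "p \<in> I" "r \<in> leaves I" and g: "good_pair p r"
  shows "tree (sw p r ` I)" "p \<in> leaves (sw p r ` I)" "r \<in> sw p r ` I"
    "sw p r ` leaves I \<subseteq> leaves (sw p r ` I)"
proof -
  have pr: "p \<parallel> r" and Yp: "Yp p" "Yp r" using g by (auto simp: good_pair_def)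
  have lenp: "N0 \<le> length p" "p \<noteq> []" and lenr: "N0 \<le> length r" "r \<noteq> []"
    using Yp Yp_not_Nil by (auto simp: Yp_def)
  have rI: "r \<notin> I" using I by (simp add: leaves_def)
  have not_r: "\<not> prefix r m" if "m \<in> I" for m using tree_prefix[OF I(1) that _ lenr(1)] rI by blast
  have fixI: "m \<in> sw p r ` I" if "m \<in> I" "\<not> prefix p m" for m
    using sw_other[of p m r] that not_r[OF that(1)] by (metis imageI)
  show r: "r \<in> sw p r ` I" using I(2) by (metis imageI sw_left0)
  have mem: "sw p r m \<in> sw p r ` I \<longleftrightarrow> m \<in> I" for m using inj_sw[OF pr] by (metis imageE imageI sw_sw[OF pr])
  have blp: "butlast p \<in> sw p r ` I" if "N0 < length p"
  proof (rule fixI)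
    show "butlast p \<in> I" using I that by (auto simp: tree_def)
    show "\<not> prefix p (butlast p)" using lenp(2) prefix_length_le[of p "butlast p"] by (cases p) auto
  qed
  have blr: "butlast r \<in> sw p r ` I" if "N0 < length r"
  proof (rule fixI)
    show "butlast r \<in> I" using I(3) that by (auto simp: leaves_def)
    show "\<not> prefix p (butlast r)" using pr by (metis parallelE prefix_order.trans prefixeq_butlast)
  qed
  show tree: "tree (sw p r ` I)"
    unfolding tree_def
  proof (intro conjI ballI impI)
    show "finite (sw p r ` I)" using I by (simp add: tree_def)
    fix m assume "m \<in> sw p r ` I"
    then obtain m0 where m0: "m0 \<in> I" "m = sw p r m0" by blast
    show "Yp m" using m0 sw_Yp[OF g] I by (auto simp: tree_def)
    assume len: "N0 < length m"
    show "butlast m \<in> sw p r ` I"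
    proof (cases "prefix p m0")
      case True
      then obtain s where s: "m0 = p @ s" by (rule prefixE)
      show ?thesis
      proof (cases "s = []")
        case True then show ?thesis using m0 s blr len by simp
      next
        case False
        then have "butlast m0 = p @ butlast s" "N0 < length m0" using s lenp by (auto simp: butlast_append simp flip: length_greater_0_conv)
        then have "p @ butlast s \<in> I" using I(1) m0 by (metis tree_def)
        moreover have "butlast m = sw p r (p @ butlast s)" using m0 s False by (simp add: butlast_append)
        ultimately show ?thesis by blast
      qed
    next
      case False
      then have m: "m = m0" using m0 not_r sw_other by metis
      then have "butlast m0 \<in> I" using I(1) m0 len by (metis tree_def)
      moreover have "\<not> prefix p (butlast m0)" using False by (metis prefix_order.trans prefixeq_butlast)
      ultimately show ?thesis using fixI m by blast
    qed
  qed
  show p: "p \<in> leaves (sw p r ` I)"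
    unfolding leaves_def using Yp mem[of r] rI pr blp by simp
  show "sw p r ` leaves I \<subseteq> leaves (sw p r ` I)"
  proof
    fix m assume "m \<in> sw p r ` leaves I"
    then obtain m0 where m0: "m0 \<in> leaves I" "m = sw p r m0" by blast
    have Ypm: "Yp m" using m0 sw_Yp[OF g] by (auto simp: leaves_def)
    have nI: "m \<notin> sw p r ` I" using m0 mem by (simp add: leaves_def)
    have "butlast m \<in> sw p r ` I" if len: "N0 < length m"
    proof (cases rule: sw_cases[where m = m0 and p = p and r = r])
      case (left s)
      have "s \<noteq> []" using left m0 I(2) by (auto simp: leaves_def)
      then have "butlast m0 = p @ butlast s" "N0 < length m0" using left lenp by (auto simp: butlast_append simp flip: length_greater_0_conv)
      then have "p @ butlast s \<in> I" using m0 by (metis (mono_tags, lifting) leaves_def mem_Collect_eq)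
      moreover have "butlast m = sw p r (p @ butlast s)" using m0 left \<open>s \<noteq> []\<close> by (simp add: butlast_append)
      ultimately show ?thesis by blast
    next
      case (right s)
      then have "m0 = r" using leaves_not_prefix[OF I(1,3) m0(1)] by (auto simp: strict_prefix_def)
      then show ?thesis using m0 pr blp len by simp
    next
      case other
      then have m: "m = m0" using m0 sw_other by metis
      then have "butlast m0 \<in> I" using m0 len by (simp add: leaves_def)
      moreover have "\<not> prefix p (butlast m0)" using other by (metis prefix_order.trans prefixeq_butlast)
      ultimately show ?thesis using fixI m by blast
    qed
    then show "m \<in> leaves (sw p r ` I)" using Ypm nI by (simp add: leaves_def)
  qed
qed

lemma cnt_sw: assumes "good_pair p r" shows "cnt (sw p r ` I) v = cnt I v"
proof -
  have eq: "{m \<in> sw p r ` I. fin m = v} = sw p r ` {m \<in> I. fin m = v}"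
    using fin_sw[OF assms] by auto
  show ?thesis using card_image[OF inj_sw] assms unfolding cnt_def eq good_pair_def by blast
qed

text \<open>If the two trees differ, an interior node of the first can be exchanged with a leaf of the
  first that is interior in the second, at the price of one swap.\<close>

lemma table_generated:
  assumes "table \<alpha> I J" "\<alpha> \<in> carrier (full_group G)" "\<And>v. cnt I v = cnt J v"
  shows "\<alpha> \<in> generate (full_group G) swaps"
  using assms
proof (induction "card (J - I)" arbitrary: \<alpha> I rule: less_induct)
  case less
  interpret F: group "full_group G" by (rule group_full)
  have I: "tree I" "finite I" and J: "tree J" "finite J" and t: "\<And>\<nu>. \<nu> \<in> leaves I \<Longrightarrow> \<exists>\<mu>\<in>leaves J. moves \<alpha> \<nu> \<mu>"
    using less.prems(1) by (auto simp: table_def tree_def)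
  \<comment> \<open>With equal counts, a node that one tree lacks is compensated by a node with the
    same terminal vertex that the other tree lacks.\<close>
  have strict: "\<exists>m'\<in>I' - J'. fin m' = fin m"
    if "\<And>v. cnt I' v = cnt J' v" "finite I'" "finite J'" "m \<in> J' - I'" for I' J' m
  proof (rule ccontr)
    assume "\<not> ?thesis"
    then have "{m' \<in> I'. fin m' = fin m} \<subset> {m' \<in> J'. fin m' = fin m}" using that(4) by blast
    then have "cnt I' (fin m) < cnt J' (fin m)" unfolding cnt_def using that(3) by (intro psubset_card_mono) auto
    then show False using that(1) by simp
  qed
  show ?case
  proof (cases "J - I = {}")
    case True
    then have "I - J = {}" using strict[of J I] less.prems(3) I J by (metis Diff_iff ex_in_conv)
    then have "I = J" using True by blast
    then show ?thesis using table_same less.prems by blast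
  next
    case False
    \<comment> \<open>A shortest missing node: unless it is a root, its parent lies in
      \<open>J\<close> and is shorter, hence lies in \<open>I\<close>, so \<open>r\<close> is a leaf
      of \<open>I\<close>.\<close>
    define r where "r = arg_min_on length (J - I)"
    have "finite (J - I)" using J by simp
    then have r: "r \<in> J - I" and min: "\<And>m. m \<in> J - I \<Longrightarrow> length r \<le> length m"
      using arg_min_if_finite(1)[OF _ False, of length] arg_min_least[OF _ False, of _ length] unfolding r_def by auto
    have Ypr: "Yp r" using r J by (auto simp: tree_def)
    have rl: "r \<in> leaves I"
    proof -
      have "butlast r \<in> I" if "N0 < length r"
      proof (rule ccontr)
        assume "butlast r \<notin> I"
        then have "butlast r \<in> J - I" using J r that by (auto simp: tree_def)
        then show False using min[of "butlast r"] that by simp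
      qed
      then show ?thesis using Ypr r by (simp add: leaves_def)
    qed
    obtain p where p: "p \<in> I - J" "fin p = fin r" using strict[OF less.prems(3) I(2) J(2) r] by blast
    have Ypp: "Yp p" using p I by (auto simp: tree_def)
    have len: "N0 \<le> length p" "N0 \<le> length r" using Ypp Ypr by (auto simp: Yp_def)
    \<comment> \<open>Trees contain the prefixes of their nodes from length \<open>N0\<close> on, so
      comparability would put \<open>p\<close> into \<open>J\<close> or \<open>r\<close> into
      \<open>I\<close>.\<close>
    have "\<not> prefix p r" using tree_prefix[OF J(1) _ _ len(1)] p r by blast
    moreover have nr: "\<not> prefix r m" if "m \<in> I" for m using tree_prefix[OF I(1) that _ len(2)] r by blast
    ultimately have pr: "p \<parallel> r" using p by blast
    have g: "good_pair p r" using Ypp Ypr p pr by (simp add: good_pair_def)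
    note sc = swap_carrier[OF g]
    let ?I = "sw p r ` I" and ?\<beta> = "\<alpha> \<otimes>\<^bsub>full_group G\<^esub> swap p r"
    have pI: "p \<in> I" using p by simp
    note ex = tree_exchange[OF I(1) pI rl g]
    have swsw: "sw r p ` sw p r ` I = I"
      using sw_sw[OF pr] sw_commute[OF pr] by (auto simp: image_image)
    \<comment> \<open>Exchanging back restores \<open>I\<close>, which gives the leaf inclusion in
      the opposite direction.\<close>
    have back_leaves: "sw p r ` leaves ?I \<subseteq> leaves I"
      using tree_exchange(4)[OF ex(1,3,2) good_pair_sym[OF g]] unfolding swsw using sw_commute[OF pr] by auto
    have \<beta>: "?\<beta> \<in> carrier (full_group G)" using sc less.prems by simp
    have "table ?\<beta> ?I J"
      unfolding table_def
    proof (intro conjI ballI)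
      fix \<nu> assume \<nu>: "\<nu> \<in> leaves ?I"
      then have "sw p r \<nu> \<in> leaves I" using back_leaves by blast
      then obtain \<mu> where \<mu>: "\<mu> \<in> leaves J" "moves \<alpha> (sw p r \<nu>) \<mu>" using t by blast
      have Yp\<nu>: "Yp \<nu>" "N0 \<le> length \<nu>" using \<nu> by (auto simp: leaves_def Yp_def)
      have "\<not> strict_prefix \<nu> p" using leaves_not_prefix[OF ex(1) \<nu> ex(2)] .
      moreover have "\<not> strict_prefix \<nu> r"
        using tree_prefix[OF ex(1,3) _ Yp\<nu>(2)] \<nu> by (auto simp: leaves_def strict_prefix_def)
      ultimately have "moves (swap p r) \<nu> (sw p r \<nu>)" using swap_moves[OF g Yp\<nu>(1)] by blast
      then have "moves ?\<beta> \<nu> \<mu>"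
        using moves_compose[OF _ \<mu>(2)] sc less.prems(2) by (simp add: mult_full)
      then show "\<exists>\<mu>\<in>leaves J. moves ?\<beta> \<nu> \<mu>" using \<mu>(1) by blast
    qed (use ex J in auto)
    \<comment> \<open>Nodes common to both trees extend neither \<open>p\<close> nor
      \<open>r\<close> and stay in place, while \<open>r\<close> is gained.\<close>
    moreover have "J - ?I \<subset> J - I"
    proof -
      have "m \<in> ?I" if "m \<in> J" "m \<in> I" for m
      proof -
        have "\<not> prefix p m" using tree_prefix[OF J(1) that(1) _ len(1)] p by blast
        then show ?thesis using that nr sw_other[of p m r] by (metis imageI)
      qed
      then show ?thesis using ex(3) r by blast
    qed
    then have "card (J - ?I) < card (J - I)" using J by (intro psubset_card_mono) auto
    ultimately have "?\<beta> \<in> generate (full_group G) swaps"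
      using less.hyps \<beta> less.prems(3) cnt_sw[OF g] by metis
    moreover have "swap p r \<in> generate (full_group G) swaps"
      using g by (intro generate.incl) (auto simp: swaps_def)
    ultimately have "?\<beta> \<otimes>\<^bsub>full_group G\<^esub> swap p r \<in> generate (full_group G) swaps" by (rule generate.eng)
    moreover have "?\<beta> \<otimes>\<^bsub>full_group G\<^esub> swap p r = \<alpha>"
      using sc less.prems(2) swap_invol[OF g] by (simp add: F.m_assoc)
    ultimately show ?thesis by simp
  qed
qed

section \<open>Counting visits to a point\<close>

text \<open>The source tree contains all words in \<open>Y\<close> below the uniform level
  \<open>n\<close>, so its leaves are the words of length \<open>n\<close>. The target tree consists
  of the proper prefixes, of length at least \<open>N0\<close>, of their images.\<close>

lemma full_group_table:
  assumes \<alpha>: "\<alpha> \<in> carrier (full_group G)"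
  obtains I J where "table \<alpha> I J"
proof -
  have loc: "locally_moves \<alpha>" using \<alpha> carrier_iff by blast
  obtain n b where n: "n \<ge> N0" and b: "\<forall>x\<in>Y. moves \<alpha> (pre n x) (b (pre n x))"
    using uniform_level[OF loc] .
  define I where "I = {m. Yp m \<and> length m < n}"
  define J where "J = {m. Yp m \<and> (\<exists>\<nu>\<in>pre n ` Y. strict_prefix m (b \<nu>))}"
  have bl: "Yp (butlast m)" if "Yp m" "N0 < length m" for m
    using Yp_take[OF that(1), of "length m - 1"] that(2) by (simp add: butlast_conv_take)
  have "finite I" by (rule finite_subset[OF _ finite_Yp[of n]]) (auto simp: I_def)
  then have "tree I" unfolding tree_def I_def using bl by auto
  moreover have "tree J"
    unfolding tree_def
  proof (intro conjI ballI impI)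
    have "J \<subseteq> (\<Union>\<nu>\<in>pre n ` Y. set (prefixes (b \<nu>)))" by (auto simp: J_def strict_prefix_def)
    then show "finite J" using finite_level by (rule finite_subset[OF _ finite_UN_I]) auto
    fix m assume m: "m \<in> J"
    then show "Yp m" by (simp add: J_def)
    assume "N0 < length m"
    then show "butlast m \<in> J"
      using m bl prefix_order.le_less_trans[OF prefixeq_butlast] unfolding J_def by blast
  qed
  moreover have "\<exists>\<mu>\<in>leaves J. moves \<alpha> \<nu> \<mu>" if \<nu>: "\<nu> \<in> leaves I" for \<nu>
  proof -
    have Yp\<nu>: "Yp \<nu>" "n \<le> length \<nu>" using \<nu> by (auto simp: leaves_def I_def)
    moreover have "length \<nu> \<le> n"
      using \<nu> n by (cases "N0 < length \<nu>") (auto simp: leaves_def I_def)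
    ultimately have len: "length \<nu> = n" by simp
    obtain z where z: "conc \<nu> z \<in> X" using point_extending Yp_path[OF Yp\<nu>(1)] by blast
    have \<nu>P: "\<nu> \<in> pre n ` Y"
      using Yp_conc[OF Yp\<nu>(1) z] len pre_conc[of \<nu> z] by (metis imageI)
    then have mv: "moves \<alpha> \<nu> (b \<nu>)" using b by blast
    \<comment> \<open>An interior image word would be a proper prefix of another image word, but
      disjoint cylinders have disjoint images.\<close>
    have "b \<nu> \<notin> J"
    proof
      assume "b \<nu> \<in> J"
      then obtain \<nu>' where \<nu>': "\<nu>' \<in> pre n ` Y" "strict_prefix (b \<nu>) (b \<nu>')" by (auto simp: J_def)
      then have "\<nu>' \<noteq> \<nu>" by auto
      moreover have "length \<nu>' = length \<nu>" using \<nu>' len by auto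
      ultimately have "\<nu> \<parallel> \<nu>'" by (intro parallel_of_same_length) auto
      moreover have "moves \<alpha> \<nu>' (b \<nu>')" using b \<nu>' by blast
      ultimately have "b \<nu> \<parallel> b \<nu>'" using moves_parallel[OF \<alpha> mv] by blast
      then show False using \<nu>' by (auto simp: strict_prefix_def)
    qed
    moreover have "butlast (b \<nu>) \<in> J" if "N0 < length (b \<nu>)"
    proof -
      have "b \<nu> \<noteq> []" using that by auto
      then have "butlast (b \<nu>) \<noteq> b \<nu>" by (metis append_butlast_last_id not_Cons_self2 self_append_conv)
      then have "strict_prefix (butlast (b \<nu>)) (b \<nu>)" using prefixeq_butlast by (simp add: strict_prefix_def)
      then show ?thesis using \<nu>P bl[OF _ that] mv by (auto simp: J_def moves_def)
    qed
    ultimately have "b \<nu> \<in> leaves J" using mv by (simp add: leaves_def moves_def)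
    then show ?thesis using mv by blast
  qed
  ultimately show ?thesis using that unfolding table_def by blast
qed

text \<open>The depth of the leaf through \<open>y\<close> is expressed by the interior nodes that
  \<open>y\<close> passes, which allows visits before the leaf to be counted node by node.\<close>

lemma leaf_depth:
  assumes "tree I" "\<mu> \<in> leaves I" "y \<in> cyl \<mu>"
  shows "j < length \<mu> \<longleftrightarrow> j < N0 \<or> pre j y \<in> I"
proof -
  have \<mu>: "Yp \<mu>" "\<mu> \<notin> I" "N0 \<le> length \<mu>" "pre (length \<mu>) y = \<mu>"
    using assms by (auto simp: leaves_def Yp_def cyl_def)
  show ?thesis
  proof
    assume j: "j < length \<mu>"
    show "j < N0 \<or> pre j y \<in> I"
    proof (cases "j < N0")
      case False
      have "strict_prefix (pre j y) \<mu>" using j \<mu>(4) by (metis length_pre less_irrefl prefix_pre_mono less_imp_le strict_prefix_def)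
      then have "prefix (pre j y) (butlast \<mu>)" by (rule strict_prefix_butlast)
      moreover have "butlast \<mu> \<in> I" using assms(2) False j by (auto simp: leaves_def)
      ultimately show ?thesis using tree_prefix[OF assms(1)] False by auto
    qed simp
  next
    assume "j < N0 \<or> pre j y \<in> I"
    then show "j < length \<mu>"
    proof
      assume pj: "pre j y \<in> I"
      show ?thesis
      proof (rule ccontr)
        assume "\<not> j < length \<mu>"
        then have "prefix \<mu> (pre j y)" using \<mu>(4) by (simp add: prefix_pre_iff)
        then show False using tree_prefix[OF assms(1) pj] \<mu> by blast
      qed
    qed (use \<mu> in simp)
  qed
qed

definition hits where
  "hits z k x = int (card {j. j < k \<and> (shift ^^ j) x = z})"

text \<open>Along an arrow \<open>(x, k - l, y)\<close> both forward orbits agree from the times \<open>k\<close> and \<open>l\<close> on; the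
  cocycle compares the visits to \<open>z\<close> before these times.\<close>

definition visit_cocycle where
  "visit_cocycle z = (\<lambda>(x, m, y). SOME c. \<exists>k l. m = int k - int l \<and> (shift ^^ k) x = (shift ^^ l) y
     \<and> c = hits z k x - hits z l y)"

lemma hits_add: "hits z (k + d) x = hits z k x + hits z d ((shift ^^ k) x)"
proof -
  have "{j. j < k + d \<and> (shift ^^ j) x = z}
      = {j. j < k \<and> (shift ^^ j) x = z} \<union> (\<lambda>j. k + j) ` {j. j < d \<and> (shift ^^ j) ((shift ^^ k) x) = z}"
    (is "?A = ?B \<union> ?C")
  proof -
    have e: "(shift ^^ j) ((shift ^^ k) x) = (shift ^^ (k + j)) x" for j by (simp add: shift_pow ac_simps)
    have "j \<in> ?C" if "j \<in> ?A" "\<not> j < k" for j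
    proof -
      have "j = k + (j - k)" using that by simp
      then show ?thesis unfolding e using that by (intro image_eqI[of _ _ "j - k"]) auto
    qed
    then show ?thesis unfolding e by auto
  qed
  moreover have "card (?B \<union> ?C) = card ?B + card ?C" by (intro card_Un_disjoint) auto
  moreover have "card ?C = card {j. j < d \<and> (shift ^^ j) ((shift ^^ k) x) = z}"
    by (intro card_image inj_onI) simp
  ultimately show ?thesis by (simp add: hits_def)
qed

text \<open>The choice in the definition is immaterial: raising both levels by \<open>d\<close>
  adds, at both ends, the visits of the same tail.\<close>

lemma visit_cocycle_eq:
  assumes "(shift ^^ k) x = (shift ^^ l) y"
  shows "visit_cocycle z (x, int k - int l, y) = hits z k x - hits z l y"
proof -
  have *: "hits z k x - hits z l y = hits z k' x - hits z l' y"
    if eq: "(shift ^^ k) x = (shift ^^ l) y" and kl: "int k - int l = int k' - int l'" "k \<le> k'" for k l k' l'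
  proof -
    obtain d where d: "k' = k + d" using kl(2) le_Suc_ex by blast
    then have "l' = l + d" using kl(1) by simp
    then show ?thesis using d eq by (simp add: hits_add)
  qed
  have "hits z k x - hits z l y = hits z k' x - hits z l' y"
    if "int k - int l = int k' - int l'" "(shift ^^ k') x = (shift ^^ l') y" for k' l'
    using *[OF assms that(1)] *[OF that(2) that(1)[symmetric]] by linarith
  then have "(\<exists>k' l'. int k - int l = int k' - int l' \<and> (shift ^^ k') x = (shift ^^ l') y \<and>
      c = hits z k' x - hits z l' y) \<longleftrightarrow> c = hits z k x - hits z l y" for c
    using assms by metis
  then show ?thesis unfolding visit_cocycle_def prod.case by simp
qed

lemma visit_cocycle_mult:
  assumes "(x, m, y) \<in> arrows" "(y, n, w) \<in> arrows"
  shows "visit_cocycle z (x, m + n, w) = visit_cocycle z (x, m, y) + visit_cocycle z (y, n, w)"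
proof -
  obtain k l where kl: "m = int k - int l" "(shift ^^ k) x = (shift ^^ l) y"
    using assms(1) by (auto simp: arrows_def)
  obtain k' l' where kl': "n = int k' - int l'" "(shift ^^ k') y = (shift ^^ l') w"
    using assms(2) by (auto simp: arrows_def)
  \<comment> \<open>Both arrows are brought to the level \<open>l + k'\<close> at their common end
    \<open>y\<close>, so that the visits of \<open>y\<close> cancel in the sum.\<close>
  have 1: "(shift ^^ (k + k')) x = (shift ^^ (l + k')) y" using shift_add_eq kl by blast
  have 2: "(shift ^^ (l + k')) y = (shift ^^ (l' + l)) w"
    using shift_add_eq[OF kl'(2), of l] by (simp add: add.commute)
  have m: "m = int (k + k') - int (l + k')" "n = int (l + k') - int (l' + l)"
    "m + n = int (k + k') - int (l' + l)" using kl kl' by simp_all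
  show ?thesis
    unfolding m(3) visit_cocycle_eq[OF trans[OF 1 2]]
    unfolding m(1,2) visit_cocycle_eq[OF 1] visit_cocycle_eq[OF 2] by simp
qed

lemma hits_0: assumes "hits z k x \<noteq> 0" obtains j where "j < k" "(shift ^^ j) x = z"
proof -
  have "{j. j < k \<and> (shift ^^ j) x = z} \<noteq> {}" using assms unfolding hits_def by (metis card.empty of_nat_0)
  then show ?thesis using that by blast
qed

text \<open>A visit that occurs inside the prefix makes the tail one of the first few iterated
  shifts of \<open>z\<close>. This finiteness stands in for continuity of the cocycle when sums over
  arrows are formed.\<close>

lemma finite_visits: "finite {g \<in> Z \<mu> \<nu>. visit_cocycle z g \<noteq> 0}"
proof -
  let ?f = "\<lambda>y. (conc \<mu> y, int (length \<mu>) - int (length \<nu>), conc \<nu> y)"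
  have key: "y \<in> (\<lambda>i. (shift ^^ i) z) ` {..length \<rho>}" if h: "hits z (length \<rho>) (conc \<rho> y) \<noteq> 0" for y and \<rho> :: "'e list"
  proof -
    obtain j where j: "j < length \<rho>" "(shift ^^ j) (conc \<rho> y) = z" by (rule hits_0[OF h])
    have "(shift ^^ (length \<rho> - j)) z = (shift ^^ length \<rho>) (conc \<rho> y)"
      using j by (auto simp: shift_pow)
    then have "y = (shift ^^ (length \<rho> - j)) z" by simp
    then show ?thesis by auto
  qed
  have "{g \<in> Z \<mu> \<nu>. visit_cocycle z g \<noteq> 0} \<subseteq>
      ?f ` ((\<lambda>i. (shift ^^ i) z) ` {..length \<mu>} \<union> (\<lambda>i. (shift ^^ i) z) ` {..length \<nu>})"
  proof
    fix g assume g: "g \<in> {g \<in> Z \<mu> \<nu>. visit_cocycle z g \<noteq> 0}"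
    then obtain y where y: "g = ?f y" by (auto simp: Z_def)
    have "visit_cocycle z (?f y) = hits z (length \<mu>) (conc \<mu> y) - hits z (length \<nu>) (conc \<nu> y)"
      by (rule visit_cocycle_eq) simp
    then have "hits z (length \<mu>) (conc \<mu> y) \<noteq> 0 \<or> hits z (length \<nu>) (conc \<nu> y) \<noteq> 0" using g y by auto
    then have "y \<in> (\<lambda>i. (shift ^^ i) z) ` {..length \<mu>} \<union> (\<lambda>i. (shift ^^ i) z) ` {..length \<nu>}"
      using key by blast
    then show "g \<in> ?f ` ((\<lambda>i. (shift ^^ i) z) ` {..length \<mu>} \<union> (\<lambda>i. (shift ^^ i) z) ` {..length \<nu>})"
      unfolding y by (rule imageI)
  qed
  then show ?thesis by (rule finite_subset) auto
qed

lemma arrow_nbhd: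
  assumes "g \<in> arr" "n \<ge> N0"
  obtains \<mu> \<nu> where "g \<in> Z \<mu> \<nu>" "Yp \<mu>" "Yp \<nu>" "n \<le> length \<mu>" "n \<le> length \<nu>"
proof -
  obtain x m y where g: "g = (x, m, y)" by (cases g)
  have xy: "x \<in> Y" "y \<in> Y" "(x, m, y) \<in> arrows" using assms by (auto simp: g arr_def)
  obtain k l where kl: "k \<ge> n" "l \<ge> n" "m = int k - int l" "(shift ^^ k) x = (shift ^^ l) y"
    by (rule arrow_levels[OF xy(3), of n])
  have "g \<in> Z (pre k x) (pre l y)" using arrow_in_Z[OF _ _ kl(4)] xy Y_sub unfolding g kl(3) by blast
  then show ?thesis using that[of "pre k x" "pre l y"] Yp_pre xy kl assms(2) by simp
qed

lemma Z_inj: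
  assumes "g \<in> Z \<mu> \<nu>" "h \<in> Z \<mu> \<nu>" "rng G g = rng G h \<or> src G g = src G h"
  shows "g = h"
  using assms by (auto simp: Z_def)

section \<open>Composable pairs, and the pairing of the visit cocycle with boundaries\<close>

abbreviation CT where "CT \<equiv> composable_top G"

definition comp :: "_ \<Rightarrow> (nat \<Rightarrow> 'e) \<times> int \<times> (nat \<Rightarrow> 'e)" where
  "comp = (\<lambda>(g1, g2). gcomp G g1 g2)"

lemma topspace_CT: "topspace CT = {(g, h). g \<in> arr \<and> h \<in> arr \<and> src G g = rng G h}"
  by (auto simp: composable_top_def)

lemma composable_nbhd:
  assumes "w \<in> topspace CT"
  obtains \<mu> \<nu> \<rho> \<tau> where "openin CT (topspace CT \<inter> Z \<mu> \<nu> \<times> Z \<rho> \<tau>)" "w \<in> Z \<mu> \<nu> \<times> Z \<rho> \<tau>"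
proof -
  obtain g h where w: "w = (g, h)" "g \<in> arr" "h \<in> arr" using assms by (auto simp: topspace_CT)
  obtain \<mu> \<nu> where gz: "g \<in> Z \<mu> \<nu>" "Yp \<mu>" "Yp \<nu>" using arrow_nbhd[OF w(2) order_refl] by metis
  obtain \<rho> \<tau> where hz: "h \<in> Z \<rho> \<tau>" "Yp \<rho>" "Yp \<tau>" using arrow_nbhd[OF w(3) order_refl] by metis
  have "openin (prod_topology (arrow_top G) (arrow_top G)) (Z \<mu> \<nu> \<times> Z \<rho> \<tau>)"
    using gz hz openin_Z_G by (simp add: openin_prod_Times_iff)
  then have "openin CT ((Z \<mu> \<nu> \<times> Z \<rho> \<tau>) \<inter> {(g, h). src G g = rng G h})"
    unfolding composable_top_def openin_subtopology by blast
  moreover have "(Z \<mu> \<nu> \<times> Z \<rho> \<tau>) \<inter> {(g, h). src G g = rng G h} = topspace CT \<inter> Z \<mu> \<nu> \<times> Z \<rho> \<tau>"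
    unfolding topspace_CT using Z_arr[OF gz(2,3)] Z_arr[OF hz(2,3)] by blast
  ultimately have "openin CT (topspace CT \<inter> Z \<mu> \<nu> \<times> Z \<rho> \<tau>)" by simp
  then show ?thesis using that gz hz w by blast
qed

text \<open>The three face maps are injective on the open sets that appear here.\<close>

lemma compact_finite:
  assumes "compactin CT K" "\<And>\<mu> \<nu> \<rho> \<tau>. finite (Q \<inter> topspace CT \<inter> Z \<mu> \<nu> \<times> Z \<rho> \<tau>)"
  shows "finite (K \<inter> Q)"
proof -
  let ?\<U> = "{U. openin CT U \<and> finite (Q \<inter> U)}"
  have Ks: "K \<subseteq> topspace CT" using assms(1) by (rule compactin_subset_topspace)
  have "K \<subseteq> \<Union>?\<U>"
  proof
    fix w assume "w \<in> K"
    then have w: "w \<in> topspace CT" using Ks by blast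
    obtain \<mu> \<nu> \<rho> \<tau> where o: "openin CT (topspace CT \<inter> Z \<mu> \<nu> \<times> Z \<rho> \<tau>)" "w \<in> Z \<mu> \<nu> \<times> Z \<rho> \<tau>"
      by (rule composable_nbhd[OF w])
    have "finite (Q \<inter> (topspace CT \<inter> Z \<mu> \<nu> \<times> Z \<rho> \<tau>))" using assms(2) by (simp add: Int_assoc)
    then show "w \<in> \<Union>?\<U>" using o w by blast
  qed
  then obtain \<F> where F: "finite \<F>" "\<F> \<subseteq> ?\<U>" "K \<subseteq> \<Union>\<F>"
    using assms(1) unfolding compactin_def by (metis (no_types, lifting) mem_Collect_eq)
  then have "K \<inter> Q \<subseteq> (\<Union>U\<in>\<F>. Q \<inter> U)" by blast
  moreover have "finite (\<Union>U\<in>\<F>. Q \<inter> U)" using F by blast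
  ultimately show ?thesis by (rule finite_subset)
qed

lemma composable_src_rng: "w \<in> topspace CT \<Longrightarrow> src G (fst w) = rng G (snd w)"
  unfolding topspace_CT by force

lemma fst_inj: "inj_on fst (topspace CT \<inter> Z \<mu> \<nu> \<times> Z \<rho> \<tau>)"
proof (rule inj_onI)
  fix w w' assume *: "w \<in> topspace CT \<inter> Z \<mu> \<nu> \<times> Z \<rho> \<tau>" "w' \<in> topspace CT \<inter> Z \<mu> \<nu> \<times> Z \<rho> \<tau>" "fst w = fst w'"
  then have "rng G (snd w) = rng G (snd w')" using composable_src_rng by (metis IntD1)
  then have "snd w = snd w'" using Z_inj[of "snd w" \<rho> \<tau> "snd w'"] * by (auto simp: mem_Times_iff)
  then show "w = w'" using * by (simp add: prod_eq_iff)
qed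

lemma snd_inj: "inj_on snd (topspace CT \<inter> Z \<mu> \<nu> \<times> Z \<rho> \<tau>)"
proof (rule inj_onI)
  fix w w' assume *: "w \<in> topspace CT \<inter> Z \<mu> \<nu> \<times> Z \<rho> \<tau>" "w' \<in> topspace CT \<inter> Z \<mu> \<nu> \<times> Z \<rho> \<tau>" "snd w = snd w'"
  then have "src G (fst w) = src G (fst w')" using composable_src_rng by (metis IntD1)
  then have "fst w = fst w'" using Z_inj[of "fst w" \<mu> \<nu> "fst w'"] * by (auto simp: mem_Times_iff)
  then show "w = w'" using * by (simp add: prod_eq_iff)
qed

lemma comp_simp [simp]: "comp ((x, m, y), (x', n, w)) = (x, m + n, w)"
  by (simp add: comp_def)

text \<open>A product keeps the range of its first factor and the source of its second, and in
  bisections these determine the factors.\<close>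

lemma comp_inj_on_bisections:
  assumes "inj_on (rng G) A" "inj_on (src G) B"
  shows "inj_on comp (topspace CT \<inter> A \<times> B)"
proof (rule inj_onI)
  fix w w' assume w: "w \<in> topspace CT \<inter> A \<times> B" "w' \<in> topspace CT \<inter> A \<times> B" "comp w = comp w'"
  obtain x m y x' n v where e: "w = ((x, m, y), (x', n, v))" by (metis prod.collapse)
  obtain a k b a' l c where e': "w' = ((a, k, b), (a', l, c))" by (metis prod.collapse)
  have "x = a" "v = c" using w(3) by (auto simp: e e')
  then have "rng G (x, m, y) = rng G (a, k, b)" "src G (x', n, v) = src G (a', l, c)" by simp_all
  moreover have "(x, m, y) \<in> A" "(a, k, b) \<in> A" "(x', n, v) \<in> B" "(a', l, c) \<in> B"
    using w by (auto simp: e e')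
  ultimately show "w = w'" using assms unfolding e e' inj_on_def by blast
qed

lemma inj_on_Z: "inj_on (rng G) (Z \<mu> \<nu>)" "inj_on (src G) (Z \<mu> \<nu>)"
  by (rule inj_onI, metis Z_inj)+

lemma comp_inj: "inj_on comp (topspace CT \<inter> Z \<mu> \<nu> \<times> Z \<rho> \<tau>)"
  by (intro comp_inj_on_bisections inj_on_Z)

definition chains where "chains = carrier (Cc CT)"

lemma chain_support:
  assumes "f \<in> chains" "\<And>\<mu> \<nu> \<rho> \<tau>. finite (Q \<inter> topspace CT \<inter> Z \<mu> \<nu> \<times> Z \<rho> \<tau>)"
  shows "finite {w \<in> topspace CT. f w \<noteq> 0 \<and> w \<in> Q}"
proof -
  let ?S = "{w \<in> topspace CT. f w \<noteq> 0}"
  have "compactin CT (CT closure_of ?S)" using assms(1) by (simp add: chains_def Cc_def)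
  then have "finite ((CT closure_of ?S) \<inter> Q)" using compact_finite assms(2) by blast
  moreover have "?S \<subseteq> CT closure_of ?S" by (rule closure_of_subset) auto
  ultimately show ?thesis by (elim finite_subset[rotated]) auto
qed

text \<open>In a product of two sets \<open>Z\<close>, each component of a composable pair
  determines the pair, so \<open>finite_visits\<close> leaves finitely many pairs. Compactness of
  the support reduces to finitely many such products.\<close>

lemma finite_visiting_chain:
  assumes "f \<in> chains"
  shows "finite {w \<in> topspace CT. f w \<noteq> 0 \<and> (visit_cocycle z (fst w) \<noteq> 0 \<or> visit_cocycle z (snd w) \<noteq> 0)}"
proof -
  let ?Q = "{w. visit_cocycle z (fst w) \<noteq> 0 \<or> visit_cocycle z (snd w) \<noteq> 0}"
  have "finite (?Q \<inter> topspace CT \<inter> Z \<mu> \<nu> \<times> Z \<rho> \<tau>)" for \<mu> \<nu> \<rho> \<tau>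
  proof -
    let ?O = "topspace CT \<inter> Z \<mu> \<nu> \<times> Z \<rho> \<tau>"
    let ?A = "{w \<in> ?O. visit_cocycle z (fst w) \<noteq> 0}" and ?B = "{w \<in> ?O. visit_cocycle z (snd w) \<noteq> 0}"
    have "finite (fst ` ?A)" by (rule finite_subset[OF _ finite_visits[of \<mu> \<nu> z]]) auto
    then have "finite ?A" by (rule finite_imageD) (rule inj_on_subset[OF fst_inj], blast)
    moreover have "finite (snd ` ?B)" by (rule finite_subset[OF _ finite_visits[of \<rho> \<tau> z]]) auto
    then have "finite ?B" by (rule finite_imageD) (rule inj_on_subset[OF snd_inj], blast)
    moreover have "?Q \<inter> topspace CT \<inter> Z \<mu> \<nu> \<times> Z \<rho> \<tau> \<subseteq> ?A \<union> ?B" by auto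
    ultimately show ?thesis by (meson finite_UnI finite_subset)
  qed
  from chain_support[OF assms this] show ?thesis by simp
qed

lemma delta2_eq: "delta2 G f g = push_forward CT snd f g - push_forward CT comp f g + push_forward CT fst f g"
  by (simp add: delta2_def comp_def)

text \<open>The projection formula: pairing \<open>d_* f\<close> with \<open>k\<close> is pairing
  \<open>f\<close> with \<open>k\<close> after \<open>d\<close>. The finite set \<open>W\<close> has
  to contain every pair that contributes, \<open>S\<close> the images of \<open>W\<close>.\<close>

lemma push_forward_pairing:
  assumes "finite W" "W \<subseteq> {w \<in> topspace CT. f w \<noteq> 0}" "finite S" "d ` W \<subseteq> S"
    and "\<And>w. w \<in> topspace CT \<Longrightarrow> f w \<noteq> 0 \<Longrightarrow> k (d w) \<noteq> 0 \<Longrightarrow> w \<in> W"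
  shows "(\<Sum>g\<in>S. push_forward CT d f g * k g) = (\<Sum>w\<in>W. f w * k (d w))"
proof -
  have "(\<Sum>w\<in>W. f w * k (d w)) = (\<Sum>g\<in>S. \<Sum>w | w \<in> W \<and> d w = g. f w * k (d w))"
    using sum.group[OF assms(1,3,4), of "\<lambda>w. f w * k (d w)"] by simp
  also have "\<dots> = (\<Sum>g\<in>S. push_forward CT d f g * k g)"
  proof (rule sum.cong[OF refl])
    fix g assume "g \<in> S"
    have "(\<Sum>w | w \<in> W \<and> d w = g. f w * k (d w)) = (\<Sum>w | w \<in> W \<and> d w = g. f w) * k g"
      by (simp add: sum_distrib_right)
    also have "\<dots> = push_forward CT d f g * k g"
    proof (cases "k g = 0")
      case False
      then have "{w. w \<in> W \<and> d w = g} = {w \<in> topspace CT. d w = g \<and> f w \<noteq> 0}"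
        using assms(2,5) by blast
      then show ?thesis by (simp add: push_forward_def)
    qed simp
    finally show "(\<Sum>w | w \<in> W \<and> d w = g. f w * k (d w)) = push_forward CT d f g * k g" .
  qed
  finally show ?thesis by simp
qed

lemma visit_cocycle_comp:
  assumes "w \<in> topspace CT"
  shows "visit_cocycle z (comp w) = visit_cocycle z (fst w) + visit_cocycle z (snd w)"
proof -
  obtain x m y x' n v where e: "w = ((x, m, y), (x', n, v))" by (metis prod.collapse)
  have "x' = y" "(x, m, y) \<in> arrows" "(x', n, v) \<in> arrows"
    using assms arr_arrows by (auto simp: e topspace_CT)
  then show ?thesis using visit_cocycle_mult by (simp add: e)
qed

text \<open>By the projection formula, pairing with \<open>delta2\<close> becomes pairing
  \<open>f\<close> with \<open>k(g2) - k(g1 g2) + k(g1)\<close>, which is zero by the cocycle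
  identity.\<close>

lemma boundary_pairing:
  assumes f: "f \<in> chains" and T: "finite {g. delta2 G f g \<noteq> 0 \<and> visit_cocycle z g \<noteq> 0}"
  shows "(\<Sum>g | delta2 G f g \<noteq> 0 \<and> visit_cocycle z g \<noteq> 0. delta2 G f g * visit_cocycle z g) = 0"
proof -
  let ?T = "{g. delta2 G f g \<noteq> 0 \<and> visit_cocycle z g \<noteq> 0}" and ?k = "visit_cocycle z"
  define W where "W = {w \<in> topspace CT. f w \<noteq> 0 \<and> (?k (fst w) \<noteq> 0 \<or> ?k (snd w) \<noteq> 0)}"
  \<comment> \<open>One finite set that serves all three push-forwards, so that the sum can be
    split.\<close>
  define S where "S = ?T \<union> fst ` W \<union> snd ` W \<union> comp ` W"
  have W: "finite W" unfolding W_def by (rule finite_visiting_chain[OF f])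
  have S: "finite S" unfolding S_def using W T by blast
  have sub: "W \<subseteq> {w \<in> topspace CT. f w \<noteq> 0}" by (auto simp: W_def)
  have "(\<Sum>g\<in>?T. delta2 G f g * ?k g) = (\<Sum>g\<in>S. delta2 G f g * ?k g)"
    by (rule sum.mono_neutral_left[OF S]) (auto simp: S_def)
  also have "\<dots> = (\<Sum>g\<in>S. push_forward CT snd f g * ?k g) - (\<Sum>g\<in>S. push_forward CT comp f g * ?k g)
      + (\<Sum>g\<in>S. push_forward CT fst f g * ?k g)"
    by (simp add: delta2_eq sum.distrib sum_subtractf algebra_simps)
  also have "\<dots> = (\<Sum>w\<in>W. f w * ?k (snd w)) - (\<Sum>w\<in>W. f w * ?k (comp w)) + (\<Sum>w\<in>W. f w * ?k (fst w))"
  proof -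
    have "(\<Sum>g\<in>S. push_forward CT snd f g * ?k g) = (\<Sum>w\<in>W. f w * ?k (snd w))"
      by (rule push_forward_pairing[OF W sub S]) (auto simp: S_def W_def)
    moreover have "(\<Sum>g\<in>S. push_forward CT fst f g * ?k g) = (\<Sum>w\<in>W. f w * ?k (fst w))"
      by (rule push_forward_pairing[OF W sub S]) (auto simp: S_def W_def)
    moreover have "(\<Sum>g\<in>S. push_forward CT comp f g * ?k g) = (\<Sum>w\<in>W. f w * ?k (comp w))"
      by (rule push_forward_pairing[OF W sub S]) (auto simp: S_def W_def visit_cocycle_comp)
    ultimately show ?thesis by simp
  qed
  also have "\<dots> = (\<Sum>w\<in>W. f w * (?k (snd w) - ?k (comp w) + ?k (fst w)))"
    by (simp add: sum.distrib sum_subtractf algebra_simps)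
  also have "\<dots> = 0"
    by (rule sum.neutral) (simp add: W_def visit_cocycle_comp)
  finally show ?thesis .
qed

text \<open>By \<open>leaf_depth\<close>, these are the visits of \<open>z\<close> made before the
  leaf of the visiting point is reached. The times \<open>j < N0\<close> lie above the roots and
  count for every tree.\<close>

definition visits where
  "visits z I = {(x, j). x \<in> Y \<and> (j < N0 \<or> pre j x \<in> I) \<and> (shift ^^ j) x = z}"

text \<open>A visit at time \<open>j \<ge> N0\<close> is determined by the interior node
  \<open>m\<close> passed then: the point is \<open>m\<close> followed by \<open>z\<close>, which is
  admissible exactly when \<open>m\<close> ends where \<open>z\<close> starts. Earlier visits give
  the constant \<open>visits z {}\<close>, which cancels when two trees are compared.\<close>

lemma card_visits:
  assumes z: "z \<in> X" and I: "tree I"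
  shows "finite (visits z I)" "card (visits z I) = card (visits z {}) + cnt I (tail D (z 0))"
proof -
  let ?f = "\<lambda>m. (conc m z, length m)"
  let ?V = "{m \<in> I. fin m = tail D (z 0)}"
  have inj: "inj_on ?f A" for A
    by (rule inj_onI) (metis (no_types, lifting) Pair_inject pre_conc)
  have fin0: "finite (visits z {})"
  proof -
    have "visits z {} \<subseteq> ?f ` {xs. set xs \<subseteq> arcs D \<and> length xs \<le> N0}"
    proof
      fix w assume "w \<in> visits z {}"
      then obtain x j where w: "w = (x, j)" "x \<in> Y" "j < N0" "(shift ^^ j) x = z" by (auto simp: visits_def)
      have "x i \<in> arcs D" for i using w Y_sub X_iff by blast
      then have "set (pre j x) \<subseteq> arcs D" by (auto simp: pre_def)
      moreover have "w = ?f (pre j x)" using w conc_pre_shift[of j x] by simp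
      ultimately show "w \<in> ?f ` {xs. set xs \<subseteq> arcs D \<and> length xs \<le> N0}" using w by force
    qed
    then show ?thesis using finite_lists_length_le[OF finite_arcs] finite_subset by blast
  qed
  have split: "visits z I = visits z {} \<union> ?f ` ?V"
  proof
    show "visits z I \<subseteq> visits z {} \<union> ?f ` ?V"
    proof
      fix w assume "w \<in> visits z I"
      then obtain x j where w: "w = (x, j)" "x \<in> Y" "j < N0 \<or> pre j x \<in> I" "(shift ^^ j) x = z"
        by (auto simp: visits_def)
      show "w \<in> visits z {} \<union> ?f ` ?V"
      proof (cases "j < N0")
        case False
        then have j: "j > 0" "pre j x \<in> I" using w N0_pos by auto
        have "z 0 = x j" using w(4) by (auto simp: shift_pow)
        then have "fin (pre j x) = tail D (z 0)" using fin_pre[OF _ j(1)] w(2) Y_sub by auto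
        moreover have "w = ?f (pre j x)" using w conc_pre_shift[of j x] by simp
        ultimately show ?thesis using j by blast
      qed (use w in \<open>auto simp: visits_def\<close>)
    qed
    have "?f m \<in> visits z I" if m: "m \<in> ?V" for m
    proof -
      have "Yp m" using m I by (auto simp: tree_def)
      moreover have "conc m z \<in> X" using conc_X_iff[OF Yp_path] \<open>Yp m\<close> m z by auto
      ultimately show ?thesis using m Yp_conc by (simp add: visits_def)
    qed
    then show "visits z {} \<union> ?f ` ?V \<subseteq> visits z I" by (auto simp: visits_def)
  qed
  have finV: "finite ?V" using I by (simp add: tree_def)
  show "finite (visits z I)" unfolding split using fin0 finV by blast
  have "visits z {} \<inter> ?f ` ?V = {}" using I by (auto simp: visits_def tree_def Yp_def)
  then have "card (visits z I) = card (visits z {}) + card (?f ` ?V)"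
    unfolding split using fin0 finV by (intro card_Un_disjoint) auto
  then show "card (visits z I) = card (visits z {}) + cnt I (tail D (z 0))"
    using card_image[OF inj] by (simp add: cnt_def)
qed

lemma sum_fibre_cards:
  assumes "finite E" "finite A" "fst ` E \<subseteq> A"
  shows "(\<Sum>a\<in>A. int (card {j. (a, j) \<in> E})) = int (card E)"
proof -
  have "E = (SIGMA a:A. {j. (a, j) \<in> E})" using assms(3) by force
  moreover have "finite {j. (a, j) \<in> E}" for a
    by (rule finite_subset[OF _ finite_imageI[OF assms(1), of snd]]) force
  ultimately have "card E = (\<Sum>a\<in>A. card {j. (a, j) \<in> E})" using card_SigmaI[OF assms(2)] by metis
  then show ?thesis by simp
qed

text \<open>The cocycle is evaluated at the depths of the two matched leaves, where both ends have
  the same tail; \<open>leaf_depth\<close> rewrites the visits before these depths.\<close>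

lemma visit_cocycle_graph:
  assumes t: "table \<alpha> I J" and g: "(a, m, x) \<in> graph_set \<alpha>"
  shows "visit_cocycle z (a, m, x) = int (card {j. (a, j) \<in> visits z J}) - int (card {j. (x, j) \<in> visits z I})"
proof -
  have IJ: "tree I" "tree J" using t by (auto simp: table_def)
  have ax: "a \<in> Y" "x \<in> Y" "\<alpha> (u x) = u a" using graph_set_src[OF g] by auto
  obtain n where n: "pre n x \<in> leaves I" using leaf_exists[OF IJ(1) ax(2)] by blast
  obtain \<mu> where \<mu>: "\<mu> \<in> leaves J" "moves \<alpha> (pre n x) \<mu>" using t n by (auto simp: table_def)
  have x: "x \<in> cyl (pre n x)" using in_cyl_pre ax Y_sub by blast
  have xe: "x = conc (pre n x) ((shift ^^ n) x)" by (simp add: conc_pre_shift)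
  have xX: "conc (pre n x) ((shift ^^ n) x) \<in> X" using ax(2) Y_sub xe by auto
  have a: "a = conc \<mu> ((shift ^^ n) x)" using moves_apply[OF \<mu>(2) xX] ax(3) xe by simp
  have ac: "a \<in> cyl \<mu>" using conc_in_cyl moves_conc_X[OF \<mu>(2)] xX a by blast
  have "(a, int (length \<mu>) - int n, x) \<in> graph_set \<alpha>"
    unfolding graph_set_iff using \<mu>(2) x ax(3) by (intro exI[of _ "pre n x"] exI[of _ \<mu>]) simp
  then have m: "m = int (length \<mu>) - int n" using graph_set_functional[OF g] by blast
  have "(shift ^^ length \<mu>) a = (shift ^^ n) x" by (simp add: a)
  then have "visit_cocycle z (a, m, x) = hits z (length \<mu>) a - hits z n x"
    unfolding m by (rule visit_cocycle_eq)
  moreover have "{j. j < length \<mu> \<and> (shift ^^ j) a = z} = {j. (a, j) \<in> visits z J}"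
    using leaf_depth[OF IJ(2) \<mu>(1) ac] ax by (auto simp: visits_def)
  moreover have "{j. j < n \<and> (shift ^^ j) x = z} = {j. (x, j) \<in> visits z I}"
    using leaf_depth[OF IJ(1) n x] ax by (auto simp: visits_def)
  ultimately show ?thesis by (simp add: hits_def)
qed

text \<open>The pairing of the visit cocycle with the graph of \<open>\<alpha>\<close> counts the interior nodes of the two
  trees that end at the vertex where \<open>z\<close> starts.\<close>

lemma table_cnt_eq:
  assumes \<alpha>: "\<alpha> \<in> carrier (full_group G)" and t: "table \<alpha> I J"
    and f: "f \<in> chains" "delta2 G f = indicator (graph_set \<alpha>)"
  shows "cnt I v = cnt J v"
proof (cases "v \<in> verts D")
  case False
  have "cnt K v = 0" if "tree K" for K
  proof -
    have "{m \<in> K. fin m = v} = {}" using that False fin_in_verts Yp_path by (auto simp: tree_def)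
    then show ?thesis unfolding cnt_def by (metis card.empty)
  qed
  then show ?thesis using t by (simp add: table_def)
next
  case True
  \<comment> \<open>Any point leaving \<open>v\<close> will do, since the count depends on
    \<open>z\<close> only through its first vertex.\<close>
  obtain z where z: "z \<in> X" "tail D (z 0) = v" by (rule point_from[OF True])
  have IJ: "tree I" "tree J" using t by (auto simp: table_def)
  note fI = card_visits[OF z(1) IJ(1)] and fJ = card_visits[OF z(1) IJ(2)]
  let ?U = "graph_set \<alpha>" and ?k = "visit_cocycle z"
  \<comment> \<open>The arrows of the graph with a visited end. They are finitely many and include
    all those where the cocycle is non-zero.\<close>
  define T where "T = {g \<in> ?U. fst g \<in> fst ` visits z J \<or> snd (snd g) \<in> fst ` visits z I}"
  have inj1: "inj_on (\<lambda>g. snd (snd g)) ?U"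
    using graph_set_functional by (auto simp: inj_on_def)
  have inj2: "inj_on fst ?U"
  proof (rule inj_onI)
    fix g h assume gh: "g \<in> ?U" "h \<in> ?U" "fst g = fst h"
    obtain a m b a' m' b' where e: "g = (a, m, b)" "h = (a', m', b')" by (metis prod.collapse)
    have "\<alpha> (u b) = \<alpha> (u b')" "b \<in> Y" "b' \<in> Y"
      using gh graph_set_src[of a m b \<alpha>] graph_set_src[of a' m' b' \<alpha>] by (auto simp: e)
    then have "b = b'" using full_inj[OF \<alpha>] by blast
    then show "g = h" using gh graph_set_functional[of a m b \<alpha> a' m'] by (auto simp: e)
  qed
  have finT: "finite T"
  proof -
    have "finite {g \<in> ?U. fst g \<in> fst ` visits z J}"
      by (rule finite_imageD[of fst]) (auto intro: finite_subset[OF _ finite_imageI[OF fJ(1), of fst]] inj_on_subset[OF inj2])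
    moreover have "finite {g \<in> ?U. snd (snd g) \<in> fst ` visits z I}"
      by (rule finite_imageD[of "\<lambda>g. snd (snd g)"]) (auto intro: finite_subset[OF _ finite_imageI[OF fI(1), of fst]] inj_on_subset[OF inj1])
    moreover have "T \<subseteq> {g \<in> ?U. fst g \<in> fst ` visits z J} \<union> {g \<in> ?U. snd (snd g) \<in> fst ` visits z I}"
      by (auto simp: T_def)
    ultimately show ?thesis by (meson finite_UnI finite_subset)
  qed
  have k: "?k g = int (card {j. (fst g, j) \<in> visits z J}) - int (card {j. (snd (snd g), j) \<in> visits z I})"
    if "g \<in> ?U" for g
    using visit_cocycle_graph[OF t, of "fst g" "fst (snd g)" "snd (snd g)"] that by simp
  have nz: "{g. delta2 G f g \<noteq> 0 \<and> ?k g \<noteq> 0} \<subseteq> T"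
  proof
    fix g assume "g \<in> {g. delta2 G f g \<noteq> 0 \<and> ?k g \<noteq> 0}"
    then have g: "g \<in> ?U" "?k g \<noteq> 0" by (auto simp: f(2) indicator_def split: if_splits)
    then have "{j. (fst g, j) \<in> visits z J} \<noteq> {} \<or> {j. (snd (snd g), j) \<in> visits z I} \<noteq> {}"
      using k[OF g(1)] by force
    then show "g \<in> T" using g by (force simp: T_def)
  qed
  have "(\<Sum>g | delta2 G f g \<noteq> 0 \<and> ?k g \<noteq> 0. delta2 G f g * ?k g) = (\<Sum>g\<in>T. ?k g)"
  proof -
    have "(\<Sum>g | delta2 G f g \<noteq> 0 \<and> ?k g \<noteq> 0. delta2 G f g * ?k g) = (\<Sum>g\<in>T. delta2 G f g * ?k g)"
      by (rule sum.mono_neutral_left[OF finT nz]) auto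
    also have "\<dots> = (\<Sum>g\<in>T. ?k g)" by (rule sum.cong) (auto simp: f(2) T_def)
    finally show ?thesis .
  qed
  then have "(\<Sum>g\<in>T. ?k g) = 0"
    using boundary_pairing[OF f(1) finite_subset[OF nz finT]] by simp
  moreover have "(\<Sum>g\<in>T. ?k g) = (\<Sum>g\<in>T. int (card {j. (fst g, j) \<in> visits z J}))
      - (\<Sum>g\<in>T. int (card {j. (snd (snd g), j) \<in> visits z I}))"
    unfolding sum_subtractf[symmetric] using k by (intro sum.cong) (auto simp: T_def)
  \<comment> \<open>Every point of \<open>Y\<close> is the range of one arrow of the graph, so the
    fibre counts add up to the number of all visits; below, sources are treated alike.\<close>
  moreover have "(\<Sum>g\<in>T. int (card {j. (fst g, j) \<in> visits z J})) = int (card (visits z J))"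
  proof -
    have "(\<Sum>g\<in>T. int (card {j. (fst g, j) \<in> visits z J})) = (\<Sum>a\<in>fst ` T. int (card {j. (a, j) \<in> visits z J}))"
      by (rule sum.reindex[symmetric, unfolded comp_def o_def]) (auto intro: inj_on_subset[OF inj2] simp: T_def)
    also have "\<dots> = int (card (visits z J))"
    proof (rule sum_fibre_cards[OF fJ(1) finite_imageI[OF finT]])
      show "fst ` visits z J \<subseteq> fst ` T"
      proof
        fix a assume a: "a \<in> fst ` visits z J"
        then have "a \<in> Y" by (auto simp: visits_def)
        then obtain x where x: "x \<in> Y" "\<alpha> (u x) = u a" using full_surj[OF \<alpha>] by blast
        then obtain a' m where g: "(a', m, x) \<in> ?U" using graph_set_total \<alpha> carrier_iff by blast
        then have "a' = a" using graph_set_src[OF g] x by simp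
        then show "a \<in> fst ` T" using g a unfolding T_def by force
      qed
    qed
    finally show ?thesis .
  qed
  moreover have "(\<Sum>g\<in>T. int (card {j. (snd (snd g), j) \<in> visits z I})) = int (card (visits z I))"
  proof -
    have "(\<Sum>g\<in>T. int (card {j. (snd (snd g), j) \<in> visits z I}))
        = (\<Sum>a\<in>(\<lambda>g. snd (snd g)) ` T. int (card {j. (a, j) \<in> visits z I}))"
      by (rule sum.reindex[symmetric, unfolded o_def]) (auto intro: inj_on_subset[OF inj1] simp: T_def)
    also have "\<dots> = int (card (visits z I))"
    proof (rule sum_fibre_cards[OF fI(1) finite_imageI[OF finT]])
      show "fst ` visits z I \<subseteq> (\<lambda>g. snd (snd g)) ` T"
      proof
        fix x assume x: "x \<in> fst ` visits z I"
        then have "x \<in> Y" by (auto simp: visits_def)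
        then obtain a m where g: "(a, m, x) \<in> ?U" using graph_set_total \<alpha> carrier_iff by blast
        then show "x \<in> (\<lambda>g. snd (snd g)) ` T" using x unfolding T_def by force
      qed
    qed
    finally show ?thesis .
  qed
  ultimately have "card (visits z J) = card (visits z I)" by simp
  then show ?thesis using fI(2) fJ(2) z(2) by simp
qed

section \<open>Boundaries of products of bisections\<close>

definition bnd where "bnd = delta2 G ` chains"

lemma bndI: "f \<in> chains \<Longrightarrow> delta2 G f = a \<Longrightarrow> a \<in> bnd"
  by (auto simp: bnd_def)

lemma chains_open:
  assumes "f \<in> chains"
  shows "openin CT {w \<in> topspace CT. f w \<in> V}"
  using assms unfolding chains_def Cc_def continuous_map_def by simp

lemma Hausdorff_CT: "Hausdorff_space CT"
  unfolding composable_top_def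
  by (intro Hausdorff_space_subtopology) (simp add: Hausdorff_space_prod_topology Hausdorff_G)

text \<open>A compact open set is closed in a Hausdorff space, so its indicator is continuous and
  has the set itself as support.\<close>

lemma chains_indicator:
  assumes "openin CT S" "compactin CT S"
  shows "(indicator S :: _ \<Rightarrow> int) \<in> chains"
proof -
  have S: "S \<subseteq> topspace CT" "closedin CT S"
    using assms compactin_imp_closedin[OF Hausdorff_CT] openin_subset by blast+
  have "openin CT {w \<in> topspace CT. (indicator S w :: int) \<in> V}" for V
  proof -
    have "{w \<in> topspace CT. (indicator S w :: int) \<in> V}
        = (if 1 \<in> V then S else {}) \<union> (if 0 \<in> V then topspace CT - S else {})"
      using S(1) by (auto simp: indicator_def split: if_splits)
    then show ?thesis using assms(1) S(2) by (auto intro: openin_Un simp: closedin_def)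
  qed
  moreover have "CT closure_of {w \<in> topspace CT. (indicator S w :: int) \<noteq> 0} = S"
  proof -
    have "{w \<in> topspace CT. (indicator S w :: int) \<noteq> 0} = S" using S(1) by (auto simp: indicator_def)
    then show ?thesis using S(2) by (simp add: closure_of_closedin)
  qed
  ultimately show ?thesis
    using S(1) assms(2) unfolding chains_def Cc_def continuous_map_def by (auto simp: indicator_def)
qed

lemma chains_minus:
  assumes f: "f \<in> chains" and g: "g \<in> chains"
  shows "(\<lambda>w. f w - g w) \<in> chains"
proof -
  have "openin CT {w \<in> topspace CT. f w - g w \<in> V}" for V
  proof -
    have gb: "openin CT {w \<in> topspace CT. g w = b}" for b using chains_open[OF g, of "{b}"] by simp
    \<comment> \<open>The difference is tested on each of the open sets where \<open>g\<close> takes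
      a fixed value \<open>b\<close>.\<close>
    have "{w \<in> topspace CT. f w - g w \<in> V}
        = (\<Union>b. {w \<in> topspace CT. f w \<in> (\<lambda>v. v + b) ` V} \<inter> {w \<in> topspace CT. g w = b})"
      by (auto simp: image_iff) (metis diff_add_cancel)
    also have "openin CT \<dots>"
      by (intro openin_Union ballI) (auto intro!: openin_Int chains_open[OF f] gb)
    finally show ?thesis .
  qed
  moreover have "compactin CT (CT closure_of {w \<in> topspace CT. f w - g w \<noteq> 0})"
  proof (rule closed_compactin)
    let ?F = "{w \<in> topspace CT. f w \<noteq> 0}" and ?G = "{w \<in> topspace CT. g w \<noteq> 0}"
    show "compactin CT (CT closure_of ?F \<union> CT closure_of ?G)"
      using f g by (intro compactin_Un) (auto simp: chains_def Cc_def)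
    show "CT closure_of {w \<in> topspace CT. f w - g w \<noteq> 0} \<subseteq> CT closure_of ?F \<union> CT closure_of ?G"
      unfolding closure_of_Un[symmetric] by (rule closure_of_mono) auto
  qed simp
  moreover have "\<forall>w. w \<notin> topspace CT \<longrightarrow> f w - g w = 0" using f g by (simp add: chains_def Cc_def)
  ultimately show ?thesis unfolding chains_def Cc_def continuous_map_def by simp
qed

lemma push_forward_superset:
  assumes "finite S" "{w \<in> topspace CT. d w = z \<and> f w \<noteq> 0} \<subseteq> S" "S \<subseteq> {w \<in> topspace CT. d w = z}"
  shows "push_forward CT d f z = sum f S"
  unfolding push_forward_def by (rule sum.mono_neutral_left) (use assms in auto)

text \<open>Each push-forward sums over the support of its own function, so additivity needs a
  common finite index set. Local injectivity of \<open>d\<close> and compact supports make the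
  relevant part of a fibre finite.\<close>

lemma push_forward_minus:
  assumes f: "f \<in> chains" and g: "g \<in> chains"
    and inj: "\<And>\<mu> \<nu> \<rho> \<tau>. inj_on d (topspace CT \<inter> Z \<mu> \<nu> \<times> Z \<rho> \<tau>)"
  shows "push_forward CT d (\<lambda>w. f w - g w) z = push_forward CT d f z - push_forward CT d g z"
proof -
  have fin: "finite {w \<in> topspace CT. h w \<noteq> 0 \<and> w \<in> {w. d w = z}}" if "h \<in> chains" for h
  proof (rule chain_support[OF that])
    fix \<mu> \<nu> \<rho> \<tau>
    let ?A = "{w. d w = z} \<inter> topspace CT \<inter> Z \<mu> \<nu> \<times> Z \<rho> \<tau>"
    have "finite (d ` ?A)" by (rule finite_subset[of _ "{z}"]) auto
    then show "finite ?A" by (rule finite_imageD) (rule inj_on_subset[OF inj], blast)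
  qed
  let ?S = "{w \<in> topspace CT. f w \<noteq> 0 \<and> w \<in> {w. d w = z}} \<union> {w \<in> topspace CT. g w \<noteq> 0 \<and> w \<in> {w. d w = z}}"
  have S: "finite ?S" using fin f g by blast
  have "push_forward CT d (\<lambda>w. f w - g w) z = (\<Sum>w\<in>?S. f w - g w)"
    by (rule push_forward_superset[OF S]) auto
  also have "\<dots> = sum f ?S - sum g ?S" by (rule sum_subtractf)
  also have "sum f ?S = push_forward CT d f z" by (rule push_forward_superset[OF S, symmetric]) auto
  also have "sum g ?S = push_forward CT d g z" by (rule push_forward_superset[OF S, symmetric]) auto
  finally show ?thesis .
qed

lemma bnd_minus:
  assumes "a \<in> bnd" "b \<in> bnd"
  shows "(\<lambda>x. a x - b x) \<in> bnd"
proof -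
  obtain f g where f: "f \<in> chains" "a = delta2 G f" and g: "g \<in> chains" "b = delta2 G g"
    using assms by (auto simp: bnd_def)
  have eq: "delta2 G (\<lambda>w. f w - g w) = (\<lambda>x. a x - b x)"
    by (rule ext) (simp add: f(2) g(2) delta2_eq push_forward_minus[OF f(1) g(1) fst_inj]
        push_forward_minus[OF f(1) g(1) snd_inj] push_forward_minus[OF f(1) g(1) comp_inj])
  show ?thesis
    by (rule bndI[OF chains_minus[OF f(1) g(1)] eq])
qed

lemma bnd_zero: "(\<lambda>x. 0) \<in> bnd"
proof -
  have "(\<lambda>w. indicator {} w :: int) \<in> chains" by (rule chains_indicator) auto
  then have "(\<lambda>w. 0 :: int) \<in> chains" by simp
  moreover have "delta2 G (\<lambda>w. 0) = (\<lambda>x. 0)" by (auto simp: delta2_def push_forward_def)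
  ultimately show ?thesis unfolding bnd_def by (metis imageI)
qed

lemma bnd_plus: "a \<in> bnd \<Longrightarrow> b \<in> bnd \<Longrightarrow> (\<lambda>x. a x + b x) \<in> bnd"
  using bnd_minus[of a "\<lambda>x. 0 - b x"] bnd_minus[OF bnd_zero, of b] by simp

lemma push_forward_indicator:
  assumes "inj_on d S" "S \<subseteq> topspace CT"
  shows "push_forward CT d (indicator S) = (indicator (d ` S) :: _ \<Rightarrow> int)"
proof
  fix g
  show "push_forward CT d (indicator S) g = (indicator (d ` S) g :: int)"
  proof (cases "g \<in> d ` S")
    case True
    then obtain w where w: "w \<in> S" "d w = g" by blast
    then have "{y \<in> topspace CT. d y = g \<and> (indicator S y :: int) \<noteq> 0} = {w}"
      using assms by (auto simp: indicator_def inj_on_def split: if_splits)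
    then show ?thesis using True w by (simp add: push_forward_def)
  next
    case False
    then have "{y \<in> topspace CT. d y = g \<and> (indicator S y :: int) \<noteq> 0} = {}"
      by (auto simp: indicator_def split: if_splits)
    then have "push_forward CT d (indicator S) g = (0 :: int)" by (simp only: push_forward_def sum.empty)
    then show ?thesis using False by simp
  qed
qed

definition bprod where "bprod A B = comp ` (topspace CT \<inter> A \<times> B)"

text \<open>If source and range differ at a coordinate \<open>i\<close>, words longer than
  \<open>i\<close> separate them on whole neighbourhoods. Closedness makes the composable part of a
  product of compact sets compact.\<close>

lemma closed_composable:
  "closedin (prod_topology (arrow_top G) (arrow_top G)) (topspace CT)"
proof -
  let ?P = "prod_topology (arrow_top G) (arrow_top G)"
  have "openin ?P (arr \<times> arr - topspace CT)"
  proof (subst openin_subopen, safe)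
    fix x m y x' m' y' assume *: "(x, m, y) \<in> arr" "(x', m', y') \<in> arr" "((x, m, y), (x', m', y')) \<notin> topspace CT"
    then have "y \<noteq> x'" by (auto simp: topspace_CT)
    then obtain i where i: "y i \<noteq> x' i" by blast
    obtain \<mu> \<nu> where a: "(x, m, y) \<in> Z \<mu> \<nu>" "Yp \<mu>" "Yp \<nu>" "N0 + Suc i \<le> length \<nu>"
      by (rule arrow_nbhd[OF *(1), of "N0 + Suc i"]) auto
    obtain \<rho> \<tau> where b: "(x', m', y') \<in> Z \<rho> \<tau>" "Yp \<rho>" "Yp \<tau>" "N0 + Suc i \<le> length \<rho>"
      by (rule arrow_nbhd[OF *(2), of "N0 + Suc i"]) auto
    have "Z \<mu> \<nu> \<times> Z \<rho> \<tau> \<inter> topspace CT = {}"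
    proof -
      have False if "(p, q, t) \<in> Z \<mu> \<nu>" "(t, q', p') \<in> Z \<rho> \<tau>" for p q t q' p'
      proof -
        have "t \<in> cyl \<nu>" "t \<in> cyl \<rho>" "y \<in> cyl \<nu>" "x' \<in> cyl \<rho>"
          using that a(1) b(1) by (auto simp: Z_eq_generator)
        then have e: "pre (length \<nu>) t = pre (length \<nu>) y" "pre (length \<rho>) t = pre (length \<rho>) x'"
          by (auto simp: cyl_def)
        have "t i = y i" using e(1) a(4) by (simp add: pre_eq_iff)
        moreover have "t i = x' i" using e(2) b(4) by (simp add: pre_eq_iff)
        ultimately show False using i by simp
      qed
      note disj = this
      show ?thesis by (auto simp: topspace_CT dest: disj)
    qed
    moreover have "openin ?P (Z \<mu> \<nu> \<times> Z \<rho> \<tau>)" using a b openin_Z_G by (simp add: openin_prod_Times_iff)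
    moreover have "Z \<mu> \<nu> \<times> Z \<rho> \<tau> \<subseteq> arr \<times> arr" using Z_arr a b by blast
    ultimately show "\<exists>T. openin ?P T \<and> ((x, m, y), (x', m', y')) \<in> T \<and> T \<subseteq> arr \<times> arr - topspace CT"
      using a(1) b(1) by (intro exI[of _ "Z \<mu> \<nu> \<times> Z \<rho> \<tau>"]) blast
  qed
  moreover have "topspace CT \<subseteq> arr \<times> arr" by (auto simp: topspace_CT)
  ultimately show ?thesis by (simp add: closedin_def)
qed

lemma composable_bisections:
  assumes "compact_open_G_set G A" "compact_open_G_set G B"
  shows "openin CT (topspace CT \<inter> A \<times> B)" "compactin CT (topspace CT \<inter> A \<times> B)"
proof -
  let ?P = "prod_topology (arrow_top G) (arrow_top G)"
  have A: "openin (arrow_top G) A" "compactin (arrow_top G) A" and B: "openin (arrow_top G) B" "compactin (arrow_top G) B"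
    using assms by (auto simp: compact_open_G_set_def)
  have sub: "A \<subseteq> arr" "B \<subseteq> arr" using A(1) B(1) openin_subset by fastforce+
  have CT: "CT = subtopology ?P (topspace CT)"
    unfolding composable_top_def by (metis subtopology_restrict topspace_subtopology)
  have "openin ?P (A \<times> B)" using A B by (simp add: openin_prod_Times_iff)
  then have "openin (subtopology ?P (topspace CT)) (topspace CT \<inter> A \<times> B)"
    unfolding openin_subtopology by blast
  then show "openin CT (topspace CT \<inter> A \<times> B)" using CT by simp
  have "compactin ?P (A \<times> B)" using A B by (simp add: compactin_Times)
  then have "compactin ?P (topspace CT \<inter> A \<times> B)"
    using closed_composable by (rule closed_Int_compactin[rotated])
  then have "compactin (subtopology ?P (topspace CT)) (topspace CT \<inter> A \<times> B)"
    by (simp add: compactin_subtopology)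
  then show "compactin CT (topspace CT \<inter> A \<times> B)" using CT by simp
qed

text \<open>The chain is the indicator of the composable part of \<open>A \<times> B\<close>. Since
  the source of \<open>A\<close> matches the range of \<open>B\<close>, it projects bijectively onto
  \<open>A\<close> and \<open>B\<close>, and composition maps it bijectively onto the
  product.\<close>

lemma bisection_boundary:
  assumes A: "compact_open_G_set G A" and B: "compact_open_G_set G B" and AB: "src G ` A = rng G ` B"
  shows "(\<lambda>g. indicator B g - indicator (bprod A B) g + indicator A g) \<in> bnd"
proof -
  let ?S = "topspace CT \<inter> A \<times> B"
  have inj: "inj_on (rng G) A" "inj_on (src G) A" "inj_on (rng G) B" "inj_on (src G) B"
    and sub: "A \<subseteq> arr" "B \<subseteq> arr"
    using A B openin_subset[of "arrow_top G"] by (auto simp: compact_open_G_set_def)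
  have "inj_on fst ?S"
  proof (rule inj_onI)
    fix w w' assume *: "w \<in> ?S" "w' \<in> ?S" "fst w = fst w'"
    then have "rng G (snd w) = rng G (snd w')" using composable_src_rng by (metis IntD1)
    then show "w = w'" using * inj(3) by (auto simp: inj_on_def prod_eq_iff mem_Times_iff)
  qed
  moreover have "inj_on snd ?S"
  proof (rule inj_onI)
    fix w w' assume *: "w \<in> ?S" "w' \<in> ?S" "snd w = snd w'"
    then have "src G (fst w) = src G (fst w')" using composable_src_rng by (metis IntD1)
    then show "w = w'" using * inj(2) by (auto simp: inj_on_def prod_eq_iff mem_Times_iff)
  qed
  moreover have "inj_on comp ?S" by (rule comp_inj_on_bisections[OF inj(1,4)])
  ultimately have pf: "push_forward CT fst (indicator ?S) = (indicator (fst ` ?S) :: _ \<Rightarrow> int)"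
    "push_forward CT snd (indicator ?S) = (indicator (snd ` ?S) :: _ \<Rightarrow> int)"
    "push_forward CT comp (indicator ?S) = (indicator (comp ` ?S) :: _ \<Rightarrow> int)"
    by (auto intro!: push_forward_indicator)
  have "fst ` ?S = A"
  proof
    show "A \<subseteq> fst ` ?S"
    proof
      fix g assume g: "g \<in> A"
      then obtain h where "h \<in> B" "src G g = rng G h" using AB by (metis imageE imageI)
      then have "(g, h) \<in> ?S" using g sub by (auto simp: topspace_CT)
      then show "g \<in> fst ` ?S" by force
    qed
  qed auto
  moreover have "snd ` ?S = B"
  proof
    show "B \<subseteq> snd ` ?S"
    proof
      fix h assume h: "h \<in> B"
      then obtain g where "g \<in> A" "src G g = rng G h" using AB by (metis imageE imageI)
      then have "(g, h) \<in> ?S" using h sub by (auto simp: topspace_CT)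
      then show "h \<in> snd ` ?S" by force
    qed
  qed auto
  ultimately have eq: "delta2 G (indicator ?S) = (\<lambda>g. indicator B g - indicator (bprod A B) g + indicator A g)"
    by (auto simp: fun_eq_iff delta2_eq pf bprod_def)
  have mem: "(indicator ?S :: _ \<Rightarrow> int) \<in> chains"
    by (rule chains_indicator) (rule composable_bisections[OF A B])+
  show ?thesis by (rule bndI[OF mem eq])
qed

section \<open>The kernel of the index map\<close>

lemma graph_set_bisection: "\<alpha> \<in> carrier (full_group G) \<Longrightarrow>
    compact_open_G_set G (graph_set \<alpha>) \<and> src G ` graph_set \<alpha> = u ` Y \<and> rng G ` graph_set \<alpha> = u ` Y"
  using represents_graph_set unfolding carrier_iff represents_def by auto

text \<open>With \<open>bisection_boundary\<close> this yields additivity of the index map.\<close>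

lemma graph_set_bprod:
  assumes \<alpha>: "\<alpha> \<in> carrier (full_group G)" and \<beta>: "\<beta> \<in> carrier (full_group G)"
  shows "bprod (graph_set \<alpha>) (graph_set \<beta>) = graph_set (\<alpha> \<otimes>\<^bsub>full_group G\<^esub> \<beta>)"
proof -
  let ?\<gamma> = "\<alpha> \<otimes>\<^bsub>full_group G\<^esub> \<beta>"
  have in_prod: "(a, m + n, c) \<in> graph_set ?\<gamma>" if g: "(a, m, b) \<in> graph_set \<alpha>" "(b, n, c) \<in> graph_set \<beta>" for a m b n c
  proof -
    obtain \<nu>' \<mu>' where a: "moves \<alpha> \<nu>' \<mu>'" "b \<in> cyl \<nu>'" "m = int (length \<mu>') - int (length \<nu>')" "\<alpha> (u b) = u a"
      using g(1) graph_set_iff by blast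
    obtain \<nu> \<mu> where b: "moves \<beta> \<nu> \<mu>" "c \<in> cyl \<nu>" "n = int (length \<mu>) - int (length \<nu>)" "\<beta> (u c) = u b"
      using g(2) graph_set_iff by blast
    from b(2) obtain z where z: "c = conc \<nu> z" "conc \<nu> z \<in> X" by (rule cylE)
    have bz: "b = conc \<mu> z" using moves_apply[OF b(1) z(2)] b(4) z(1) by simp
    let ?k = "length \<nu>'"
    have c: "c \<in> cyl (\<nu> @ pre ?k z)" using in_cyl_pre[OF z(2), of "length \<nu> + ?k"] by (simp add: z(1) pre_conc_add)
    have "path (\<nu> @ pre ?k z)"
      using path_pre[OF z(2), of "length \<nu> + ?k"] b(1) Yp_not_Nil by (auto simp: pre_conc_add moves_def)
    then have "moves \<beta> (\<nu> @ pre ?k z) (\<mu> @ pre ?k z)" by (rule moves_extend[OF b(1)])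
    \<comment> \<open>The refined image word has length \<open>length \<mu>' + length \<mu>\<close>,
      so the lags of the two arrows add up.\<close>
    moreover obtain \<rho> where "moves \<alpha> (\<mu> @ pre ?k z) (\<mu>' @ \<rho>)" "length \<rho> = length \<mu>"
      using moves_at[OF a(1,2), of "length \<mu> + ?k"] by (auto simp: bz pre_conc_add)
    ultimately have "moves ?\<gamma> (\<nu> @ pre ?k z) (\<mu>' @ \<rho>)" "length \<rho> = length \<mu>"
      using moves_compose \<alpha> \<beta> by (auto simp: mult_full)
    moreover have "c \<in> Y" using graph_set_src[OF g(2)] by simp
    then have "?\<gamma> (u c) = u a" using a(4) b(4) \<alpha> \<beta> by (simp add: mult_full compose_def)
    ultimately show ?thesis using c a(3) b(3) unfolding graph_set_iff
      by (intro exI[of _ "\<nu> @ pre ?k z"] exI[of _ "\<mu>' @ \<rho>"]) simp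
  qed
  show ?thesis
  proof
    show "bprod (graph_set \<alpha>) (graph_set \<beta>) \<subseteq> graph_set ?\<gamma>"
      using in_prod by (auto simp: bprod_def topspace_CT)
    show "graph_set ?\<gamma> \<subseteq> bprod (graph_set \<alpha>) (graph_set \<beta>)"
    proof clarify
      fix a k c assume g: "(a, k, c) \<in> graph_set ?\<gamma>"
      then have "c \<in> Y" using graph_set_src by blast
      then obtain b n where b: "(b, n, c) \<in> graph_set \<beta>" using graph_set_total \<beta> carrier_iff by blast
      then have "b \<in> Y" using graph_set_src by blast
      then obtain a' m where a: "(a', m, b) \<in> graph_set \<alpha>" using graph_set_total \<alpha> carrier_iff by blast
      have e: "a' = a" "m + n = k" using graph_set_functional[OF in_prod[OF a b] g] by auto
      have "graph_set \<alpha> \<subseteq> arr" "graph_set \<beta> \<subseteq> arr" using openin_graph_set openin_G_iff by blast+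
      then have "((a', m, b), (b, n, c)) \<in> topspace CT" using a b by (auto simp: topspace_CT)
      then show "(a, k, c) \<in> bprod (graph_set \<alpha>) (graph_set \<beta>)"
        unfolding bprod_def using a b e by (intro image_eqI[of _ _ "((a', m, b), (b, n, c))"]) auto
    qed
  qed
qed

lemma Z_bisection:
  assumes "Yp \<mu>" "Yp \<nu>" "fin \<mu> = fin \<nu>"
  shows "compact_open_G_set G (Z \<mu> \<nu>)"
  unfolding compact_open_G_set_def using assms compactin_Z openin_Z_G inj_on_Z by blast

lemma Z_bprod:
  assumes "Yp \<mu>" "Yp \<nu>" "Yp \<rho>" "fin \<mu> = fin \<nu>" "fin \<nu> = fin \<rho>"
  shows "bprod (Z \<mu> \<nu>) (Z \<nu> \<rho>) = Z \<mu> \<rho>" "src G ` Z \<mu> \<nu> = rng G ` Z \<nu> \<rho>"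
proof -
  have c: "conc \<mu> z \<in> X \<longleftrightarrow> conc \<nu> z \<in> X" "conc \<rho> z \<in> X \<longleftrightarrow> conc \<nu> z \<in> X" for z
    using assms conc_X_cong Yp_path by metis+
  show "src G ` Z \<mu> \<nu> = rng G ` Z \<nu> \<rho>"
  proof -
    have "src G ` Z \<mu> \<nu> = {u (conc \<nu> z) | z. conc \<nu> z \<in> X}" by (auto simp: Z_def c image_iff)
    moreover have "rng G ` Z \<nu> \<rho> = {u (conc \<nu> z) | z. conc \<nu> z \<in> X}" by (auto simp: Z_def c image_iff)
    ultimately show ?thesis by simp
  qed
  show "bprod (Z \<mu> \<nu>) (Z \<nu> \<rho>) = Z \<mu> \<rho>"
  proof
    show "bprod (Z \<mu> \<nu>) (Z \<nu> \<rho>) \<subseteq> Z \<mu> \<rho>"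
      by (auto simp: bprod_def topspace_CT Z_def c)
    show "Z \<mu> \<rho> \<subseteq> bprod (Z \<mu> \<nu>) (Z \<nu> \<rho>)"
    proof
      fix g assume "g \<in> Z \<mu> \<rho>"
      then obtain z where z: "g = (conc \<mu> z, int (length \<mu>) - int (length \<rho>), conc \<rho> z)" "conc \<nu> z \<in> X"
        by (auto simp: Z_def c)
      let ?g = "(conc \<mu> z, int (length \<mu>) - int (length \<nu>), conc \<nu> z)"
      let ?h = "(conc \<nu> z, int (length \<nu>) - int (length \<rho>), conc \<rho> z)"
      have gh: "?g \<in> Z \<mu> \<nu>" "?h \<in> Z \<nu> \<rho>" using z(2) c by (auto simp: Z_def)
      then have "(?g, ?h) \<in> topspace CT" using Z_arr assms by (auto simp: topspace_CT)
      then show "g \<in> bprod (Z \<mu> \<nu>) (Z \<nu> \<rho>)"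
        unfolding bprod_def z(1) using gh by (intro image_eqI[of _ _ "(?g, ?h)"]) auto
    qed
  qed
qed

definition index_null where
  "index_null = {\<alpha> \<in> carrier (full_group G). (indicator (graph_set \<alpha>) :: _ \<Rightarrow> int) \<in> bnd}"

lemma graph_mult_bnd:
  assumes \<alpha>: "\<alpha> \<in> carrier (full_group G)" and \<beta>: "\<beta> \<in> carrier (full_group G)"
  shows "(\<lambda>g. indicator (graph_set \<beta>) g - indicator (graph_set (\<alpha> \<otimes>\<^bsub>full_group G\<^esub> \<beta>)) g
     + indicator (graph_set \<alpha>) g) \<in> bnd"
  using bisection_boundary[of "graph_set \<alpha>" "graph_set \<beta>"] graph_set_bisection[OF \<alpha>] graph_set_bisection[OF \<beta>]
  unfolding graph_set_bprod[OF \<alpha> \<beta>] by simp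

text \<open>The relation for the product of the identity with itself has three equal terms, two of
  which cancel.\<close>

lemma graph_one_bnd: "(indicator (graph_set \<one>\<^bsub>full_group G\<^esub>) :: _ \<Rightarrow> int) \<in> bnd"
proof -
  interpret F: group "full_group G" by (rule group_full)
  show ?thesis using graph_mult_bnd[OF F.one_closed F.one_closed] by simp
qed

lemma subgroup_index_null: "subgroup index_null (full_group G)"
proof -
  interpret F: group "full_group G" by (rule group_full)
  show ?thesis
  proof (rule F.subgroupI)
    show "index_null \<subseteq> carrier (full_group G)" by (auto simp: index_null_def)
    show "index_null \<noteq> {}" using graph_one_bnd by (auto simp: index_null_def)
    fix \<alpha> assume "\<alpha> \<in> index_null"
    then have \<alpha>: "\<alpha> \<in> carrier (full_group G)" "(indicator (graph_set \<alpha>) :: _ \<Rightarrow> int) \<in> bnd"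
      by (auto simp: index_null_def)
    show "inv\<^bsub>full_group G\<^esub> \<alpha> \<in> index_null"
      \<comment> \<open>With \<open>U\<close> for graphs: add the identity term to the relation for
        \<open>\<alpha> \<alpha>^-1\<close> and subtract \<open>U_\<alpha>\<close>; what remains is
        the graph of the inverse.\<close>
      using bnd_minus[OF bnd_plus[OF graph_mult_bnd[OF \<alpha>(1) F.inv_closed[OF \<alpha>(1)]] graph_one_bnd] \<alpha>(2)] \<alpha>
      by (simp add: index_null_def)
    fix \<beta> assume "\<beta> \<in> index_null"
    then have \<beta>: "\<beta> \<in> carrier (full_group G)" "(indicator (graph_set \<beta>) :: _ \<Rightarrow> int) \<in> bnd"
      by (auto simp: index_null_def)
    show "\<alpha> \<otimes>\<^bsub>full_group G\<^esub> \<beta> \<in> index_null"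
      using bnd_minus[OF bnd_plus[OF \<alpha>(2) \<beta>(2)] graph_mult_bnd[OF \<alpha>(1) \<beta>(1)]] \<alpha> \<beta>
      by (simp add: index_null_def)
  qed
qed

text \<open>The swap arises from the identity by cutting out the units over both cylinders and
  inserting the two arrows sets between them.\<close>

lemma graph_set_swap:
  assumes g: "good_pair \<mu> \<nu>"
  shows "indicator (graph_set (swap \<mu> \<nu>)) w = (indicator (Z \<mu> \<nu>) w + indicator (Z \<nu> \<mu>) w
     + indicator (graph_set \<one>\<^bsub>full_group G\<^esub>) w - indicator (Z \<mu> \<mu>) w - indicator (Z \<nu> \<nu>) w :: int)"
proof -
  have Yp: "Yp \<mu>" "Yp \<nu>" and par: "\<mu> \<parallel> \<nu>" using g by (auto simp: good_pair_def)
  have disj: "cyl \<mu> \<inter> cyl \<nu> = {}" using par by (rule cyl_disjoint)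
  obtain a m x where w: "w = (a, m, x)" by (cases w)
  have one: "(a, m, x) \<in> graph_set \<one>\<^bsub>full_group G\<^esub> \<longleftrightarrow> x \<in> Y \<and> a = x \<and> m = 0"
  proof -
    have "(x, 0, x) \<in> graph_set \<one>\<^bsub>full_group G\<^esub>" if "x \<in> Y"
      unfolding graph_set_iff one_full using moves_id[OF Yp_pre[OF that order_refl]] in_cyl_pre that Y_sub
      by (intro exI[of _ "pre N0 x"]) auto
    then show ?thesis using graph_set_functional graph_set_src by metis
  qed
  have diag: "(a, m, x) \<in> Z \<rho> \<rho> \<longleftrightarrow> x \<in> cyl \<rho> \<and> a = x \<and> m = 0" if "Yp \<rho>" for \<rho>
    by (auto simp: Z_diag unit_arrow_def cyl_def)
  have src: "(a, m, x) \<in> Z \<rho> \<tau> \<Longrightarrow> x \<in> cyl \<tau>" for \<rho> \<tau> unfolding Z_eq_generator by auto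
  have mv: "moves (swap \<mu> \<nu>) \<mu> \<nu>" "moves (swap \<mu> \<nu>) \<nu> \<mu>"
    using swap_moves[OF g Yp(1)] swap_moves[OF g Yp(2)] par by (auto simp: strict_prefix_def)
  have sub: "Z \<nu> \<mu> \<subseteq> graph_set (swap \<mu> \<nu>)" "Z \<mu> \<nu> \<subseteq> graph_set (swap \<mu> \<nu>)"
    unfolding graph_set_def using mv by blast+
  have ex: "\<exists>a' m'. (a', m', x) \<in> Z \<tau> \<rho>" if "x \<in> cyl \<rho>" "Yp \<rho>" "Yp \<tau>" "fin \<rho> = fin \<tau>" for \<rho> \<tau>
  proof -
    from \<open>x \<in> cyl \<rho>\<close> obtain z where "x = conc \<rho> z" "conc \<rho> z \<in> X" by (rule cylE)
    then show ?thesis using conc_X_cong[OF Yp_path Yp_path, OF that(2,3,4)] by (auto simp: Z_def)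
  qed
  have fin: "fin \<mu> = fin \<nu>" using g by (simp add: good_pair_def)
  consider "x \<in> cyl \<mu>" "x \<notin> cyl \<nu>" | "x \<in> cyl \<nu>" "x \<notin> cyl \<mu>" | "x \<notin> cyl \<mu>" "x \<notin> cyl \<nu>"
    using disj by blast
  then show ?thesis
  proof cases
    case 1
    obtain a' m' where "(a', m', x) \<in> Z \<nu> \<mu>" using ex[OF 1(1) Yp fin] by blast
    then have "(a, m, x) \<in> graph_set (swap \<mu> \<nu>) \<longleftrightarrow> (a, m, x) \<in> Z \<nu> \<mu>"
      using sub graph_set_functional by blast
    moreover have "x \<in> Y" using 1 cyl_Yp Yp by blast
    ultimately show ?thesis unfolding w indicator_def using 1 one diag[OF Yp(1)] diag[OF Yp(2)] src by auto
  next
    case 2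
    obtain a' m' where "(a', m', x) \<in> Z \<mu> \<nu>" using ex[OF 2(1) Yp(2,1) fin[symmetric]] by blast
    then have "(a, m, x) \<in> graph_set (swap \<mu> \<nu>) \<longleftrightarrow> (a, m, x) \<in> Z \<mu> \<nu>"
      using sub graph_set_functional by blast
    moreover have "x \<in> Y" using 2 cyl_Yp Yp by blast
    ultimately show ?thesis unfolding w indicator_def using 2 one diag[OF Yp(1)] diag[OF Yp(2)] src by auto
  next
    case 3
    have "(x, 0, x) \<in> graph_set (swap \<mu> \<nu>)" if x: "x \<in> Y"
    proof -
      define n where "n = pre (N0 + length \<mu> + length \<nu>) x"
      have n: "Yp n" "x \<in> cyl n" using x Yp_pre in_cyl_pre Y_sub by (auto simp: n_def)
      have "\<not> prefix \<mu> n" "\<not> prefix \<nu> n" using 3 x Y_sub by (auto simp: n_def prefix_pre_iff cyl_def)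
      moreover have "\<not> strict_prefix n \<mu>" "\<not> strict_prefix n \<nu>" by (auto simp: n_def dest: prefix_length_less)
      ultimately have "moves (swap \<mu> \<nu>) n n" using swap_moves[OF g n(1)] sw_other by metis
      then show ?thesis unfolding graph_set_iff using n swap_other[OF x 3]
        by (intro exI[of _ n]) simp
    qed
    then have "(a, m, x) \<in> graph_set (swap \<mu> \<nu>) \<longleftrightarrow> x \<in> Y \<and> a = x \<and> m = 0"
      using graph_set_functional graph_set_src by metis
    then show ?thesis unfolding w indicator_def using 3 one src by auto
  qed
qed

text \<open>\<open>Z \<mu> \<nu>\<close> and \<open>Z \<nu> \<mu>\<close> are inverse bisections, so
  their sum is homologous to the units over the cylinder of \<open>\<mu>\<close>; unit bisections
  are idempotent and hence bound.\<close>

lemma swap_index_null: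
  assumes g: "good_pair \<mu> \<nu>"
  shows "swap \<mu> \<nu> \<in> index_null"
proof -
  have Yp: "Yp \<mu>" "Yp \<nu>" "fin \<mu> = fin \<nu>" using g by (auto simp: good_pair_def)
  have p: "bprod (Z \<mu> \<nu>) (Z \<nu> \<mu>) = Z \<mu> \<mu>" "src G ` Z \<mu> \<nu> = rng G ` Z \<nu> \<mu>"
    using Z_bprod[OF Yp(1,2,1,3) Yp(3)[symmetric]] by auto
  have 1: "(\<lambda>w. indicator (Z \<nu> \<mu>) w - indicator (Z \<mu> \<mu>) w + indicator (Z \<mu> \<nu>) w) \<in> bnd"
    using bisection_boundary[OF Z_bisection[OF Yp] Z_bisection[OF Yp(2,1) Yp(3)[symmetric]] p(2)]
    unfolding p(1) .
  have q: "bprod (Z \<nu> \<nu>) (Z \<nu> \<nu>) = Z \<nu> \<nu>" "src G ` Z \<nu> \<nu> = rng G ` Z \<nu> \<nu>"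
    using Z_bprod[OF Yp(2,2,2) refl refl] by auto
  have 2: "(\<lambda>w. indicator (Z \<nu> \<nu>) w) \<in> bnd"
    using bisection_boundary[OF Z_bisection[OF Yp(2,2) refl] Z_bisection[OF Yp(2,2) refl] q(2)]
    unfolding q(1) by simp
  have "(\<lambda>w. indicator (Z \<nu> \<mu>) w - indicator (Z \<mu> \<mu>) w + indicator (Z \<mu> \<nu>) w
      + indicator (graph_set \<one>\<^bsub>full_group G\<^esub>) w - indicator (Z \<nu> \<nu>) w) \<in> bnd"
    by (rule bnd_minus[OF bnd_plus[OF 1 graph_one_bnd] 2])
  then have "(\<lambda>w. indicator (graph_set (swap \<mu> \<nu>)) w) \<in> bnd"
    unfolding graph_set_swap[OF g] by (simp add: algebra_simps)
  then show ?thesis using swap_carrier[OF g] by (simp add: index_null_def)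
qed

lemma boundaries1_G: "boundaries1 G = bnd"
  by (simp add: boundaries1_def bnd_def chains_def)

text \<open>The index is a coset of the boundaries, and since these are closed under sums and
  differences it is trivial exactly when the indicator is itself a boundary.\<close>

lemma full_group0_eq: "full_group0 G = index_null"
proof -
  have "index_map G \<alpha> = \<one>\<^bsub>H1 G\<^esub> \<longleftrightarrow> (indicator (graph_set \<alpha>) :: _ \<Rightarrow> int) \<in> bnd"
    if \<alpha>: "\<alpha> \<in> carrier (full_group G)" for \<alpha>
  proof -
    let ?i = "indicator (graph_set \<alpha>) :: _ \<Rightarrow> int"
    have coset: "index_map G \<alpha> = (\<lambda>h x. h x + ?i x) ` bnd"
      by (auto simp: index_map_def the_represents[OF \<alpha>] boundaries1_G r_coset_def cycles1_def Cc_def)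
    have one: "\<one>\<^bsub>H1 G\<^esub> = bnd" by (simp add: H1_def FactGroup_def boundaries1_G)
    show ?thesis unfolding coset one
    proof
      assume e: "(\<lambda>h x. h x + ?i x) ` bnd = bnd"
      have "(\<lambda>x. 0 + ?i x) \<in> (\<lambda>h x. h x + ?i x) ` bnd" using bnd_zero by (rule rev_image_eqI) simp
      then show "?i \<in> bnd" unfolding e by simp
    next
      assume i: "?i \<in> bnd"
      show "(\<lambda>h x. h x + ?i x) ` bnd = bnd"
      proof
        show "(\<lambda>h x. h x + ?i x) ` bnd \<subseteq> bnd" using bnd_plus[OF _ i] by blast
        show "bnd \<subseteq> (\<lambda>h x. h x + ?i x) ` bnd"
        proof
          fix h assume h: "h \<in> bnd"
          show "h \<in> (\<lambda>h x. h x + ?i x) ` bnd"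
            by (rule image_eqI[OF _ bnd_minus[OF h i]]) simp
        qed
      qed
    qed
  qed
  then show ?thesis by (auto simp: full_group0_def kernel_def index_null_def)
qed

text \<open>Here the two halves meet: a graph that bounds forces equal node counts on a tree pair,
  and equal counts suffice for a factorisation into swaps.\<close>

lemma index_null_generated: "index_null \<subseteq> generate (full_group G) swaps"
proof
  fix \<alpha> assume "\<alpha> \<in> index_null"
  then obtain f where \<alpha>: "\<alpha> \<in> carrier (full_group G)" and f: "f \<in> chains" "delta2 G f = indicator (graph_set \<alpha>)"
    by (auto simp: index_null_def bnd_def)
  obtain I J where t: "table \<alpha> I J" by (rule full_group_table[OF \<alpha>])
  show "\<alpha> \<in> generate (full_group G) swaps"
    by (rule table_generated[OF t \<alpha>]) (rule table_cnt_eq[OF \<alpha> t f])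
qed

lemma finitely_generated_by_transpositions:
  "\<exists>F. F \<subseteq> transpositions G \<and> finite F \<and> generate (full_group G) F = full_group0 G"
proof -
  interpret F: group "full_group G" by (rule group_full)
  obtain L where L: "swaps \<subseteq> generate (full_group G) (short_swaps L)" by (rule short_swaps_generate)
  have sc: "short_swaps L \<subseteq> carrier (full_group G)" using short_swaps_sub swaps_carrier by blast
  have "generate (full_group G) (short_swaps L) \<subseteq> index_null"
    using swap_index_null by (intro F.generate_subgroup_incl subgroup_index_null) (auto simp: short_swaps_def)
  moreover have "index_null \<subseteq> generate (full_group G) (short_swaps L)"
    using index_null_generated F.generate_subgroup_incl[OF L F.generate_is_subgroup[OF sc]] by blast
  moreover have "short_swaps L \<subseteq> transpositions G"
    using swap_transposition by (auto simp: short_swaps_def)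
  ultimately show ?thesis using finite_short_swaps full_group0_eq by blast
qed

end

text \<open>Openness gives a level at each point; compactness of the closed set \<open>Y\<close>
  makes it uniform.\<close>

lemma (in irred_graph) clopen_level:
  assumes "openin (sft D) Y" "closedin (sft D) Y"
  obtains N0 where "N0 > 0" "\<And>x y. x \<in> Y \<Longrightarrow> y \<in> X \<Longrightarrow> pre N0 y = pre N0 x \<Longrightarrow> y \<in> Y"
proof -
  have sub: "Y \<subseteq> X" and "\<forall>x\<in>Y. \<exists>n. \<forall>y\<in>X. pre n y = pre n x \<longrightarrow> y \<in> Y"
    using assms(1) unfolding openin_sft_iff by auto
  then obtain n where n: "\<And>x y. x \<in> Y \<Longrightarrow> y \<in> X \<Longrightarrow> pre (n x) y = pre (n x) x \<Longrightarrow> y \<in> Y" by metis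
  have "compactin (sft D) Y" by (rule closedin_compact_space[OF compact_sft assms(2)])
  moreover have "Y \<subseteq> \<Union> ((\<lambda>x. cyl (pre (n x) x)) ` Y)" using in_cyl_pre sub by blast
  ultimately obtain \<F> where "finite \<F>" "\<F> \<subseteq> (\<lambda>x. cyl (pre (n x) x)) ` Y" "Y \<subseteq> \<Union> \<F>"
    using openin_cyl unfolding compactin_def by (metis (no_types, lifting) imageE)
  then obtain V where V: "finite V" "V \<subseteq> Y" "Y \<subseteq> \<Union> ((\<lambda>x. cyl (pre (n x) x)) ` V)"
    by (metis (no_types, lifting) finite_subset_image)
  show ?thesis
  proof (rule that)
    \<comment> \<open>The sum bounds the finitely many levels, and the summand \<open>1\<close>
      makes the result positive even if all of them are \<open>0\<close>.\<close>
    show "0 < 1 + (\<Sum>x\<in>V. n x)" by simp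
    fix x y assume *: "x \<in> Y" "y \<in> X" "pre (1 + (\<Sum>x\<in>V. n x)) y = pre (1 + (\<Sum>x\<in>V. n x)) x"
    obtain v where v: "v \<in> V" "x \<in> cyl (pre (n v) v)" using V(3) *(1) by blast
    have "n v \<le> 1 + (\<Sum>x\<in>V. n x)" using member_le_sum[OF v(1), of n] V(1) by simp
    then have "pre (n v) y = pre (n v) x" using *(3) pre_eq_mono by blast
    also have "\<dots> = pre (n v) v" using v(2) by (simp add: cyl_def)
    finally show "y \<in> Y" using n V(2) v(1) *(2) by blast
  qed
qed

theorem theorem6p11:
  fixes D :: "('v, 'e) pre_digraph" and Y :: "(nat \<Rightarrow> 'e) set"
  assumes "fin_digraph D"
    and "irreducible_matrix (verts D) (adjacency D)"
    and "\<not> permutation_matrix (verts D) (adjacency D)"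
    and "openin (sft D) Y" and "closedin (sft D) Y" and "Y \<noteq> {}"
  shows "\<exists>F. F \<subseteq> transpositions (sft_reduction D Y) \<and> finite F \<and>
    generate (full_group (sft_reduction D Y)) F = full_group0 (sft_reduction D Y)"
proof -
  interpret irred_graph D
    using assms(1-3) by (intro irred_graph.intro irred_graph_axioms.intro)
  obtain N0 where N0: "N0 > 0" "\<And>x y. x \<in> Y \<Longrightarrow> y \<in> X \<Longrightarrow> pre N0 y = pre N0 x \<Longrightarrow> y \<in> Y"
    using clopen_level[OF assms(4,5)] by blast
  have "Y \<subseteq> X" using assms(4) openin_sft_iff by blast
  then interpret sft_clopen D Y N0
    using assms(6) N0 by unfold_locales
  show ?thesis by (rule finitely_generated_by_transpositions)
qed

end
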